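(* Let $V$ be a real vector space of finite dimension $d$, and let $f_1,\ldots,f_n$ be nonconstant affine linear functions on $V$ whose associated linear forms span the dual vector space $V^{\vee}$. Let $\mathcal{A}$ be the collection of affine hyperplanes $H_j=f_j^{-1}(0)\subseteq V$, $j\in\{1,\ldots,n\}$, let $\mathcal{M}(\mathcal{A})$ be the complement of the complexification of $\mathcal{A}$, and let $\mathcal{Z}(\mathcal{A})$ be the (in general non-Hausdorff) space obtained by gluing copies of $V$ indexed by the chambers of $\mathcal{A}$, both defined in the context. Then $\mathcal{M}(\mathcal{A})$ may be realized as the total space of a principal bundle over $\mathcal{Z}(\mathcal{A})$, in the category of real analytic prevarieties, with structure group naturally isomorphic to the additive group of the dual vector space $V^{\vee}$.
   Context: Complexified complement: $V^{\mathbb{C}}=V\otimes_{\mathbb{R}}\mathbb{C}$, $H_j^{\mathbb{C}}\subseteq V^{\mathbb{C}}$ is the zero set of the complexification $f_j^{\mathbb{C}}:V^{\mathbb{C}}\to\mathbb{C}$ of $f_j$, and $\mathcal{M}(\mathcal{A}) := V^{\mathbb{C}}\setminus\bigcup_{j=1}^n H_j^{\mathbb{C}}$, regarded as a real analytic manifold of dimension $2d$. The space $\mathcal{Z}(\mathcal{A})$: the chambers of $\mathcal{A}$ are the connected components of $V\setminus\bigcup_{j=1}^n H_j$. For each chamber $C$ let $V_C$ be a copy of $V$. Then $\mathcal{Z}(\mathcal{A})$ is obtained by gluing the $V_C$ along open subsets, where for chambers $C,C'$ the copies $V_C$ and $V_{C'}$ are glued, via the identity map of $V$, along the open set $$V_C\cap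 V_{C'}\cong V\setminus\bigcup_{H_j \text{ separates } C \text{ from } C'}H_j .$$ Thus the points of $V_C$ and $V_{C'}$ lying over $q\in V$ are identified if and only if $q$ lies on no hyperplane $H_j$ separating $C$ from $C'$. The $V_C$ form an open cover of $\mathcal{Z}(\mathcal{A})$ by copies of $V$, making it a real algebraic (in particular real analytic) prevariety of dimension $d$. "Prevariety" means that the space need not be Hausdorff in the analytic topology. The prevarieties appearing here are locally isomorphic to open subsets of $\mathbb{R}^m$, so they are real analytic manifolds except that the Hausdorff condition is dropped. A principal bundle with structure group $G$ in this category is a real analytic map $\mathcal{M}\to\mathcal{Z}$ together with a real analytic action of $G$ on $\mathcal{M}$ preserving the fibers, such that every point of $\mathcal{Z}$ has an open neighborhood $U$ over which $\mathcal{M}$ is $G$-equivariantly and real-analytically isomorphic to $U\times G$ over $U$. *)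

theory Defs
  imports "HOL-Analysis.Analysis"
begin

section \<open>Real analytic functions on \<open>\<real>\<^sup>m\<close>\<close>

text \<open>
  \<open>\<real>\<^sup>m\<close> is \<^const>\<open>Euclidean_space\<close> \<open>m\<close>, the sequences of reals vanishing from index \<open>m\<close> on.
  The multi-indices of the power series range over \<open>{..<m} \<rightarrow>\<^sub>E UNIV\<close>.  The predicate is only
  meant for \<open>S\<close> open in \<open>\<real>\<^sup>m\<close>, in which case the restriction to \<open>x \<in> S\<close> is harmless.
\<close>

definition real_analytic_on :: "nat \<Rightarrow> (nat \<Rightarrow> real) set \<Rightarrow> ((nat \<Rightarrow> real) \<Rightarrow> real) \<Rightarrow> bool" where
  "real_analytic_on m S g \<longleftrightarrow>
     (\<forall>a\<in>S. \<exists>r>0. \<exists>c :: (nat \<Rightarrow> nat) \<Rightarrow> real.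
        \<forall>x\<in>S. (\<forall>i<m. \<bar>x i - a i\<bar> < r) \<longrightarrow>
          ((\<lambda>\<alpha>. c \<alpha> * (\<Prod>i<m. (x i - a i) ^ \<alpha> i)) has_sum g x) ({..<m} \<rightarrow>\<^sub>E UNIV))"


section \<open>Real analytic prevarieties\<close>

text \<open>
  A real analytic prevariety is a set of points with an atlas of \<open>\<real>\<^sup>m\<close>-valued charts.  Its
  topology is the one determined by the atlas; it is not required to be Hausdorff.
\<close>

type_synonym 'p chart = "'p set \<times> ('p \<Rightarrow> nat \<Rightarrow> real)"

record 'p prevariety =
  points :: "'p set"
  pdim :: nat
  charts :: "'p chart set"

definition real_analytic_prevariety :: "'p prevariety \<Rightarrow> bool" where
  "real_analytic_prevariety X \<longleftrightarrow>
     (\<Union>(U, \<phi>)\<in>charts X. U) = points X \<and>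
     (\<forall>(U, \<phi>)\<in>charts X.
        inj_on \<phi> U \<and> openin (Euclidean_space (pdim X)) (\<phi> ` U)) \<and>
     (\<forall>(U, \<phi>)\<in>charts X. \<forall>(W, \<psi>)\<in>charts X.
        openin (Euclidean_space (pdim X)) (\<phi> ` (U \<inter> W)) \<and>
        (\<forall>i<pdim X. real_analytic_on (pdim X) (\<phi> ` (U \<inter> W)) (\<lambda>x. \<psi> (inv_into U \<phi> x) i)))"

definition atlas_open :: "'p prevariety \<Rightarrow> 'p set \<Rightarrow> bool" where
  "atlas_open X S \<longleftrightarrow> S \<subseteq> points X \<and>
     (\<forall>(U, \<phi>)\<in>charts X. openin (Euclidean_space (pdim X)) (\<phi> ` (U \<inter> S)))"

definition ptop :: "'p prevariety \<Rightarrow> 'p topology" where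
  "ptop X = topology (atlas_open X)"

lemma istopology_atlas_open:
  assumes "real_analytic_prevariety X"
  shows "istopology (atlas_open X)"
  unfolding istopology_def
proof (intro conjI allI impI)
  fix S T assume S: "atlas_open X S" and T: "atlas_open X T"
  have "openin (Euclidean_space (pdim X)) (\<phi> ` (U \<inter> (S \<inter> T)))" if "(U, \<phi>) \<in> charts X" for U \<phi>
  proof -
    have inj: "inj_on \<phi> U"
      using assms that by (auto simp: real_analytic_prevariety_def)
    have "\<phi> ` (U \<inter> (S \<inter> T)) = \<phi> ` ((U \<inter> S) \<inter> (U \<inter> T))"
      by (rule arg_cong[where f = "image \<phi>"]) blast
    also have "\<dots> = \<phi> ` (U \<inter> S) \<inter> \<phi> ` (U \<inter> T)"
      using inj by (intro inj_on_image_Int[where C = U]) auto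
    finally show ?thesis
      using S T that by (auto simp: atlas_open_def)
  qed
  then show "atlas_open X (S \<inter> T)"
    using S by (auto simp: atlas_open_def)
next
  fix \<K> assume K: "\<forall>S\<in>\<K>. atlas_open X S"
  have "openin (Euclidean_space (pdim X)) (\<phi> ` (U \<inter> \<Union>\<K>))" if "(U, \<phi>) \<in> charts X" for U \<phi>
  proof -
    have "openin (Euclidean_space (pdim X)) (\<Union>S\<in>\<K>. \<phi> ` (U \<inter> S))"
      using K that by (intro openin_Union) (auto simp: atlas_open_def)
    moreover have "\<phi> ` (U \<inter> \<Union>\<K>) = (\<Union>S\<in>\<K>. \<phi> ` (U \<inter> S))"
      by blast
    ultimately show ?thesis
      by simp
  qed
  then show "atlas_open X (\<Union>\<K>)"
    using K by (auto simp: atlas_open_def)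
qed

lemma openin_ptop:
  "real_analytic_prevariety X \<Longrightarrow> openin (ptop X) S \<longleftrightarrow> atlas_open X S"
  by (simp add: ptop_def topology_inverse' istopology_atlas_open)

lemma topspace_ptop:
  assumes "real_analytic_prevariety X"
  shows "topspace (ptop X) = points X"
proof (rule antisym)
  show "topspace (ptop X) \<subseteq> points X"
    using openin_ptop[OF assms, of "topspace (ptop X)"] by (simp add: atlas_open_def)
  have "openin (Euclidean_space (pdim X)) (\<phi> ` (U \<inter> points X))" if "(U, \<phi>) \<in> charts X" for U \<phi>
  proof -
    have "U \<inter> points X = U"
      using assms that by (fastforce simp: real_analytic_prevariety_def)
    then show ?thesis
      using assms that by (auto simp: real_analytic_prevariety_def)
  qed
  then have "openin (ptop X) (points X)"
    using assms by (auto simp: openin_ptop atlas_open_def)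
  then show "points X \<subseteq> topspace (ptop X)"
    by (rule openin_subset)
qed

definition real_analytic_map :: "'p prevariety \<Rightarrow> 'q prevariety \<Rightarrow> ('p \<Rightarrow> 'q) \<Rightarrow> bool" where
  "real_analytic_map X Y F \<longleftrightarrow>
     continuous_map (ptop X) (ptop Y) F \<and>
     (\<forall>(U, \<phi>)\<in>charts X. \<forall>(W, \<psi>)\<in>charts Y. \<forall>i<pdim Y.
        real_analytic_on (pdim X) (\<phi> ` (U \<inter> F -` W)) (\<lambda>x. \<psi> (F (inv_into U \<phi> x)) i))"

definition real_analytic_iso :: "'p prevariety \<Rightarrow> 'q prevariety \<Rightarrow> ('p \<Rightarrow> 'q) \<Rightarrow> bool" where
  "real_analytic_iso X Y F \<longleftrightarrow>
     real_analytic_map X Y F \<and>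
     (\<exists>G. real_analytic_map Y X G \<and>
        (\<forall>x\<in>points X. G (F x) = x) \<and> (\<forall>y\<in>points Y. F (G y) = y))"

definition open_subprevariety :: "'p prevariety \<Rightarrow> 'p set \<Rightarrow> 'p prevariety" where
  "open_subprevariety X S =
     \<lparr>points = points X \<inter> S, pdim = pdim X, charts = (\<lambda>(U, \<phi>). (U \<inter> S, \<phi>)) ` charts X\<rparr>"

definition append_coords ::
  "nat \<Rightarrow> ('p \<Rightarrow> nat \<Rightarrow> real) \<Rightarrow> ('q \<Rightarrow> nat \<Rightarrow> real) \<Rightarrow> 'p \<times> 'q \<Rightarrow> nat \<Rightarrow> real" where
  "append_coords m \<phi> \<psi> = (\<lambda>(x, y) i. if i < m then \<phi> x i else \<psi> y (i - m))"

definition product_prevariety :: "'p prevariety \<Rightarrow> 'q prevariety \<Rightarrow> ('p \<times> 'q) prevariety" where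
  "product_prevariety X Y =
     \<lparr>points = points X \<times> points Y, pdim = pdim X + pdim Y,
      charts = {(U \<times> W, append_coords (pdim X) \<phi> \<psi>) | U \<phi> W \<psi>.
                  (U, \<phi>) \<in> charts X \<and> (W, \<psi>) \<in> charts Y}\<rparr>"


section \<open>Principal bundles\<close>

text \<open>
  The structure group is written additively, but \<^class>\<open>group_add\<close> does not assume commutativity.
\<close>

definition real_analytic_group :: "'g::group_add prevariety \<Rightarrow> bool" where
  "real_analytic_group G \<longleftrightarrow>
     real_analytic_prevariety G \<and> points G = UNIV \<and>
     real_analytic_map (product_prevariety G G) G (\<lambda>(g, h). g + h) \<and>
     real_analytic_map G G uminus"

definition real_analytic_action ::
  "'g::group_add prevariety \<Rightarrow> 'm prevariety \<Rightarrow> ('g \<Rightarrow> 'm \<Rightarrow> 'm) \<Rightarrow> bool" where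
  "real_analytic_action G M act \<longleftrightarrow>
     real_analytic_map (product_prevariety G M) M (\<lambda>(g, x). act g x) \<and>
     (\<forall>x\<in>points M. act 0 x = x \<and> (\<forall>g h. act (g + h) x = act g (act h x)))"

definition principal_bundle ::
  "'g::group_add prevariety \<Rightarrow> 'm prevariety \<Rightarrow> 'z prevariety
    \<Rightarrow> ('m \<Rightarrow> 'z) \<Rightarrow> ('g \<Rightarrow> 'm \<Rightarrow> 'm) \<Rightarrow> bool" where
  "principal_bundle G M Z \<pi> act \<longleftrightarrow>
     real_analytic_group G \<and> real_analytic_prevariety M \<and> real_analytic_prevariety Z \<and>
     real_analytic_map M Z \<pi> \<and>
     real_analytic_action G M act \<and>
     (\<forall>g. \<forall>x\<in>points M. \<pi> (act g x) = \<pi> x) \<and>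
     (\<forall>z\<in>points Z. \<exists>U. openin (ptop Z) U \<and> z \<in> U \<and>
        (\<exists>\<Phi>. real_analytic_iso (open_subprevariety M (\<pi> -` U))
                 (product_prevariety (open_subprevariety Z U) G) \<Phi> \<and>
             (\<forall>x\<in>points M. \<pi> x \<in> U \<longrightarrow>
                fst (\<Phi> x) = \<pi> x \<and> (\<forall>g. \<Phi> (act g x) = (\<pi> x, g + snd (\<Phi> x))))))"


section \<open>Finite dimensional real vector spaces\<close>

definition linear_coordinates :: "('v::real_vector \<Rightarrow> nat \<Rightarrow> real) \<Rightarrow> bool" where
  "linear_coordinates \<phi> \<longleftrightarrow>
     (\<forall>i. linear (\<lambda>v. \<phi> v i)) \<and>
     bij_betw \<phi> UNIV (topspace (Euclidean_space (dim (UNIV :: 'v set))))"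

definition vector_prevariety :: "'v::real_vector prevariety" where
  "vector_prevariety =
     \<lparr>points = UNIV, pdim = dim (UNIV :: 'v set),
      charts = {(UNIV, \<phi>) | \<phi>. linear_coordinates \<phi>}\<rparr>"

typedef (overloaded) 'v dual_space = "{l :: 'v::real_vector \<Rightarrow> real. linear l}"
  morphisms dual_apply Dual
  by (auto intro: exI[of _ "\<lambda>_. 0"] linear_zero)

setup_lifting type_definition_dual_space

instantiation dual_space :: (real_vector) real_vector
begin

lift_definition zero_dual_space :: "'a dual_space" is "\<lambda>_. 0"
  by (rule linear_zero)

lift_definition plus_dual_space :: "'a dual_space \<Rightarrow> 'a dual_space \<Rightarrow> 'a dual_space"
  is "\<lambda>k l x. k x + l x"
  by (rule linear_compose_add)

lift_definition minus_dual_space :: "'a dual_space \<Rightarrow> 'a dual_space \<Rightarrow> 'a dual_space"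
  is "\<lambda>k l x. k x - l x"
  by (rule linear_compose_sub)

lift_definition uminus_dual_space :: "'a dual_space \<Rightarrow> 'a dual_space"
  is "\<lambda>l x. - l x"
  by (rule linear_compose_neg)

lift_definition scaleR_dual_space :: "real \<Rightarrow> 'a dual_space \<Rightarrow> 'a dual_space"
  is "\<lambda>c l x. c *\<^sub>R l x"
  by (rule linear_compose_scale_right)

instance
  by standard (transfer; simp add: algebra_simps)+

end


section \<open>Affine hyperplane arrangements\<close>

text \<open>
  The arrangement is given by the affine linear functions \<open>f 1, \<dots>, f n\<close>.
\<close>

definition affine_linear :: "('v::real_vector \<Rightarrow> real) \<Rightarrow> bool" where
  "affine_linear f \<longleftrightarrow> (\<exists>l c. linear l \<and> f = (\<lambda>x. l x + c))"

definition linear_form :: "('v::real_vector \<Rightarrow> real) \<Rightarrow> 'v dual_space" where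
  "linear_form f = Dual (\<lambda>x. f x - f 0)"

lemma dual_apply_linear_form:
  "affine_linear f \<Longrightarrow> dual_apply (linear_form f) x = f x - f 0"
  by (auto simp: affine_linear_def linear_form_def linear_0 Dual_inverse)

definition hyperplane :: "('v::real_vector \<Rightarrow> real) \<Rightarrow> 'v set" where
  "hyperplane f = {x. f x = 0}"

text \<open>
  The complexification of \<open>V\<close> is the type \<open>'v \<times> 'v\<close>, where \<open>(x, y)\<close> stands for \<open>x + \<i>y\<close>.
\<close>

definition complexification :: "('v::real_vector \<Rightarrow> real) \<Rightarrow> 'v \<times> 'v \<Rightarrow> complex" where
  "complexification f = (\<lambda>(x, y). of_real (f x) + \<i> * of_real (dual_apply (linear_form f) y))"

definition complex_hyperplane :: "('v::real_vector \<Rightarrow> real) \<Rightarrow> ('v \<times> 'v) set" where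
  "complex_hyperplane f = {z. complexification f z = 0}"

definition complexified_complement ::
  "(nat \<Rightarrow> 'v::real_vector \<Rightarrow> real) \<Rightarrow> nat \<Rightarrow> ('v \<times> 'v) prevariety" where
  "complexified_complement f n =
     open_subprevariety vector_prevariety (UNIV - (\<Union>j\<in>{1..n}. complex_hyperplane (f j)))"

definition chambers :: "(nat \<Rightarrow> 'v::real_vector \<Rightarrow> real) \<Rightarrow> nat \<Rightarrow> 'v set set" where
  "chambers f n = connected_components_of
     (subtopology (ptop vector_prevariety) (UNIV - (\<Union>j\<in>{1..n}. hyperplane (f j))))"

definition separates :: "('v::real_vector \<Rightarrow> real) \<Rightarrow> 'v set \<Rightarrow> 'v set \<Rightarrow> bool" where
  "separates f C C' \<longleftrightarrow>
     (\<forall>x\<in>C. f x < 0) \<and> (\<forall>x\<in>C'. 0 < f x) \<or> (\<forall>x\<in>C. 0 < f x) \<and> (\<forall>x\<in>C'. f x < 0)"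

text \<open>
  \<open>(C, q)\<close> is the point \<open>q\<close> of the copy \<open>V\<^sub>C\<close>.  A point of the glued space is a class of such pairs;
  all its members have the same second component.
\<close>

definition gluing ::
  "(nat \<Rightarrow> 'v::real_vector \<Rightarrow> real) \<Rightarrow> nat \<Rightarrow> (('v set \<times> 'v) \<times> ('v set \<times> 'v)) set" where
  "gluing f n =
     {((C, q), (C', q)) | C C' q. C \<in> chambers f n \<and> C' \<in> chambers f n \<and>
        (\<forall>j\<in>{1..n}. separates (f j) C C' \<longrightarrow> q \<notin> hyperplane (f j))}"

definition chamber_copy ::
  "(nat \<Rightarrow> 'v::real_vector \<Rightarrow> real) \<Rightarrow> nat \<Rightarrow> 'v set \<Rightarrow> ('v set \<times> 'v) set set" where
  "chamber_copy f n C = ({C} \<times> UNIV) // gluing f n"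

definition copy_point :: "'v set \<Rightarrow> ('v set \<times> 'v) set \<Rightarrow> 'v" where
  "copy_point C z = (THE q. (C, q) \<in> z)"

definition glued_space ::
  "(nat \<Rightarrow> 'v::real_vector \<Rightarrow> real) \<Rightarrow> nat \<Rightarrow> ('v set \<times> 'v) set prevariety" where
  "glued_space f n =
     \<lparr>points = (chambers f n \<times> UNIV) // gluing f n, pdim = dim (UNIV :: 'v set),
      charts = {(chamber_copy f n C, \<lambda>z. \<phi> (copy_point C z)) | C \<phi>.
                  C \<in> chambers f n \<and> linear_coordinates \<phi>}\<rparr>"

end

theory Submission
  imports Defs "HOL-Complex_Analysis.Complex_Analysis"
begin

text \<open>
  A point of \<open>\<M>(\<A>)\<close> is a pair \<open>(x, y)\<close>, standing for \<open>x + \<i>y\<close>, such that \<open>y\<close> is transversal to every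
  hyperplane through \<open>x\<close>.  Moving from \<open>x\<close> a little in the direction \<open>y\<close> leads into a chamber \<open>C\<close>, and the class
  of \<open>(C, x)\<close> in \<open>\<Z>(\<A>)\<close> depends only on the signs of \<open>C\<close> at the hyperplanes through \<open>x\<close>.  This defines the
  projection.  Its fibre is the open convex cone \<open>F\<close> of all \<open>y\<close> such that \<open>a\<^sub>j y > 0\<close> whenever \<open>f\<^sub>j x = 0\<close>, where
  \<open>a\<^sub>j\<close> is the linear part of \<open>f\<^sub>j\<close> multiplied by its sign on \<open>C\<close>.

  The fibre is identified with \<open>V\<^sup>\<or>\<close> by the gradient of a strictly convex function on \<open>F\<close>, namely
  \<open>y \<mapsto> \<Sum>\<^sub>j barrier (f\<^sub>j x) (a\<^sub>j y)\<close> with \<open>barrier u v = v\<^sup>2 / 2 + 1 / (r + v)\<close> and \<open>r = sqrt (u\<^sup>2 + v\<^sup>2)\<close>.  For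
  \<open>u \<noteq> 0\<close> the barrier is defined for all \<open>v\<close>, for \<open>u = 0\<close> only for \<open>v > 0\<close>, so that the single formula yields the
  correct domain over every \<open>x\<close>.  The gradient is injective by strict convexity (\<open>gradient_injective\<close>), and
  surjective because the function minus a linear form is coercive and tends to infinity at the boundary of the
  cone, so that it attains a minimum (\<open>gradient_surjective\<close>).  The dual space acts by translating gradients.

  The gradient depends on \<open>C\<close>, and the action must not.  The derivative \<open>slope u v = v - 1 / (r * (r + v))\<close> of the
  barrier satisfies \<open>slope u (- v) = - slope u v - 2 / u\<^sup>2\<close> (\<open>slope_minus\<close>).  Hence replacing \<open>C\<close> by another chamber
  with the same signs at the hyperplanes through \<open>x\<close> changes the gradient by a covector that depends only on \<open>x\<close>
  (\<open>gradient_transition\<close>), and translations are unaffected (\<open>act_eq\<close>).  Over the copy \<open>V\<^sub>C\<close> the map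
  \<open>(x, y) \<mapsto> ([(C, x)], gradient\<^sub>C x y)\<close> is an equivariant trivialization (\<open>trivialization\<close>).

  It remains to see that everything is real analytic.  The slope is analytic on its domain, since \<open>u\<^sup>2 + v\<^sup>2\<close> and
  \<open>r + v\<close> are positive there.  For the inverse of the gradient, one complexifies and solves by iterating a
  contraction: the Hessian is positive definite and its inverse serves as the fixed derivative in Newton's method
  (\<open>slope_system_solution\<close>, \<open>solve_analytic\<close>).  Convergence is uniform on a polydisc, so the solution extends to a
  holomorphic function.  To pass between power series and holomorphic extensions, a function is called
  holomorphic if it is bounded and holomorphic along holomorphic curves; such functions are closed under
  composition and uniform limits, and they have power series expansions (\<open>bounded_holomorphic_power_series\<close>).
\<close>

section \<open>Functions holomorphic along curves\<close>

definition polydisc :: "nat \<Rightarrow> (nat \<Rightarrow> complex) \<Rightarrow> real \<Rightarrow> (nat \<Rightarrow> complex) set" where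
  "polydisc m a r = {z. \<forall>i<m. norm (z i - a i) < r}"

text \<open>
  Holomorphy in several variables, tested along holomorphic curves: no derivative in several variables
  occurs, and stability under composition and uniform limits reduces to functions of one complex variable.
  Boundedness is included because the Schwarz lemma and the Cauchy estimates start from a bound.
\<close>

definition bounded_holomorphic ::
  "nat \<Rightarrow> (nat \<Rightarrow> complex) set \<Rightarrow> ((nat \<Rightarrow> complex) \<Rightarrow> complex) \<Rightarrow> bool" where
  "bounded_holomorphic m P F \<longleftrightarrow>
     (\<exists>M. \<forall>z\<in>P. norm (F z) \<le> M) \<and>
     (\<forall>U c. open U \<longrightarrow> (\<forall>i<m. (\<lambda>t. c t i) holomorphic_on U) \<longrightarrow> c ` U \<subseteq> P \<longrightarrow>
        (\<lambda>t. F (c t)) holomorphic_on U)"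

lemma polydisc_mono: "r \<le> s \<Longrightarrow> polydisc m a r \<subseteq> polydisc m a s"
  by (force simp: polydisc_def)

lemma centre_in_polydisc: "0 < r \<Longrightarrow> a \<in> polydisc m a r"
  by (simp add: polydisc_def)

lemma bounded_holomorphicI:
  assumes "\<And>z. z \<in> P \<Longrightarrow> norm (F z) \<le> M"
    and "\<And>U c. open U \<Longrightarrow> (\<And>i. i < m \<Longrightarrow> (\<lambda>t. c t i) holomorphic_on U) \<Longrightarrow> c ` U \<subseteq> P \<Longrightarrow>
        (\<lambda>t. F (c t)) holomorphic_on U"
  shows "bounded_holomorphic m P F"
  using assms unfolding bounded_holomorphic_def by blast

lemma bounded_holomorphic_bound:
  assumes "bounded_holomorphic m P F"
  obtains M where "0 < M" "\<And>z. z \<in> P \<Longrightarrow> norm (F z) < M"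
proof -
  obtain M where "\<forall>z\<in>P. norm (F z) \<le> M"
    using assms by (auto simp: bounded_holomorphic_def)
  then show thesis
    by (intro that[of "\<bar>M\<bar> + 1"]) (auto intro: le_less_trans)
qed

lemma bounded_holomorphic_curve:
  assumes "bounded_holomorphic m P F" "open U" "\<And>i. i < m \<Longrightarrow> (\<lambda>t. c t i) holomorphic_on U"
    and "\<And>t. t \<in> U \<Longrightarrow> c t \<in> P"
  shows "(\<lambda>t. F (c t)) holomorphic_on U"
  using assms unfolding bounded_holomorphic_def by blast

lemma bounded_holomorphic_subset:
  "bounded_holomorphic m P F \<Longrightarrow> Q \<subseteq> P \<Longrightarrow> bounded_holomorphic m Q F"
  unfolding bounded_holomorphic_def by (meson subset_eq)

lemma bounded_holomorphic_const: "bounded_holomorphic m P (\<lambda>_. k)"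
  by (rule bounded_holomorphicI[where M = "norm k"]) auto

lemma bounded_holomorphic_coordinate:
  assumes "i < m"
  shows "bounded_holomorphic m (polydisc m a r) (\<lambda>z. z i)"
proof (rule bounded_holomorphicI[where M = "norm (a i) + r"])
  fix z assume "z \<in> polydisc m a r"
  then have "norm (z i - a i) < r"
    using assms by (simp add: polydisc_def)
  then show "norm (z i) \<le> norm (a i) + r"
    using norm_triangle_ineq[of "a i" "z i - a i"] by simp
qed (use assms in auto)

lemma bounded_holomorphic_add:
  assumes "bounded_holomorphic m P F" "bounded_holomorphic m P G"
  shows "bounded_holomorphic m P (\<lambda>z. F z + G z)"
proof -
  obtain M N where M: "\<And>z. z \<in> P \<Longrightarrow> norm (F z) < M" and N: "\<And>z. z \<in> P \<Longrightarrow> norm (G z) < N"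
    using assms bounded_holomorphic_bound by metis
  show ?thesis
  proof (rule bounded_holomorphicI[where M = "M + N"])
    fix z assume "z \<in> P"
    then show "norm (F z + G z) \<le> M + N"
      using M[of z] N[of z] norm_triangle_ineq[of "F z" "G z"] by simp
  next
    fix U :: "complex set" and c
    assume "open U" "\<And>i. i < m \<Longrightarrow> (\<lambda>t. c t i) holomorphic_on U" "c ` U \<subseteq> P"
    then show "(\<lambda>t. F (c t) + G (c t)) holomorphic_on U"
      by (intro holomorphic_intros bounded_holomorphic_curve[OF assms(1)]
          bounded_holomorphic_curve[OF assms(2)]) auto
  qed
qed

lemma bounded_holomorphic_mult:
  assumes "bounded_holomorphic m P F" "bounded_holomorphic m P G"
  shows "bounded_holomorphic m P (\<lambda>z. F z * G z)"
proof -
  obtain M N where M: "0 < M" "\<And>z. z \<in> P \<Longrightarrow> norm (F z) < M" and N: "\<And>z. z \<in> P \<Longrightarrow> norm (G z) < N"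
    using assms bounded_holomorphic_bound by metis
  show ?thesis
  proof (rule bounded_holomorphicI[where M = "M * N"])
    fix z assume "z \<in> P"
    then show "norm (F z * G z) \<le> M * N"
      using M(1) M(2)[of z] N[of z] by (auto simp: norm_mult intro!: mult_mono)
  next
    fix U :: "complex set" and c
    assume "open U" "\<And>i. i < m \<Longrightarrow> (\<lambda>t. c t i) holomorphic_on U" "c ` U \<subseteq> P"
    then show "(\<lambda>t. F (c t) * G (c t)) holomorphic_on U"
      by (intro holomorphic_intros bounded_holomorphic_curve[OF assms(1)]
          bounded_holomorphic_curve[OF assms(2)]) auto
  qed
qed

lemma bounded_holomorphic_sum:
  "(\<And>k. k \<in> K \<Longrightarrow> bounded_holomorphic m P (F k)) \<Longrightarrow> bounded_holomorphic m P (\<lambda>z. \<Sum>k\<in>K. F k z)"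
  by (induction K rule: infinite_finite_induct)
    (auto intro: bounded_holomorphic_add bounded_holomorphic_const)

lemma bounded_holomorphic_prod:
  "(\<And>k. k \<in> K \<Longrightarrow> bounded_holomorphic m P (F k)) \<Longrightarrow> bounded_holomorphic m P (\<lambda>z. \<Prod>k\<in>K. F k z)"
  by (induction K rule: infinite_finite_induct)
    (auto intro: bounded_holomorphic_mult bounded_holomorphic_const)

lemma bounded_holomorphic_diff:
  assumes "bounded_holomorphic m P F" "bounded_holomorphic m P G"
  shows "bounded_holomorphic m P (\<lambda>z. F z - G z)"
  using bounded_holomorphic_add[OF assms(1) bounded_holomorphic_mult[OF
      bounded_holomorphic_const[where k = "- 1"] assms(2)]] by simp

lemma bounded_holomorphic_power:
  "bounded_holomorphic m P F \<Longrightarrow> bounded_holomorphic m P (\<lambda>z. F z ^ k)"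
  by (induction k) (auto intro: bounded_holomorphic_mult bounded_holomorphic_const)

lemma bounded_holomorphic_compose:
  assumes "bounded_holomorphic k Q F" "\<And>i. i < k \<Longrightarrow> bounded_holomorphic m P (\<lambda>z. G z i)"
    and "\<And>z. z \<in> P \<Longrightarrow> G z \<in> Q"
  shows "bounded_holomorphic m P (\<lambda>z. F (G z))"
proof -
  obtain M where M: "\<And>z. z \<in> Q \<Longrightarrow> norm (F z) < M"
    using assms(1) bounded_holomorphic_bound by metis
  show ?thesis
  proof (rule bounded_holomorphicI[where M = M])
    fix U :: "complex set" and c
    assume "open U" "\<And>i. i < m \<Longrightarrow> (\<lambda>t. c t i) holomorphic_on U" "c ` U \<subseteq> P"
    then show "(\<lambda>t. F (G (c t))) holomorphic_on U"
      by (intro bounded_holomorphic_curve[OF assms(1)] bounded_holomorphic_curve[OF assms(2)] assms(3))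
        auto
  qed (use M assms(3) in \<open>force intro: less_imp_le\<close>)
qed

lemma bounded_holomorphic_compose_one:
  assumes "\<phi> holomorphic_on D" "\<And>w. w \<in> D \<Longrightarrow> norm (\<phi> w) \<le> M"
    and "bounded_holomorphic m P F" "\<And>z. z \<in> P \<Longrightarrow> F z \<in> D"
  shows "bounded_holomorphic m P (\<lambda>z. \<phi> (F z))"
proof (rule bounded_holomorphicI[where M = M])
  fix U :: "complex set" and c
  assume "open U" "\<And>i. i < m \<Longrightarrow> (\<lambda>t. c t i) holomorphic_on U" "c ` U \<subseteq> P"
  moreover from this have "(\<lambda>t. F (c t)) holomorphic_on U"
    by (intro bounded_holomorphic_curve[OF assms(3)]) auto
  ultimately show "(\<lambda>t. \<phi> (F (c t))) holomorphic_on U"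
    using holomorphic_on_compose_gen[OF _ assms(1), of "\<lambda>t. F (c t)" U] assms(4)
    by (force simp: o_def)
qed (use assms in auto)

text \<open>
  Coordinates from \<open>m\<close> on are invisible to the hypothesis on a curve \<open>c\<close>, so a curve may jump in them.
  Composing with \<open>F\<close> gives a holomorphic, hence continuous, function, which cannot jump.
\<close>

lemma bounded_holomorphic_cong_coordinates:
  assumes "bounded_holomorphic m P F" "z \<in> P" "w \<in> P" "\<And>i. i < m \<Longrightarrow> z i = w i"
  shows "F z = F w"
proof -
  let ?c = "\<lambda>t::complex. if t = 0 then z else w"
  have "(\<lambda>t. F (?c t)) holomorphic_on UNIV"
  proof (rule bounded_holomorphic_curve[OF assms(1)])
    fix i assume "i < m"
    then have "(\<lambda>t. ?c t i) = (\<lambda>t. w i)"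
      using assms(4) by (auto simp: fun_eq_iff)
    then show "(\<lambda>t. ?c t i) holomorphic_on UNIV"
      by simp
  qed (use assms in auto)
  then have "isCont (\<lambda>t. F (?c t)) 0"
    using holomorphic_on_imp_continuous_on continuous_on_eq_continuous_at open_UNIV by blast
  then have "((\<lambda>t. F (?c t)) \<longlongrightarrow> F z) (at 0)"
    by (simp add: isCont_def)
  moreover have "((\<lambda>t. F (?c t)) \<longlongrightarrow> F w) (at 0)"
    by (rule tendsto_eventually) (auto simp: eventually_at_filter)
  ultimately show ?thesis
    using LIM_unique by blast
qed

lemma bounded_holomorphic_uniform_limit:
  assumes F: "eventually (\<lambda>n. bounded_holomorphic m P (F n)) A"
    and lim: "uniform_limit P F G A" and A: "A \<noteq> bot"
  shows "bounded_holomorphic m P G"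
proof -
  have "eventually (\<lambda>n. bounded_holomorphic m P (F n) \<and> (\<forall>z\<in>P. dist (F n z) (G z) < 1)) A"
    using F uniform_limitD[OF lim, of 1] by (auto intro: eventually_conj)
  then obtain n where n: "bounded_holomorphic m P (F n)" "\<And>z. z \<in> P \<Longrightarrow> dist (F n z) (G z) < 1"
    using A eventually_happens by blast
  obtain M where M: "\<And>z. z \<in> P \<Longrightarrow> norm (F n z) < M"
    using n bounded_holomorphic_bound by metis
  show ?thesis
  proof (rule bounded_holomorphicI[where M = "M + 1"])
    fix z assume z: "z \<in> P"
    have "norm (G z) \<le> norm (F n z) + dist (F n z) (G z)"
      by (metis dist_norm norm_minus_commute norm_triangle_sub)
    then show "norm (G z) \<le> M + 1"
      using M[OF z] n(2)[OF z] by simp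
  next
    fix U :: "complex set" and c
    assume U: "open U" and c: "\<And>i. i < m \<Longrightarrow> (\<lambda>t. c t i) holomorphic_on U" "c ` U \<subseteq> P"
    have hol: "eventually (\<lambda>n. (\<lambda>t. F n (c t)) holomorphic_on U) A"
      using F
    proof eventually_elim
      case (elim n)
      show ?case
        by (rule bounded_holomorphic_curve[OF elim U]) (use c in auto)
    qed
    have lim': "uniform_limit U (\<lambda>n t. F n (c t)) (\<lambda>t. G (c t)) A"
      using lim c(2) by (fastforce simp: uniform_limit_iff elim!: eventually_mono)
    have "(\<lambda>t. G (c t)) field_differentiable at t" if t: "t \<in> U" for t
    proof -
      obtain e where e: "0 < e" "cball t e \<subseteq> U"
        using U t open_contains_cball by blast
      have "eventually (\<lambda>n. continuous_on (cball t e) (\<lambda>t. F n (c t)) \<and>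
          (\<lambda>t. F n (c t)) holomorphic_on ball t e) A"
        using hol
        by eventually_elim
          (use e in \<open>meson ball_subset_cball holomorphic_on_imp_continuous_on holomorphic_on_subset\<close>)
      then have "(\<lambda>t. G (c t)) holomorphic_on ball t e"
        using holomorphic_uniform_limit[OF _ uniform_limit_on_subset[OF lim' e(2)] A] by blast
      then show ?thesis
        using e holomorphic_on_imp_differentiable_at[OF _ open_ball] by simp
    qed
    then show "(\<lambda>t. G (c t)) holomorphic_on U"
      by (simp add: holomorphic_on_def field_differentiable_at_within)
  qed
qed

text \<open>
  The Schwarz lemma on the complex line through \<open>a\<close> and \<open>z\<close> bounds the increment of \<open>F\<close> by its sup norm times
  the ratio of the distance of \<open>z\<close> from \<open>a\<close> to the radius, uniformly in the direction of the line.
\<close>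

lemma bounded_holomorphic_continuous_at_centre:
  assumes F: "bounded_holomorphic m (polydisc m a r) F" and r: "0 < r" and e: "0 < e"
  obtains s where "0 < s" "s \<le> r" "\<And>z. z \<in> polydisc m a s \<Longrightarrow> norm (F z - F a) < e"
proof -
  obtain M where M: "0 < M" "\<And>z. z \<in> polydisc m a r \<Longrightarrow> norm (F z) < M"
    using F bounded_holomorphic_bound by metis
  \<comment> \<open>\<open>q\<close> is the ratio of the radii; the increments are at most \<open>2 * M * q \<le> e / 2\<close>.\<close>
  define q where "q = min (1/2) (e / (4 * M))"
  have q: "0 < q" "q < 1" "2 * M * q < e"
    using M(1) e by (auto simp: q_def min_def field_simps)
  have "norm (F z - F a) < e" if z: "z \<in> polydisc m a (q * r)" for z
  proof -
    define g where "g t = (F (\<lambda>i. a i + t / of_real q * (z i - a i)) - F a) / of_real (2 * M)" for t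
    have in_P: "(\<lambda>i. a i + t / of_real q * (z i - a i)) \<in> polydisc m a r" if t: "norm t < 1" for t
    proof -
      have "norm (t / of_real q * (z i - a i)) < r" if "i < m" for i
      proof -
        have "norm (t / of_real q * (z i - a i)) = norm t * (norm (z i - a i) / q)"
          using q by (simp add: norm_mult norm_divide)
        also have "\<dots> \<le> 1 * (norm (z i - a i) / q)"
          using t q by (intro mult_right_mono) auto
        also have "\<dots> < r"
          using z q \<open>i < m\<close> by (simp add: polydisc_def field_simps)
        finally show ?thesis .
      qed
      then show ?thesis
        by (simp add: polydisc_def)
    qed
    have "g holomorphic_on ball 0 1"
      unfolding g_def using M(1) q(1)
      by (intro holomorphic_intros bounded_holomorphic_curve[OF F]) (auto intro: in_P[simplified])
    moreover have "norm (g t) < 1" if "norm t < 1" for t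
    proof -
      have "norm (F (\<lambda>i. a i + t / of_real q * (z i - a i)) - F a) < 2 * M"
        using M(2)[OF in_P[OF that]] M(2)[OF centre_in_polydisc[OF r]]
          norm_triangle_ineq4[of "F (\<lambda>i. a i + t / of_real q * (z i - a i))" "F a"] by linarith
      then show ?thesis
        using M(1) by (simp add: g_def norm_divide)
    qed
    moreover have "g 0 = 0"
      by (simp add: g_def)
    ultimately have "norm (g (of_real q)) \<le> norm (of_real q :: complex)"
      using q Schwarz_Lemma(1)[of g "of_real q"] by simp
    then have "norm (F z - F a) \<le> 2 * M * q"
      using M(1) q(1) by (simp add: g_def norm_divide field_simps)
    then show ?thesis
      using q(3) by simp
  qed
  moreover have "q * r \<le> r"
    using q r by simp
  ultimately show thesis
    using that[of "q * r"] q r by simp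
qed

section \<open>Power series in several complex variables\<close>

text \<open>
  Explicit in \<open>M\<close>, \<open>d\<close> and \<open>h\<close> only, so that difference quotients in one variable converge to the partial
  derivative uniformly in the other variables.
\<close>

lemma difference_quotient_bound:
  assumes f: "f holomorphic_on ball a d" and M: "\<And>w. w \<in> ball a d \<Longrightarrow> norm (f w) < M"
    and d: "0 < d" and h: "norm h < d / 4" "h \<noteq> 0"
  shows "norm ((f (a + h) - f a) / h - deriv f a) \<le> 32 * M / d\<^sup>2 * norm h"
proof -
  have M0: "0 < M"
    using M[of a] d by (meson centre_in_ball le_less_trans norm_ge_zero)
  have B: "norm ((deriv ^^ 2) f x) \<le> 32 * M / d\<^sup>2" if "x \<in> ball a (d/2)" for x
  proof -
    have sub: "cball x (d/4) \<subseteq> ball a d"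
    proof
      fix y assume "y \<in> cball x (d/4)"
      then show "y \<in> ball a d"
        using that d dist_triangle[of a y x] by (simp add: dist_commute)
    qed
    have "norm ((deriv ^^ 2) f x) \<le> fact 2 * M / (d/4)^2"
    proof (rule Cauchy_higher_deriv_bound)
      show "f holomorphic_on ball x (d/4)"
        using f sub ball_subset_cball by (meson holomorphic_on_subset order_trans)
      show "continuous_on (cball x (d/4)) f"
        using f sub by (meson holomorphic_on_imp_continuous_on holomorphic_on_subset)
      show "f w \<in> ball 0 M" if "w \<in> ball x (d/4)" for w
        using that sub M[of w] by (simp add: subset_eq)
    qed (use d in auto)
    then show ?thesis
      by (simp add: field_simps power2_eq_square)
  qed
  have "norm ((deriv ^^ 0) f (a + h) - (\<Sum>i\<le>1. (deriv ^^ i) f a * (a + h - a) ^ i / fact i))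
      \<le> 32 * M / d\<^sup>2 * norm (a + h - a) ^ Suc 1 / fact 1"
  proof (rule complex_Taylor)
    show "convex (ball a (d/2))"
      by simp
    fix i x assume x: "x \<in> ball a (d/2)"
    have "(deriv ^^ i) f holomorphic_on ball a d"
      using f by (intro holomorphic_higher_deriv) auto
    then have "((deriv ^^ i) f has_field_derivative deriv ((deriv ^^ i) f) x) (at x)"
      using x d by (intro holomorphic_derivI[where S = "ball a d"]) auto
    then show "((deriv ^^ i) f has_field_derivative (deriv ^^ Suc i) f x) (at x within ball a (d/2))"
      by (simp add: has_field_derivative_at_within)
  qed (use B d h in \<open>auto simp: dist_norm numeral_2_eq_2\<close>)
  then have "norm (f (a + h) - f a - deriv f a * h) \<le> 32 * M / d\<^sup>2 * norm h ^ 2"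
    by (simp add: numeral_2_eq_2 algebra_simps)
  moreover have "(f (a + h) - f a) / h - deriv f a = (f (a + h) - f a - deriv f a * h) / h"
    using h(2) by (simp add: field_simps)
  ultimately have "norm ((f (a + h) - f a) / h - deriv f a) \<le> 32 * M / d\<^sup>2 * norm h ^ 2 / norm h"
    by (simp only: norm_divide) (intro divide_right_mono, auto)
  then show ?thesis
    using h(2) by (simp add: power2_eq_square)
qed

definition last_deriv :: "nat \<Rightarrow> ((nat \<Rightarrow> complex) \<Rightarrow> complex) \<Rightarrow> (nat \<Rightarrow> complex) \<Rightarrow> complex" where
  "last_deriv m F z = deriv (\<lambda>w. F (z(m := w))) (z m)"

lemma last_deriv_power:
  "(last_deriv m ^^ k) F z = (deriv ^^ k) (\<lambda>w. F (z(m := w))) (z m)"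
proof (induction k arbitrary: z)
  case (Suc k)
  show ?case
    by (simp only: funpow.simps o_def last_deriv_def[of m "(last_deriv m ^^ k) F"] Suc.IH
        fun_upd_upd fun_upd_same)
qed auto

lemma slice_holomorphic:
  assumes F: "bounded_holomorphic (Suc m) (polydisc (Suc m) a r) F" and z: "z \<in> polydisc m a r"
  shows "(\<lambda>w. F (z(m := w))) holomorphic_on ball (a m) r"
proof (rule bounded_holomorphic_curve[OF F])
  fix i assume "i < Suc m"
  show "(\<lambda>w. (z(m := w)) i) holomorphic_on ball (a m) r"
    by (cases "i = m") auto
qed (use z in \<open>auto simp: polydisc_def less_Suc_eq dist_norm norm_minus_commute\<close>)

text \<open>
  The partial derivative is a uniform limit of difference quotients, which are combinations of translates of
  \<open>F\<close>.  Some room between the two polydiscs is used up by the translation and by the Cauchy estimate.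
\<close>

lemma bounded_holomorphic_last_deriv:
  assumes F: "bounded_holomorphic (Suc m) (polydisc (Suc m) a r) F" and s: "s < r"
  shows "bounded_holomorphic (Suc m) (polydisc (Suc m) a s) (last_deriv m F)"
proof -
  obtain M where M: "0 < M" "\<And>z. z \<in> polydisc (Suc m) a r \<Longrightarrow> norm (F z) < M"
    using F bounded_holomorphic_bound by metis
  define d where "d = r - s"
  have d: "0 < d"
    using s by (simp add: d_def)
  \<comment> \<open>Any null sequence with values in \<open>]0, d/4[\<close> would do.\<close>
  define h where "h n = d / (5 * (real n + 1))" for n
  have h: "0 < h n" "h n < d / 4" for n
    using d by (auto simp: h_def field_simps intro!: add_pos_nonneg)
  define Q where "Q n z = (F (z(m := z m + of_real (h n))) - F z) / of_real (h n)" for n z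
  have shift: "z(m := w) \<in> polydisc (Suc m) a r" if "z \<in> polydisc (Suc m) a s" "dist (z m) w < d" for z w
  proof -
    have "norm (w - a m) < r"
      using that norm_triangle_ineq[of "w - z m" "z m - a m"]
      by (auto simp: polydisc_def d_def dist_norm norm_minus_commute)
    then show ?thesis
      using that s by (force simp: polydisc_def)
  qed
  show ?thesis
  proof (rule bounded_holomorphic_uniform_limit[where F = Q and A = sequentially])
    have "bounded_holomorphic (Suc m) (polydisc (Suc m) a s) (Q n)" for n
    proof -
      have "bounded_holomorphic (Suc m) (polydisc (Suc m) a s) (\<lambda>z. F (z(m := z m + of_real (h n))))"
      proof (rule bounded_holomorphic_compose[OF F])
        fix i assume "i < Suc m"
        then show "bounded_holomorphic (Suc m) (polydisc (Suc m) a s)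
            (\<lambda>z. (z(m := z m + of_real (h n))) i)"
          by (cases "i = m")
            (auto intro!: bounded_holomorphic_add bounded_holomorphic_const bounded_holomorphic_coordinate)
      next
        fix z assume "z \<in> polydisc (Suc m) a s"
        then show "z(m := z m + of_real (h n)) \<in> polydisc (Suc m) a r"
          using h[of n] by (intro shift) (auto simp: dist_norm)
      qed
      moreover have "bounded_holomorphic (Suc m) (polydisc (Suc m) a s) F"
        using F polydisc_mono[of s r] s bounded_holomorphic_subset by (metis less_imp_le)
      ultimately have "bounded_holomorphic (Suc m) (polydisc (Suc m) a s)
         (\<lambda>z. (F (z(m := z m + of_real (h n))) - F z) * (1 / of_real (h n)))"
        by (intro bounded_holomorphic_mult bounded_holomorphic_diff bounded_holomorphic_const)
      then show ?thesis
        by (simp add: Q_def [abs_def])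
    qed
    then show "\<forall>\<^sub>F n in sequentially. bounded_holomorphic (Suc m) (polydisc (Suc m) a s) (Q n)"
      by simp
    have close: "dist (Q n z) (last_deriv m F z) \<le> 32 * M / d\<^sup>2 * h n"
      if z: "z \<in> polydisc (Suc m) a s" for n z
    proof -
      have "(\<lambda>w. F (z(m := w))) holomorphic_on ball (z m) d"
      proof (rule bounded_holomorphic_curve[OF F])
        fix i assume "i < Suc m"
        show "(\<lambda>w. (z(m := w)) i) holomorphic_on ball (z m) d"
          by (cases "i = m") auto
      qed (use shift[OF z] in auto)
      from difference_quotient_bound[OF this, of M "of_real (h n)"]
      have "norm ((F (z(m := z m + of_real (h n))) - F (z(m := z m))) / of_real (h n) - last_deriv m F z)
          \<le> 32 * M / d\<^sup>2 * norm (complex_of_real (h n))"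
        using h[of n] d M(2)[OF shift[OF z]] by (simp add: last_deriv_def)
      then show ?thesis
        using h[of n] by (simp add: Q_def dist_norm)
    qed
    have "(\<lambda>n. 32 * M / d\<^sup>2 * h n) \<longlonglongrightarrow> 0"
      unfolding h_def by real_asymp
    then have lim: "\<forall>\<^sub>F n in sequentially. 32 * M / d\<^sup>2 * h n < e" if "0 < e" for e
      using that order_tendstoD(2) by blast
    show "uniform_limit (polydisc (Suc m) a s) Q (last_deriv m F) sequentially"
      unfolding uniform_limit_iff
    proof (intro allI impI)
      fix e :: real assume "0 < e"
      from lim[OF this] show "\<forall>\<^sub>F n in sequentially. \<forall>z\<in>polydisc (Suc m) a s. dist (Q n z) (last_deriv m F z) < e"
        by eventually_elim (use close in \<open>blast intro: le_less_trans\<close>)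
    qed
  qed auto
qed

lemma bounded_holomorphic_last_deriv_power:
  assumes "bounded_holomorphic (Suc m) (polydisc (Suc m) a r) F" "s < r"
  shows "bounded_holomorphic (Suc m) (polydisc (Suc m) a s) ((last_deriv m ^^ k) F)"
  using assms(2)
proof (induction k arbitrary: s)
  case 0
  then show ?case
    using bounded_holomorphic_subset[OF assms(1) polydisc_mono[of s r]] by simp
next
  case (Suc k)
  have "bounded_holomorphic (Suc m) (polydisc (Suc m) a ((r + s) / 2)) ((last_deriv m ^^ k) F)"
    using Suc.prems by (intro Suc.IH) auto
  then show ?case
    using bounded_holomorphic_last_deriv[of m a "(r + s) / 2" "(last_deriv m ^^ k) F" s] Suc.prems
    by (simp add: o_def)
qed

lemma PiE_lessThan_Suc:
  "bij_betw (\<lambda>(k, \<beta>). \<beta>(m := k)) (UNIV \<times> ({..<m} \<rightarrow>\<^sub>E UNIV)) ({..<Suc m} \<rightarrow>\<^sub>E UNIV)"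
proof -
  have "inj_on (\<lambda>(k, \<beta>). \<beta>(m := k)) (UNIV \<times> ({..<m} \<rightarrow>\<^sub>E UNIV))"
    using inj_combinator[of m "{..<m}" "\<lambda>_. UNIV"] by simp
  moreover have "{..<Suc m} = insert m {..<m}"
    by auto
  ultimately show ?thesis
    by (simp add: bij_betw_def PiE_insert_eq)
qed

text \<open>
  Expand in the last variable: the coefficients are Taylor coefficients of slices of \<open>F\<close>, hence bounded
  holomorphic in the remaining variables, and are expanded by induction.  By the Cauchy estimate on the
  circle of radius \<open>2 * s\<close> the \<open>k\<close>-th of them is at most \<open>M / (2 * s) ^ k\<close>, so on the polydisc of radius \<open>s\<close>
  the terms are dominated by a geometric series of ratio \<open>1/2\<close>.  It doubles the bound in each variable, which
  explains \<open>M * 2 ^ m\<close>; the bound on the absolute sum is part of the induction because it permits the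
  rearrangement of the double series.
\<close>

theorem bounded_holomorphic_power_series:
  assumes "bounded_holomorphic m (polydisc m a r) F" "0 < s" "2 * s < r"
    and "\<And>z. z \<in> polydisc m a r \<Longrightarrow> norm (F z) \<le> M" "0 \<le> M"
  shows "\<exists>c. \<forall>z\<in>polydisc m a s. \<exists>B\<le>M * 2 ^ m.
     ((\<lambda>\<alpha>. norm (c \<alpha> * (\<Prod>i<m. (z i - a i) ^ \<alpha> i))) has_sum B) ({..<m} \<rightarrow>\<^sub>E UNIV) \<and>
     ((\<lambda>\<alpha>. c \<alpha> * (\<Prod>i<m. (z i - a i) ^ \<alpha> i)) has_sum F z) ({..<m} \<rightarrow>\<^sub>E UNIV)"
  using assms
proof (induction m arbitrary: F M r)
  case 0
  have "F z = F a" for z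
    by (rule bounded_holomorphic_cong_coordinates[OF 0(1)]) (simp_all add: polydisc_def)
  moreover have "norm (F a) \<le> M"
    by (rule 0(4)) (simp add: polydisc_def)
  ultimately show ?case
    by (intro exI[of _ "\<lambda>_. F a"])
      (auto intro!: exI[of _ "norm (F a)"] simp: has_sum_finite_iff)
next
  case (Suc m)
  let ?A = "{..<m} \<rightarrow>\<^sub>E (UNIV :: nat set)"
  define C where "C k z = (last_deriv m ^^ k) F (z(m := a m)) / fact k" for k z
  have slice: "(\<lambda>w. F (z(m := w))) holomorphic_on ball (a m) r" if "z \<in> polydisc m a r" for z
    using slice_holomorphic[OF Suc.prems(1) that] .
  \<comment> \<open>Differentiation shrinks the polydisc, so the coefficients live on a radius strictly between
    \<open>2 * s\<close>, as the induction hypothesis demands, and \<open>r\<close>.\<close>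
  define q where "q = (r + 2 * s) / 2"
  have q: "2 * s < q" "q < r"
    using Suc.prems by (auto simp: q_def)
  have C_hol: "bounded_holomorphic m (polydisc m a q) (C k)" for k
  proof -
    have "bounded_holomorphic m (polydisc m a q) (\<lambda>z. (last_deriv m ^^ k) F (z(m := a m)))"
    proof (rule bounded_holomorphic_compose[OF bounded_holomorphic_last_deriv_power[OF Suc.prems(1) q(2)]])
      fix i assume "i < Suc m"
      then show "bounded_holomorphic m (polydisc m a q) (\<lambda>z. (z(m := a m)) i)"
        by (cases "i = m") (auto intro: bounded_holomorphic_const bounded_holomorphic_coordinate)
    qed (use q Suc.prems in \<open>auto simp: polydisc_def\<close>)
    from bounded_holomorphic_mult[OF this bounded_holomorphic_const[where k = "1 / fact k"]]
    show ?thesis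
      by (simp add: C_def [abs_def])
  qed
  have C_bound: "norm (C k z) \<le> M / (2 * s) ^ k" if z: "z \<in> polydisc m a q" for k z
  proof -
    have zr: "z \<in> polydisc m a r"
      using z polydisc_mono[of q r] q by auto
    have sub: "cball (a m) (2 * s) \<subseteq> ball (a m) r"
      using Suc.prems by auto
    have "norm ((deriv ^^ k) (\<lambda>w. F (z(m := w))) (a m)) \<le> fact k * M / (2 * s) ^ k"
    proof (rule Cauchy_inequality)
      show "(\<lambda>w. F (z(m := w))) holomorphic_on ball (a m) (2 * s)"
        using slice[OF zr] sub ball_subset_cball by (meson holomorphic_on_subset order_trans)
      show "continuous_on (cball (a m) (2 * s)) (\<lambda>w. F (z(m := w)))"
        using slice[OF zr] sub by (meson holomorphic_on_imp_continuous_on holomorphic_on_subset)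
      fix x assume "norm (a m - x) = 2 * s"
      then have "z(m := x) \<in> polydisc (Suc m) a r"
        using zr Suc.prems by (auto simp: polydisc_def norm_minus_commute)
      then show "norm (F (z(m := x))) \<le> M"
        using Suc.prems by blast
    qed (use Suc.prems in auto)
    then show ?thesis
      by (simp add: C_def last_deriv_power norm_divide field_simps)
  qed
  define represents where "represents k c \<longleftrightarrow> (\<forall>z\<in>polydisc m a s. \<exists>B\<le>M / (2 * s) ^ k * 2 ^ m.
     ((\<lambda>\<alpha>. norm (c \<alpha> * (\<Prod>i<m. (z i - a i) ^ \<alpha> i))) has_sum B) ?A \<and>
     ((\<lambda>\<alpha>. c \<alpha> * (\<Prod>i<m. (z i - a i) ^ \<alpha> i)) has_sum C k z) ?A)" for k c
  have "\<exists>c. represents k c" for k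
    unfolding represents_def
    by (rule Suc.IH[OF C_hol _ _ C_bound]) (use Suc.prems q in auto)
  then obtain c where c: "\<And>k. represents k (c k)"
    by metis
  \<comment> \<open>A multi-index in \<open>Suc m\<close> variables is the exponent of the last variable together with a multi-index
    in the first \<open>m\<close> ones.\<close>
  define c' where "c' \<alpha> = c (\<alpha> m) (restrict \<alpha> {..<m})" for \<alpha>
  have reindex: "c' (\<beta>(m := k)) * (\<Prod>i<Suc m. (z i - a i) ^ (\<beta>(m := k)) i) =
      (c k \<beta> * (\<Prod>i<m. (z i - a i) ^ \<beta> i)) * (z m - a m) ^ k" if "\<beta> \<in> ?A" for k \<beta> and z :: "nat \<Rightarrow> complex"
  proof -
    have "restrict (\<beta>(m := k)) {..<m} = \<beta>"
      using that by (auto simp: PiE_def extensional_def restrict_def fun_eq_iff)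
    then show ?thesis
      by (simp add: c'_def)
  qed
  show ?case
  proof (intro exI[of _ c'] ballI)
    fix z assume z: "z \<in> polydisc (Suc m) a s"
    then have z': "z \<in> polydisc m a s" and zm: "norm (z m - a m) < s"
      by (auto simp: polydisc_def)
    then have zr: "z \<in> polydisc m a r"
      using polydisc_mono[of s r m a] Suc.prems by auto
    let ?f = "\<lambda>(k, \<beta>). (c k \<beta> * (\<Prod>i<m. (z i - a i) ^ \<beta> i)) * (z m - a m) ^ k"
    define B where "B k = infsum (\<lambda>\<beta>. norm (c k \<beta> * (\<Prod>i<m. (z i - a i) ^ \<beta> i))) ?A" for k
    have B: "B k \<le> M / (2 * s) ^ k * 2 ^ m"
      and B_sum: "((\<lambda>\<beta>. norm (c k \<beta> * (\<Prod>i<m. (z i - a i) ^ \<beta> i))) has_sum B k) ?A"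
      and C_sum: "((\<lambda>\<beta>. c k \<beta> * (\<Prod>i<m. (z i - a i) ^ \<beta> i)) has_sum C k z) ?A" for k
    proof -
      obtain b where b: "b \<le> M / (2 * s) ^ k * 2 ^ m"
        "((\<lambda>\<beta>. norm (c k \<beta> * (\<Prod>i<m. (z i - a i) ^ \<beta> i))) has_sum b) ?A"
        "((\<lambda>\<beta>. c k \<beta> * (\<Prod>i<m. (z i - a i) ^ \<beta> i)) has_sum C k z) ?A"
        using c[of k] z' unfolding represents_def by blast
      moreover have "B k = b"
        unfolding B_def by (rule infsumI[OF b(2)])
      ultimately show "B k \<le> M / (2 * s) ^ k * 2 ^ m"
        "((\<lambda>\<beta>. norm (c k \<beta> * (\<Prod>i<m. (z i - a i) ^ \<beta> i))) has_sum B k) ?A"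
        "((\<lambda>\<beta>. c k \<beta> * (\<Prod>i<m. (z i - a i) ^ \<beta> i)) has_sum C k z) ?A"
        by simp_all
    qed
    have B0: "0 \<le> B k" for k
      using B_sum by (rule has_sum_nonneg) auto
    define D where "D k = B k * norm (z m - a m) ^ k" for k
    have D: "0 \<le> D k" "D k \<le> M * 2 ^ m * (1/2) ^ k" for k
    proof -
      show "0 \<le> D k"
        using B0 by (simp add: D_def)
      have "D k \<le> (M / (2 * s) ^ k * 2 ^ m) * s ^ k"
        unfolding D_def using B[of k] zm Suc.prems by (intro mult_mono power_mono) auto
      also have "\<dots> = M * 2 ^ m * (1/2) ^ k"
        using Suc.prems by (simp add: power_mult_distrib power_divide)
      finally show "D k \<le> M * 2 ^ m * (1/2) ^ k" .
    qed
    have geo: "(\<lambda>k. M * 2 ^ m * (1/2) ^ k) sums (M * 2 ^ Suc m)"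
      using sums_mult[OF geometric_sums[of "1/2::real"], of "M * 2 ^ m"] by (simp add: mult_ac)
    have D_summable: "summable D"
      by (rule summable_comparison_test'[OF sums_summable[OF geo], of 0]) (use D in auto)
    then have D_has: "(D has_sum suminf D) UNIV"
      using D by (intro sums_nonneg_imp_has_sum) (auto simp: summable_sums)
    have D_le: "suminf D \<le> M * 2 ^ Suc m"
      using suminf_le[OF D(2) D_summable sums_summable[OF geo]] sums_unique[OF geo] by simp
    have norm_inner: "((\<lambda>\<beta>. norm (?f (k, \<beta>))) has_sum D k) ?A" for k
      using has_sum_cmult_left[OF B_sum[of k], of "norm (z m - a m) ^ k"]
      by (simp add: D_def norm_mult norm_power)
    have norm_summable: "(\<lambda>p. norm (?f p)) summable_on (UNIV \<times> ?A)"
      by (rule summable_on_SigmaI[OF norm_inner has_sum_imp_summable[OF D_has]]) auto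
    have norm_sum: "((\<lambda>p. norm (?f p)) has_sum suminf D) (UNIV \<times> ?A)"
      by (rule has_sum_SigmaI[OF norm_inner D_has norm_summable])
    have inner: "((\<lambda>\<beta>. ?f (k, \<beta>)) has_sum C k z * (z m - a m) ^ k) ?A" for k
      using has_sum_cmult_left[OF C_sum[of k], of "(z m - a m) ^ k"] by simp
    have C_sums: "(\<lambda>k. C k z * (z m - a m) ^ k) sums F z"
      using holomorphic_power_series[OF slice[OF zr], of "z m"] zm Suc.prems
      by (simp add: C_def last_deriv_power dist_norm norm_minus_commute)
    have "norm (C k z * (z m - a m) ^ k) \<le> D k" for k
    proof -
      have "norm (C k z) \<le> B k"
        by (rule norm_infsum_le[OF C_sum[of k] B_sum[of k]]) simp
      then show ?thesis
        by (simp add: D_def norm_mult norm_power mult_right_mono)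
    qed
    then have "summable (\<lambda>k. norm (C k z * (z m - a m) ^ k))"
      by (intro summable_comparison_test'[OF D_summable, of 0]) auto
    then have outer: "((\<lambda>k. C k z * (z m - a m) ^ k) has_sum F z) UNIV"
      using C_sums by (rule norm_summable_imp_has_sum)
    have sum: "(?f has_sum F z) (UNIV \<times> ?A)"
      by (rule has_sum_SigmaI[OF inner outer abs_summable_summable[OF norm_summable]])
    define T where "T \<alpha> = c' \<alpha> * (\<Prod>i<Suc m. (z i - a i) ^ \<alpha> i)" for \<alpha>
    have T: "T ((\<lambda>(k, \<beta>). \<beta>(m := k)) p) = ?f p" if p: "p \<in> UNIV \<times> ?A" for p
    proof -
      obtain k \<beta> where "p = (k, \<beta>)" "\<beta> \<in> ?A"
        using p by auto
      then show ?thesis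
        using reindex[of \<beta> k z] by (simp only: T_def split)
    qed
    have "((\<lambda>\<alpha>. norm (T \<alpha>)) has_sum suminf D) ({..<Suc m} \<rightarrow>\<^sub>E UNIV)"
      unfolding has_sum_reindex_bij_betw[OF PiE_lessThan_Suc, symmetric]
      using norm_sum T by (subst has_sum_cong[where g = "\<lambda>p. norm (?f p)"]) presburger+
    moreover have "(T has_sum F z) ({..<Suc m} \<rightarrow>\<^sub>E UNIV)"
      unfolding has_sum_reindex_bij_betw[OF PiE_lessThan_Suc, symmetric]
      using sum T by (subst has_sum_cong[where g = ?f]) presburger+
    ultimately show "\<exists>B\<le>M * 2 ^ Suc m.
      ((\<lambda>\<alpha>. norm (c' \<alpha> * (\<Prod>i<Suc m. (z i - a i) ^ \<alpha> i))) has_sum B) ({..<Suc m} \<rightarrow>\<^sub>E UNIV) \<and>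
      ((\<lambda>\<alpha>. c' \<alpha> * (\<Prod>i<Suc m. (z i - a i) ^ \<alpha> i)) has_sum F z) ({..<Suc m} \<rightarrow>\<^sub>E UNIV)"
      using D_le unfolding T_def by blast
  qed
qed

section \<open>Real analytic germs\<close>

lemma openin_Euclidean_space_box:
  "openin (Euclidean_space m) S \<longleftrightarrow>
     S \<subseteq> topspace (Euclidean_space m) \<and>
     (\<forall>a\<in>S. \<exists>r>0. \<forall>x\<in>topspace (Euclidean_space m). (\<forall>i<m. \<bar>x i - a i\<bar> < r) \<longrightarrow> x \<in> S)"
proof -
  define E :: "(nat \<Rightarrow> real) set" where "E = {x. \<forall>i\<ge>m. x i = 0}"
  have E: "Euclidean_space m = top_of_set E" "topspace (Euclidean_space m) = E"
    by (simp_all add: Euclidean_space_def E_def euclidean_product_topology)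
  show ?thesis
    unfolding E(2) unfolding E(1)
  proof (intro iffI conjI ballI)
    assume S: "openin (top_of_set E) S"
    then show "S \<subseteq> E"
      using openin_imp_subset by blast
    fix a assume a: "a \<in> S"
    obtain T where T: "open T" "S = E \<inter> T"
      using S by (auto simp: openin_open)
    have "openin (product_topology (\<lambda>i::nat. euclideanreal) UNIV) T"
      using T by (simp add: euclidean_product_topology)
    from product_topology_open_contains_basis[OF this, of a] a T
    obtain X where X: "a \<in> (\<Pi>\<^sub>E i\<in>UNIV. X i)" "\<And>i. open (X i)" "(\<Pi>\<^sub>E i\<in>UNIV. X i) \<subseteq> T"
      by auto
    then have "\<exists>e>0. ball (a i) e \<subseteq> X i" for i
      by (meson PiE_mem UNIV_I open_contains_ball)
    then obtain e where e: "\<And>i. 0 < e i" "\<And>i. ball (a i) (e i) \<subseteq> X i"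
      by metis
    define r where "r = Min (insert 1 (e ` {..<m}))"
    have r: "0 < r" "\<And>i. i < m \<Longrightarrow> r \<le> e i"
      using e(1) by (auto simp: r_def)
    show "\<exists>r>0. \<forall>x\<in>E. (\<forall>i<m. \<bar>x i - a i\<bar> < r) \<longrightarrow> x \<in> S"
    proof (intro exI[of _ r] conjI ballI impI r(1))
      fix x assume x: "x \<in> E" "\<forall>i<m. \<bar>x i - a i\<bar> < r"
      have "x i \<in> X i" for i
      proof (cases "i < m")
        case True
        then have "x i \<in> ball (a i) (e i)"
          using x(2) r(2) by (force simp: dist_real_def abs_minus_commute)
        then show ?thesis
          using e(2) by blast
      next
        case False
        then have "x i = a i"
          using x(1) a T(2) by (simp add: E_def)
        then show ?thesis
          using X(1) by auto
      qed
      then show "x \<in> S"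
        using X(3) x(1) T(2) by auto
    qed
  next
    assume *: "S \<subseteq> E \<and> (\<forall>a\<in>S. \<exists>r>0. \<forall>x\<in>E. (\<forall>i<m. \<bar>x i - a i\<bar> < r) \<longrightarrow> x \<in> S)"
    show "openin (top_of_set E) S"
    proof (subst openin_subopen, intro ballI)
      fix a assume a: "a \<in> S"
      with * obtain r where r: "r > 0" "\<forall>x\<in>E. (\<forall>i<m. \<bar>x i - a i\<bar> < r) \<longrightarrow> x \<in> S"
        by blast
      have "open (\<Inter>i<m. {x :: nat \<Rightarrow> real. \<bar>x i - a i\<bar> < r})"
        by (intro open_INT finite_lessThan ballI open_Collect_less continuous_intros
            continuous_on_product_coordinates)
      then show "\<exists>T. openin (top_of_set E) T \<and> a \<in> T \<and> T \<subseteq> S"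
        using r a * by (intro exI[of _ "E \<inter> (\<Inter>i<m. {x. \<bar>x i - a i\<bar> < r})"]) auto
    qed
  qed
qed

definition cvec :: "(nat \<Rightarrow> real) \<Rightarrow> nat \<Rightarrow> complex" where
  "cvec x = (\<lambda>i. of_real (x i))"

text \<open>
  Real analyticity at \<open>a\<close> in terms of a holomorphic extension instead of a power series.  In this form
  composition is immediate and no power series has to be substituted into another one.
\<close>

definition analytic_germ ::
  "nat \<Rightarrow> (nat \<Rightarrow> real) set \<Rightarrow> ((nat \<Rightarrow> real) \<Rightarrow> real) \<Rightarrow> (nat \<Rightarrow> real) \<Rightarrow> bool" where
  "analytic_germ m S g a \<longleftrightarrow>
     (\<exists>r>0. \<exists>F. bounded_holomorphic m (polydisc m (cvec a) r) F \<and>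
        (\<forall>x\<in>S. (\<forall>i<m. \<bar>x i - a i\<bar> < r) \<longrightarrow> F (cvec x) = of_real (g x)))"

lemma cvec_in_polydisc: "cvec x \<in> polydisc m (cvec a) r \<longleftrightarrow> (\<forall>i<m. \<bar>x i - a i\<bar> < r)"
proof -
  have "norm (complex_of_real (x i) - complex_of_real (a i)) = \<bar>x i - a i\<bar>" for i
    by (metis norm_of_real of_real_diff)
  then show ?thesis
    by (simp add: polydisc_def cvec_def)
qed

text \<open>
  The power series of the holomorphic extension may have complex coefficients, but at real points its real
  part is the series of the real parts.
\<close>

lemma real_analytic_on_if_germ:
  assumes "\<And>a. a \<in> S \<Longrightarrow> analytic_germ m S g a"
  shows "real_analytic_on m S g"
  unfolding real_analytic_on_def
proof
  fix a assume "a \<in> S"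
  from assms[OF this] obtain r F where r: "r > 0" and F: "bounded_holomorphic m (polydisc m (cvec a) r) F"
    and Fg: "\<And>x. x \<in> S \<Longrightarrow> \<forall>i<m. \<bar>x i - a i\<bar> < r \<Longrightarrow> F (cvec x) = of_real (g x)"
    unfolding analytic_germ_def by blast
  obtain M where "0 < M" "\<And>z. z \<in> polydisc m (cvec a) r \<Longrightarrow> norm (F z) < M"
    using bounded_holomorphic_bound[OF F] by blast
  with bounded_holomorphic_power_series[OF F, of "r/3" M] r
  obtain c where c: "\<And>z. z \<in> polydisc m (cvec a) (r/3) \<Longrightarrow>
     ((\<lambda>\<alpha>. c \<alpha> * (\<Prod>i<m. (z i - cvec a i) ^ \<alpha> i)) has_sum F z) ({..<m} \<rightarrow>\<^sub>E UNIV)"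
    by (auto simp: less_imp_le)
  show "\<exists>r>0. \<exists>c. \<forall>x\<in>S. (\<forall>i<m. \<bar>x i - a i\<bar> < r) \<longrightarrow>
      ((\<lambda>\<alpha>. c \<alpha> * (\<Prod>i<m. (x i - a i) ^ \<alpha> i)) has_sum g x) ({..<m} \<rightarrow>\<^sub>E UNIV)"
  proof (intro exI[of _ "r/3"] conjI exI[of _ "\<lambda>\<alpha>. Re (c \<alpha>)"] ballI impI)
    fix x assume x: "x \<in> S" "\<forall>i<m. \<bar>x i - a i\<bar> < r/3"
    have "F (cvec x) = of_real (g x)"
      using x r by (intro Fg) force+
    with has_sum_Re[OF c[of "cvec x"]] x(2)
    have "((\<lambda>\<alpha>. Re (c \<alpha> * (\<Prod>i<m. (cvec x i - cvec a i) ^ \<alpha> i))) has_sum g x) ({..<m} \<rightarrow>\<^sub>E UNIV)"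
      by (simp add: cvec_in_polydisc)
    moreover have "Re (c \<alpha> * (\<Prod>i<m. (cvec x i - cvec a i) ^ \<alpha> i)) =
        Re (c \<alpha>) * (\<Prod>i<m. (x i - a i) ^ \<alpha> i)" for \<alpha>
    proof -
      have "(\<Prod>i<m. (cvec x i - cvec a i) ^ \<alpha> i) = of_real (\<Prod>i<m. (x i - a i) ^ \<alpha> i)"
        by (simp add: cvec_def)
      then show ?thesis
        by (simp only: Re_complex_of_real times_complex.sel Im_complex_of_real mult_zero_right diff_zero)
    qed
    ultimately show "((\<lambda>\<alpha>. Re (c \<alpha>) * (\<Prod>i<m. (x i - a i) ^ \<alpha> i)) has_sum g x) ({..<m} \<rightarrow>\<^sub>E UNIV)"
      by simp
  qed (use r in auto)
qed

text \<open>
  Since \<open>S\<close> is open, the series converges at a point \<open>b\<close> of \<open>S\<close> all of whose coordinates differ from those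
  of \<open>a\<close> by the same \<open>t > 0\<close>.  Unordered convergence of reals is absolute, so the terms at \<open>b\<close> dominate those
  at every complex point of the polydisc of radius \<open>t\<close>, and the series converges there uniformly.
\<close>

lemma analytic_germ_if_real_analytic_on:
  assumes g: "real_analytic_on m S g" and S: "openin (Euclidean_space m) S" and a: "a \<in> S"
  shows "analytic_germ m S g a"
proof -
  let ?A = "{..<m} \<rightarrow>\<^sub>E (UNIV :: nat set)"
  obtain r c where r: "r > 0" and c: "\<And>x. x \<in> S \<Longrightarrow> \<forall>i<m. \<bar>x i - a i\<bar> < r \<Longrightarrow>
     ((\<lambda>\<alpha>. c \<alpha> * (\<Prod>i<m. (x i - a i) ^ \<alpha> i)) has_sum g x) ?A"
    using g a unfolding real_analytic_on_def by blast
  obtain s where s: "s > 0" "\<And>x. x \<in> topspace (Euclidean_space m) \<Longrightarrow> \<forall>i<m. \<bar>x i - a i\<bar> < s \<Longrightarrow> x \<in> S"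
    using S a unfolding openin_Euclidean_space_box by blast
  define t where "t = min r s / 2"
  have t: "0 < t" "t < r" "t < s"
    using r s(1) by (auto simp: t_def)
  define b where "b i = (if i < m then a i + t else 0)" for i
  have "b \<in> S"
    using t by (intro s(2)) (auto simp: b_def topspace_Euclidean_space)
  from c[OF this] t have "((\<lambda>\<alpha>. c \<alpha> * (\<Prod>i<m. (b i - a i) ^ \<alpha> i)) has_sum g b) ?A"
    by (simp add: b_def)
  then have "(\<lambda>\<alpha>. norm (c \<alpha> * (\<Prod>i<m. (b i - a i) ^ \<alpha> i))) summable_on ?A"
    by (intro summable_on_iff_abs_summable_on_real[THEN iffD1]) (rule has_sum_imp_summable)
  moreover have "norm (c \<alpha> * (\<Prod>i<m. (b i - a i) ^ \<alpha> i)) = \<bar>c \<alpha>\<bar> * (\<Prod>i<m. t ^ \<alpha> i)" for \<alpha>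
    using t by (simp add: b_def abs_mult abs_prod power_abs)
  ultimately have summable: "(\<lambda>\<alpha>. \<bar>c \<alpha>\<bar> * (\<Prod>i<m. t ^ \<alpha> i)) summable_on ?A"
    by simp
  define P where "P = polydisc m (cvec a) t"
  define u where "u \<alpha> z = of_real (c \<alpha>) * (\<Prod>i<m. (z i - cvec a i) ^ \<alpha> i)" for \<alpha> z
  define F where "F z = infsum (\<lambda>\<alpha>. u \<alpha> z) ?A" for z
  have u_bound: "norm (u \<alpha> z) \<le> \<bar>c \<alpha>\<bar> * (\<Prod>i<m. t ^ \<alpha> i)" if "z \<in> P" for \<alpha> z
    using that unfolding u_def norm_mult prod_norm[symmetric] norm_power norm_of_real P_def polydisc_def
    by (intro mult_left_mono prod_mono conjI power_mono) (auto simp: less_imp_le)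
  have "uniform_limit P (\<lambda>X z. \<Sum>\<alpha>\<in>X. u \<alpha> z) F (finite_subsets_at_top ?A)"
    unfolding F_def by (rule Weierstrass_m_test_general[OF u_bound summable])
  moreover have "bounded_holomorphic m P (\<lambda>z. \<Sum>\<alpha>\<in>X. u \<alpha> z)" for X
    unfolding u_def P_def
    by (intro bounded_holomorphic_sum bounded_holomorphic_mult bounded_holomorphic_const
        bounded_holomorphic_prod bounded_holomorphic_power bounded_holomorphic_diff
        bounded_holomorphic_coordinate) auto
  ultimately have "bounded_holomorphic m P F"
    by (intro bounded_holomorphic_uniform_limit[where A = "finite_subsets_at_top ?A"]) auto
  moreover have "F (cvec x) = of_real (g x)" if "x \<in> S" "\<forall>i<m. \<bar>x i - a i\<bar> < t" for x
  proof -
    have "\<forall>i<m. \<bar>x i - a i\<bar> < r"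
      using that(2) t(2) by force
    from has_sum_of_real[OF c[OF that(1) this], where 'a = complex]
    show ?thesis
      unfolding F_def u_def cvec_def by (intro infsumI) simp
  qed
  ultimately show ?thesis
    unfolding analytic_germ_def P_def by (intro exI[of _ t] conjI exI[of _ F] t(1)) auto
qed

lemma analytic_germ_mono: "analytic_germ m S g a \<Longrightarrow> T \<subseteq> S \<Longrightarrow> analytic_germ m T g a"
  unfolding analytic_germ_def by blast

lemma analytic_germ_cong:
  "analytic_germ m S g a \<Longrightarrow> (\<And>x. x \<in> S \<Longrightarrow> g x = h x) \<Longrightarrow> analytic_germ m S h a"
  unfolding analytic_germ_def by auto

lemma analytic_germ_local:
  assumes "analytic_germ m T g a" "0 < r"
    and "\<And>x. x \<in> S \<Longrightarrow> \<forall>i<m. \<bar>x i - a i\<bar> < r \<Longrightarrow> x \<in> T"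
  shows "analytic_germ m S g a"
proof -
  obtain s F where s: "s > 0" and F: "bounded_holomorphic m (polydisc m (cvec a) s) F"
    and Fg: "\<And>x. x \<in> T \<Longrightarrow> \<forall>i<m. \<bar>x i - a i\<bar> < s \<Longrightarrow> F (cvec x) = of_real (g x)"
    using assms(1) unfolding analytic_germ_def by blast
  show ?thesis
    unfolding analytic_germ_def
  proof (intro exI[of _ "min r s"] conjI exI[of _ F] ballI impI)
    show "bounded_holomorphic m (polydisc m (cvec a) (min r s)) F"
      using F by (rule bounded_holomorphic_subset) (simp add: polydisc_mono)
  qed (use assms s Fg in auto)
qed

lemma analytic_germ_const: "analytic_germ m S (\<lambda>_. k) a"
  unfolding analytic_germ_def
  by (intro exI[of _ 1] conjI exI[of _ "\<lambda>_. of_real k"] bounded_holomorphic_const) auto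

lemma analytic_germ_coordinate: "i < m \<Longrightarrow> analytic_germ m S (\<lambda>x. x i) a"
  unfolding analytic_germ_def
  by (intro exI[of _ 1] conjI exI[of _ "\<lambda>z. z i"] bounded_holomorphic_coordinate)
    (auto simp: cvec_def)

lemma analytic_germ_continuous:
  assumes "analytic_germ m S g a" "a \<in> S" "0 < e"
  obtains s where "0 < s" "\<And>x. x \<in> S \<Longrightarrow> \<forall>i<m. \<bar>x i - a i\<bar> < s \<Longrightarrow> \<bar>g x - g a\<bar> < e"
proof -
  obtain r F where r: "r > 0" and F: "bounded_holomorphic m (polydisc m (cvec a) r) F"
    and Fg: "\<And>x. x \<in> S \<Longrightarrow> \<forall>i<m. \<bar>x i - a i\<bar> < r \<Longrightarrow> F (cvec x) = of_real (g x)"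
    using assms(1) unfolding analytic_germ_def by blast
  obtain s where s: "0 < s" "s \<le> r" "\<And>z. z \<in> polydisc m (cvec a) s \<Longrightarrow> norm (F z - F (cvec a)) < e"
    using bounded_holomorphic_continuous_at_centre[OF F r assms(3)] by blast
  show thesis
  proof (rule that[OF s(1)])
    fix x assume x: "x \<in> S" "\<forall>i<m. \<bar>x i - a i\<bar> < s"
    have "norm (F (cvec x) - F (cvec a)) < e"
      using x(2) by (intro s(3)) (simp add: cvec_in_polydisc)
    moreover have "F (cvec x) = of_real (g x)" "F (cvec a) = of_real (g a)"
      using x s(2) r assms(2) by (auto intro!: Fg)
    ultimately show "\<bar>g x - g a\<bar> < e"
      by (metis norm_of_real of_real_diff)
  qed
qed

text \<open>
  The extensions compose as soon as the inner polydisc is so small that the extension of \<open>G\<close> maps it into the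
  polydisc of \<open>h\<close>; continuity at the centre provides such a radius.
\<close>

theorem analytic_germ_compose:
  assumes h: "analytic_germ k T h (G a)" and T: "T \<subseteq> topspace (Euclidean_space k)"
    and G: "\<And>i. i < k \<Longrightarrow> analytic_germ m S (\<lambda>x. G x i) a"
    and GS: "\<And>x. x \<in> S \<Longrightarrow> G x \<in> T" and a: "a \<in> S"
  shows "analytic_germ m S (\<lambda>x. h (G x)) a"
proof -
  obtain R H where R: "R > 0" and H: "bounded_holomorphic k (polydisc k (cvec (G a)) R) H"
    and Hh: "\<And>y. y \<in> T \<Longrightarrow> \<forall>i<k. \<bar>y i - G a i\<bar> < R \<Longrightarrow> H (cvec y) = of_real (h y)"
    using h unfolding analytic_germ_def by blast
  define extends where "extends i F s \<longleftrightarrow> s > 0 \<and> bounded_holomorphic m (polydisc m (cvec a) s) F \<and>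
      (\<forall>z\<in>polydisc m (cvec a) s. norm (F z - of_real (G a i)) < R) \<and>
      (\<forall>x\<in>S. (\<forall>i<m. \<bar>x i - a i\<bar> < s) \<longrightarrow> F (cvec x) = of_real (G x i))" for i F s
  have "\<exists>F s. extends i F s" if i: "i < k" for i
  proof -
    obtain r F where r: "r > 0" and F: "bounded_holomorphic m (polydisc m (cvec a) r) F"
      and Fg: "\<And>x. x \<in> S \<Longrightarrow> \<forall>i<m. \<bar>x i - a i\<bar> < r \<Longrightarrow> F (cvec x) = of_real (G x i)"
      using G[OF i] unfolding analytic_germ_def by blast
    obtain s where s: "0 < s" "s \<le> r" "\<And>z. z \<in> polydisc m (cvec a) s \<Longrightarrow> norm (F z - F (cvec a)) < R"
      using bounded_holomorphic_continuous_at_centre[OF F r R] by blast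
    have "F (cvec a) = of_real (G a i)"
      using r a by (intro Fg) auto
    have "extends i F s"
      unfolding extends_def
    proof (intro conjI ballI impI)
      show "norm (F z - of_real (G a i)) < R" if "z \<in> polydisc m (cvec a) s" for z
        using s(3)[OF that] \<open>F (cvec a) = of_real (G a i)\<close> by simp
      show "F (cvec x) = of_real (G x i)" if "x \<in> S" "\<forall>i<m. \<bar>x i - a i\<bar> < s" for x
        using that s(2) by (intro Fg) force+
    qed (use s(1) bounded_holomorphic_subset[OF F polydisc_mono[OF s(2)]] in simp_all)
    then show ?thesis
      by blast
  qed
  then obtain F r where "\<And>i. i < k \<Longrightarrow> extends i (F i) (r i)"
    by metis
  then have r: "\<And>i. i < k \<Longrightarrow> r i > 0"
    and F: "\<And>i. i < k \<Longrightarrow> bounded_holomorphic m (polydisc m (cvec a) (r i)) (F i)"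
    and F_near: "\<And>i z. i < k \<Longrightarrow> z \<in> polydisc m (cvec a) (r i) \<Longrightarrow> norm (F i z - of_real (G a i)) < R"
    and FG: "\<And>i x. i < k \<Longrightarrow> x \<in> S \<Longrightarrow> \<forall>j<m. \<bar>x j - a j\<bar> < r i \<Longrightarrow> F i (cvec x) = of_real (G x i)"
    unfolding extends_def by blast+
  define s where "s = Min (insert 1 (r ` {..<k}))"
  have s: "s > 0" "\<And>i. i < k \<Longrightarrow> s \<le> r i"
    using r by (auto simp: s_def)
  define V where "V z i = (if i < k then F i z else 0)" for z i
  have V_R: "V z \<in> polydisc k (cvec (G a)) R" if "z \<in> polydisc m (cvec a) s" for z
    unfolding polydisc_def
  proof (intro CollectI allI impI)
    fix i assume i: "i < k"
    have "z \<in> polydisc m (cvec a) (r i)"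
      using that polydisc_mono[OF s(2)[OF i]] by blast
    from F_near[OF i this] show "norm (V z i - cvec (G a) i) < R"
      using i by (simp add: V_def cvec_def)
  qed
  have "bounded_holomorphic m (polydisc m (cvec a) s) (\<lambda>z. H (V z))"
  proof (rule bounded_holomorphic_compose[OF H _ V_R])
    fix i assume "i < k"
    then show "bounded_holomorphic m (polydisc m (cvec a) s) (\<lambda>z. V z i)"
      using bounded_holomorphic_subset[OF F polydisc_mono[OF s(2)]] by (simp add: V_def)
  qed
  moreover have "H (V (cvec x)) = of_real (h (G x))" if x: "x \<in> S" "\<forall>i<m. \<bar>x i - a i\<bar> < s" for x
  proof -
    have *: "F i (cvec x) = of_real (G x i)" if "i < k" for i
      using x s(2)[OF that] by (intro FG[OF that]) force+
    have "G x i = 0" if "\<not> i < k" for i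
      using GS[OF x(1)] T that by (auto simp: topspace_Euclidean_space)
    then have V: "V (cvec x) = cvec (G x)"
      using * by (auto simp: V_def cvec_def fun_eq_iff)
    have "cvec x \<in> polydisc m (cvec a) s"
      unfolding cvec_in_polydisc by (rule x(2))
    from V_R[OF this] have "\<forall>i<k. \<bar>G x i - G a i\<bar> < R"
      unfolding V cvec_in_polydisc .
    from Hh[OF GS[OF x(1)] this] show ?thesis
      unfolding V .
  qed
  ultimately show ?thesis
    unfolding analytic_germ_def by (intro exI[of _ s] conjI exI[of _ "\<lambda>z. H (V z)"] s(1)) auto
qed

lemma analytic_germ_compose_one:
  assumes g: "analytic_germ m S g a" and a: "a \<in> S"
    and \<phi>: "\<phi> holomorphic_on ball (of_real (g a)) e" "0 < e"
    and \<psi>: "\<And>y. \<bar>y - g a\<bar> < e \<Longrightarrow> \<phi> (of_real y) = of_real (\<psi> y)"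
  shows "analytic_germ m S (\<lambda>x. \<psi> (g x)) a"
proof -
  obtain r F where r: "r > 0" and F: "bounded_holomorphic m (polydisc m (cvec a) r) F"
    and Fg: "\<And>x. x \<in> S \<Longrightarrow> \<forall>i<m. \<bar>x i - a i\<bar> < r \<Longrightarrow> F (cvec x) = of_real (g x)"
    using g unfolding analytic_germ_def by blast
  have Fa: "F (cvec a) = of_real (g a)"
    using a r by (intro Fg) auto
  obtain s where s: "0 < s" "s \<le> r" "\<And>z. z \<in> polydisc m (cvec a) s \<Longrightarrow> norm (F z - of_real (g a)) < e / 2"
    using bounded_holomorphic_continuous_at_centre[OF F r half_gt_zero[OF \<phi>(2)], unfolded Fa]
    by blast
  have "\<phi> holomorphic_on cball (of_real (g a)) (e/2)"
    using \<phi>(2) by (intro holomorphic_on_subset[OF \<phi>(1)]) auto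
  then have "bounded (\<phi> ` cball (of_real (g a)) (e/2))"
    by (intro compact_imp_bounded compact_continuous_image holomorphic_on_imp_continuous_on compact_cball)
  then obtain M where M: "\<And>w. w \<in> cball (of_real (g a)) (e/2) \<Longrightarrow> norm (\<phi> w) \<le> M"
    unfolding bounded_iff by (meson imageI)
  have "bounded_holomorphic m (polydisc m (cvec a) s) (\<lambda>z. \<phi> (F z))"
  proof (rule bounded_holomorphic_compose_one[where \<phi> = \<phi> and F = F and D = "ball (of_real (g a)) (e/2)" and M = M])
    show "\<phi> holomorphic_on ball (of_real (g a)) (e/2)"
      using \<phi>(2) by (intro holomorphic_on_subset[OF \<phi>(1)]) auto
    show "F z \<in> ball (of_real (g a)) (e/2)" if "z \<in> polydisc m (cvec a) s" for z
      using s(3)[OF that] by (simp add: dist_norm norm_minus_commute)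
    show "bounded_holomorphic m (polydisc m (cvec a) s) F"
      using F polydisc_mono[OF s(2)] by (rule bounded_holomorphic_subset)
  qed (use M in auto)
  moreover have "\<phi> (F (cvec x)) = of_real (\<psi> (g x))" if x: "x \<in> S" "\<forall>i<m. \<bar>x i - a i\<bar> < s" for x
  proof -
    have "F (cvec x) = of_real (g x)"
      using x s(2) by (intro Fg) force+
    moreover have "norm (F (cvec x) - of_real (g a)) < e / 2"
      using x(2) by (intro s(3)) (simp add: cvec_in_polydisc)
    ultimately have "\<bar>g x - g a\<bar> < e"
      using \<phi>(2) by (simp flip: of_real_diff)
    with \<psi> \<open>F (cvec x) = of_real (g x)\<close> show ?thesis
      by simp
  qed
  ultimately show ?thesis
    unfolding analytic_germ_def by (intro exI[of _ s] conjI exI[of _ "\<lambda>z. \<phi> (F z)"] s(1)) auto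
qed

lemma analytic_germ_add:
  assumes "analytic_germ m S g a" "analytic_germ m S h a"
  shows "analytic_germ m S (\<lambda>x. g x + h x) a"
proof -
  obtain r F where r: "r > 0" and F: "bounded_holomorphic m (polydisc m (cvec a) r) F"
    and Fg: "\<And>x. x \<in> S \<Longrightarrow> \<forall>i<m. \<bar>x i - a i\<bar> < r \<Longrightarrow> F (cvec x) = of_real (g x)"
    using assms(1) unfolding analytic_germ_def by blast
  obtain s H where s: "s > 0" and H: "bounded_holomorphic m (polydisc m (cvec a) s) H"
    and Hh: "\<And>x. x \<in> S \<Longrightarrow> \<forall>i<m. \<bar>x i - a i\<bar> < s \<Longrightarrow> H (cvec x) = of_real (h x)"
    using assms(2) unfolding analytic_germ_def by blast
  have "bounded_holomorphic m (polydisc m (cvec a) (min r s)) (\<lambda>z. F z + H z)"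
    by (intro bounded_holomorphic_add bounded_holomorphic_subset[OF F] bounded_holomorphic_subset[OF H]
        polydisc_mono) auto
  then show ?thesis
    unfolding analytic_germ_def using r s Fg Hh
    by (intro exI[of _ "min r s"] conjI exI[of _ "\<lambda>z. F z + H z"]) auto
qed

lemma analytic_germ_mult:
  assumes "analytic_germ m S g a" "analytic_germ m S h a"
  shows "analytic_germ m S (\<lambda>x. g x * h x) a"
proof -
  obtain r F where r: "r > 0" and F: "bounded_holomorphic m (polydisc m (cvec a) r) F"
    and Fg: "\<And>x. x \<in> S \<Longrightarrow> \<forall>i<m. \<bar>x i - a i\<bar> < r \<Longrightarrow> F (cvec x) = of_real (g x)"
    using assms(1) unfolding analytic_germ_def by blast
  obtain s H where s: "s > 0" and H: "bounded_holomorphic m (polydisc m (cvec a) s) H"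
    and Hh: "\<And>x. x \<in> S \<Longrightarrow> \<forall>i<m. \<bar>x i - a i\<bar> < s \<Longrightarrow> H (cvec x) = of_real (h x)"
    using assms(2) unfolding analytic_germ_def by blast
  have "bounded_holomorphic m (polydisc m (cvec a) (min r s)) (\<lambda>z. F z * H z)"
    by (intro bounded_holomorphic_mult bounded_holomorphic_subset[OF F] bounded_holomorphic_subset[OF H]
        polydisc_mono) auto
  then show ?thesis
    unfolding analytic_germ_def using r s Fg Hh
    by (intro exI[of _ "min r s"] conjI exI[of _ "\<lambda>z. F z * H z"]) auto
qed

lemma analytic_germ_sum:
  "(\<And>k. k \<in> K \<Longrightarrow> analytic_germ m S (g k) a) \<Longrightarrow> analytic_germ m S (\<lambda>x. \<Sum>k\<in>K. g k x) a"
  by (induction K rule: infinite_finite_induct) (auto intro: analytic_germ_add analytic_germ_const)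

lemma analytic_germ_inverse:
  assumes "analytic_germ m S g a" "a \<in> S" "g a \<noteq> 0"
  shows "analytic_germ m S (\<lambda>x. inverse (g x)) a"
proof (rule analytic_germ_compose_one[OF assms(1,2), where e = "\<bar>g a\<bar>" and \<phi> = inverse])
  show "inverse holomorphic_on ball (complex_of_real (g a)) \<bar>g a\<bar>"
    by (rule holomorphic_on_inverse[OF holomorphic_on_ident]) (auto simp: dist_norm)
qed (use assms in auto)

lemma analytic_germ_sqrt:
  assumes "analytic_germ m S g a" "a \<in> S" "0 < g a"
  shows "analytic_germ m S (\<lambda>x. sqrt (g x)) a"
proof (rule analytic_germ_compose_one[OF assms(1,2), where e = "g a" and \<phi> = csqrt])
  show "csqrt holomorphic_on ball (complex_of_real (g a)) (g a)"
  proof (rule holomorphic_on_subset[OF holomorphic_on_csqrt], rule subsetI)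
    fix z assume z: "z \<in> ball (complex_of_real (g a)) (g a)"
    have "\<bar>Re (complex_of_real (g a) - z)\<bar> < g a"
      using z abs_Re_le_cmod[of "complex_of_real (g a) - z"] by (auto simp: dist_norm)
    then show "z \<in> - \<real>\<^sub>\<le>\<^sub>0"
      by (auto simp: complex_nonpos_Reals_iff)
  qed
  show "csqrt (of_real y) = of_real (sqrt y)" if "\<bar>y - g a\<bar> < g a" for y
    using that by (intro of_real_sqrt[symmetric]) auto
qed (use assms in auto)

section \<open>A local criterion for real analytic maps\<close>

lemma analytic_germs_neighbourhood:
  assumes G: "\<And>i. i < k \<Longrightarrow> analytic_germ m S (\<lambda>x. G x i) a" and a: "a \<in> S" "G a \<in> T"
    and GS: "\<And>x. x \<in> S \<Longrightarrow> G x \<in> topspace (Euclidean_space k)"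
    and T: "openin (Euclidean_space k) T"
  obtains s where "0 < s" "\<And>x. x \<in> S \<Longrightarrow> \<forall>i<m. \<bar>x i - a i\<bar> < s \<Longrightarrow> G x \<in> T"
proof -
  obtain r where r: "r > 0" "\<And>y. y \<in> topspace (Euclidean_space k) \<Longrightarrow> \<forall>i<k. \<bar>y i - G a i\<bar> < r \<Longrightarrow> y \<in> T"
    using T a(2) unfolding openin_Euclidean_space_box by blast
  have "\<exists>s>0. \<forall>x\<in>S. (\<forall>j<m. \<bar>x j - a j\<bar> < s) \<longrightarrow> \<bar>G x i - G a i\<bar> < r" if "i < k" for i
    using analytic_germ_continuous[OF G[OF that] a(1) r(1)] by metis
  then obtain s where s: "\<And>i. i < k \<Longrightarrow> 0 < s i"
    "\<And>i x. i < k \<Longrightarrow> x \<in> S \<Longrightarrow> \<forall>j<m. \<bar>x j - a j\<bar> < s i \<Longrightarrow> \<bar>G x i - G a i\<bar> < r"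
    by metis
  define t where "t = Min (insert 1 (s ` {..<k}))"
  have t: "t > 0" "\<And>i. i < k \<Longrightarrow> t \<le> s i"
    using s(1) by (auto simp: t_def)
  show thesis
  proof (rule that[OF t(1)])
    fix x assume x: "x \<in> S" "\<forall>i<m. \<bar>x i - a i\<bar> < t"
    show "G x \<in> T"
    proof (rule r(2)[OF GS[OF x(1)]], intro allI impI)
      fix i assume i: "i < k"
      have "\<forall>j<m. \<bar>x j - a j\<bar> < s i"
        using x(2) t(2)[OF i] less_le_trans by blast
      then show "\<bar>G x i - G a i\<bar> < r"
        by (rule s(2)[OF i x(1)])
    qed
  qed
qed

lemma openin_analytic_preimage:
  assumes G: "\<And>i a. i < k \<Longrightarrow> a \<in> S \<Longrightarrow> analytic_germ m S (\<lambda>x. G x i) a"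
    and GS: "\<And>x. x \<in> S \<Longrightarrow> G x \<in> topspace (Euclidean_space k)"
    and S: "openin (Euclidean_space m) S" and T: "openin (Euclidean_space k) T"
  shows "openin (Euclidean_space m) {x \<in> S. G x \<in> T}"
  unfolding openin_Euclidean_space_box
proof (intro conjI ballI)
  show "{x \<in> S. G x \<in> T} \<subseteq> topspace (Euclidean_space m)"
    using S openin_subset by blast
  fix a assume a: "a \<in> {x \<in> S. G x \<in> T}"
  then obtain s where s: "0 < s" "\<And>x. x \<in> S \<Longrightarrow> \<forall>i<m. \<bar>x i - a i\<bar> < s \<Longrightarrow> G x \<in> T"
    using analytic_germs_neighbourhood[OF G _ _ GS T, of a] by blast
  obtain r where r: "r > 0" "\<forall>x\<in>topspace (Euclidean_space m). (\<forall>i<m. \<bar>x i - a i\<bar> < r) \<longrightarrow> x \<in> S"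
    using S a unfolding openin_Euclidean_space_box by blast
  show "\<exists>r>0. \<forall>x\<in>topspace (Euclidean_space m). (\<forall>i<m. \<bar>x i - a i\<bar> < r) \<longrightarrow> x \<in> {x \<in> S. G x \<in> T}"
    using r s by (intro exI[of _ "min r s"]) auto
qed

lemma
  assumes X: "real_analytic_prevariety X" and U: "(U, \<phi>) \<in> charts X"
  shows chart_subset_points: "U \<subseteq> points X"
    and chart_inj: "inj_on \<phi> U"
    and chart_image_open: "openin (Euclidean_space (pdim X)) (\<phi> ` U)"
proof -
  have "(\<Union>c\<in>charts X. fst c) = points X"
    using X by (simp add: real_analytic_prevariety_def case_prod_beta)
  then show "U \<subseteq> points X"
    using U by force
  have "\<forall>c\<in>charts X. inj_on (snd c) (fst c) \<and> openin (Euclidean_space (pdim X)) (snd c ` fst c)"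
    using X by (simp add: real_analytic_prevariety_def case_prod_beta)
  from bspec[OF this U] show "inj_on \<phi> U" "openin (Euclidean_space (pdim X)) (\<phi> ` U)"
    by simp_all
qed

lemma chart_in_topspace:
  "real_analytic_prevariety X \<Longrightarrow> (U, \<phi>) \<in> charts X \<Longrightarrow> p \<in> U \<Longrightarrow> \<phi> p \<in> topspace (Euclidean_space (pdim X))"
  by (rule subsetD[OF openin_subset[OF chart_image_open]]) auto

lemma chart_inv: "real_analytic_prevariety X \<Longrightarrow> (U, \<phi>) \<in> charts X \<Longrightarrow> p \<in> U \<Longrightarrow> inv_into U \<phi> (\<phi> p) = p"
  by (rule inv_into_f_f[OF chart_inj])

lemma
  assumes X: "real_analytic_prevariety X" and U: "(U, \<phi>) \<in> charts X" and W: "(W, \<psi>) \<in> charts X"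
  shows chart_overlap_open: "openin (Euclidean_space (pdim X)) (\<phi> ` (U \<inter> W))"
    and chart_transition_germ: "\<lbrakk>i < pdim X; a \<in> \<phi> ` (U \<inter> W)\<rbrakk> \<Longrightarrow>
      analytic_germ (pdim X) (\<phi> ` (U \<inter> W)) (\<lambda>x. \<psi> (inv_into U \<phi> x) i) a"
proof -
  have "\<forall>c\<in>charts X. \<forall>c'\<in>charts X. openin (Euclidean_space (pdim X)) (snd c ` (fst c \<inter> fst c')) \<and>
      (\<forall>i<pdim X. real_analytic_on (pdim X) (snd c ` (fst c \<inter> fst c')) (\<lambda>x. snd c' (inv_into (fst c) (snd c) x) i))"
    using X by (simp add: real_analytic_prevariety_def case_prod_beta)
  from bspec[OF bspec[OF this U] W]
  have overlap: "openin (Euclidean_space (pdim X)) (\<phi> ` (U \<inter> W))"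
    and analytic: "\<And>i. i < pdim X \<Longrightarrow>
      real_analytic_on (pdim X) (\<phi> ` (U \<inter> W)) (\<lambda>x. \<psi> (inv_into U \<phi> x) i)"
    by simp_all
  show "openin (Euclidean_space (pdim X)) (\<phi> ` (U \<inter> W))"
    by (rule overlap)
  show "analytic_germ (pdim X) (\<phi> ` (U \<inter> W)) (\<lambda>x. \<psi> (inv_into U \<phi> x) i) a"
    if "i < pdim X" "a \<in> \<phi> ` (U \<inter> W)"
    by (rule analytic_germ_if_real_analytic_on[OF analytic[OF that(1)] overlap that(2)])
qed

lemma point_in_chart:
  assumes "real_analytic_prevariety X" "p \<in> points X"
  obtains U \<phi> where "(U, \<phi>) \<in> charts X" "p \<in> U"
proof -
  have "p \<in> (\<Union>(U, \<phi>)\<in>charts X. U)"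
    using assms by (simp add: real_analytic_prevariety_def)
  then obtain c where "c \<in> charts X" "p \<in> fst c"
    by (auto simp: case_prod_beta)
  then show thesis
    using that[of "fst c" "snd c"] by simp
qed

text \<open>
  Openness is defined by testing all charts; transition maps are continuous, so a single chart suffices.
\<close>

lemma atlas_open_if_open_in_chart:
  assumes X: "real_analytic_prevariety X" and U: "(U, \<phi>) \<in> charts X" and A: "A \<subseteq> U"
    and open_A: "openin (Euclidean_space (pdim X)) (\<phi> ` A)"
  shows "atlas_open X A"
  unfolding atlas_open_def
proof (intro conjI ballI, goal_cases)
  case 1
  show ?case
    using A chart_subset_points[OF X U] by blast
next
  case (2 c)
  obtain W \<psi> where c: "c = (W, \<psi>)"
    by fastforce
  with 2 have W: "(W, \<psi>) \<in> charts X"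
    by simp
  have "openin (Euclidean_space (pdim X)) {y \<in> \<psi> ` (W \<inter> U). \<phi> (inv_into W \<psi> y) \<in> \<phi> ` A}"
    by (rule openin_analytic_preimage[OF chart_transition_germ[OF X W U] _ chart_overlap_open[OF X W U] open_A])
      (auto simp: chart_inv[OF X W] chart_in_topspace[OF X U])
  also have "{y \<in> \<psi> ` (W \<inter> U). \<phi> (inv_into W \<psi> y) \<in> \<phi> ` A} = \<psi> ` (W \<inter> A)"
  proof -
    have mem_A: "\<phi> p \<in> \<phi> ` A \<longleftrightarrow> p \<in> A" if "p \<in> U" for p
      using inj_on_image_mem_iff[OF chart_inj[OF X U] that A] .
    have "{x \<in> W \<inter> U. \<phi> (inv_into W \<psi> (\<psi> x)) \<in> \<phi> ` A} = {x \<in> W \<inter> U. x \<in> A}"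
      by (intro Collect_cong conj_cong refl) (simp add: chart_inv[OF X W] mem_A)
    moreover have "{x \<in> W \<inter> U. x \<in> A} = W \<inter> A"
      using A by blast
    moreover have "{y \<in> \<psi> ` (W \<inter> U). \<phi> (inv_into W \<psi> y) \<in> \<phi> ` A} =
        \<psi> ` {x \<in> W \<inter> U. \<phi> (inv_into W \<psi> (\<psi> x)) \<in> \<phi> ` A}"
      by blast
    ultimately show ?thesis
      by simp
  qed
  finally show ?case
    by (simp add: c)
qed

lemma atlas_open_chart:
  "real_analytic_prevariety X \<Longrightarrow> (U, \<phi>) \<in> charts X \<Longrightarrow> atlas_open X U"
  by (rule atlas_open_if_open_in_chart[OF _ _ subset_refl chart_image_open])

lemma atlas_open_Int:
  "real_analytic_prevariety X \<Longrightarrow> atlas_open X A \<Longrightarrow> atlas_open X B \<Longrightarrow> atlas_open X (A \<inter> B)"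
  using openin_Int[of "ptop X" A B] by (simp add: openin_ptop)

lemma atlas_open_chart_image:
  "atlas_open X A \<Longrightarrow> (U, \<phi>) \<in> charts X \<Longrightarrow> openin (Euclidean_space (pdim X)) (\<phi> ` (U \<inter> A))"
  unfolding atlas_open_def by (drule conjunct2, drule (1) bspec) simp

lemma atlas_openI:
  assumes X: "real_analytic_prevariety X"
    and "\<And>p. p \<in> A \<Longrightarrow> \<exists>N. atlas_open X N \<and> p \<in> N \<and> N \<subseteq> A"
  shows "atlas_open X A"
proof -
  have "openin (ptop X) A"
  proof (rule openin_subopen[THEN iffD2], intro ballI)
    fix p assume "p \<in> A"
    from assms(2)[OF this] show "\<exists>T. openin (ptop X) T \<and> p \<in> T \<and> T \<subseteq> A"
      by (simp add: openin_ptop[OF X])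
  qed
  then show ?thesis
    using openin_ptop[OF X] by blast
qed

text \<open>
  Analyticity near one point, tested in one pair of charts of one's choice.
\<close>

definition analytic_at :: "'p prevariety \<Rightarrow> 'q prevariety \<Rightarrow> ('p \<Rightarrow> 'q) \<Rightarrow> 'p \<Rightarrow> bool" where
  "analytic_at X Y F p \<longleftrightarrow>
     (\<exists>U \<phi> W \<psi> S. (U, \<phi>) \<in> charts X \<and> (W, \<psi>) \<in> charts Y \<and> p \<in> S \<and> S \<subseteq> U \<and> F ` S \<subseteq> W \<and>
        openin (Euclidean_space (pdim X)) (\<phi> ` S) \<and>
        (\<forall>i<pdim Y. analytic_germ (pdim X) (\<phi> ` S) (\<lambda>x. \<psi> (F (inv_into U \<phi> x)) i) (\<phi> p)))"

lemma analytic_at_neighbourhood: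
  assumes X: "real_analytic_prevariety X" and Y: "real_analytic_prevariety Y"
    and F: "analytic_at X Y F p" and T: "atlas_open Y T" "F p \<in> T"
  obtains N where "atlas_open X N" "p \<in> N" "F ` N \<subseteq> T"
proof -
  obtain U \<phi> W \<psi> S where U: "(U, \<phi>) \<in> charts X" and W: "(W, \<psi>) \<in> charts Y" and S: "p \<in> S" "S \<subseteq> U" "F ` S \<subseteq> W"
    and open_S: "openin (Euclidean_space (pdim X)) (\<phi> ` S)"
    and germ: "\<And>i. i < pdim Y \<Longrightarrow> analytic_germ (pdim X) (\<phi> ` S) (\<lambda>x. \<psi> (F (inv_into U \<phi> x)) i) (\<phi> p)"
    using F unfolding analytic_at_def by blast
  have inv: "inv_into U \<phi> (\<phi> x) = x" if "x \<in> S" for x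
    using chart_inv[OF X U] S(2) that by blast
  have FS: "F x \<in> W" if "x \<in> S" for x
    using S(3) that by blast
  have "\<phi> p \<in> \<phi> ` S" "\<psi> (F (inv_into U \<phi> (\<phi> p))) \<in> \<psi> ` (W \<inter> T)"
    using S T inv FS by auto
  moreover have "\<psi> (F (inv_into U \<phi> x)) \<in> topspace (Euclidean_space (pdim Y))" if "x \<in> \<phi> ` S" for x
    using that inv FS chart_in_topspace[OF Y W] by force
  moreover have "openin (Euclidean_space (pdim Y)) (\<psi> ` (W \<inter> T))"
    using T(1) W by (rule atlas_open_chart_image)
  ultimately obtain s where s: "0 < s" and near: "\<And>x. x \<in> \<phi> ` S \<Longrightarrow> \<forall>i<pdim X. \<bar>x i - \<phi> p i\<bar> < s \<Longrightarrow>
      \<psi> (F (inv_into U \<phi> x)) \<in> \<psi> ` (W \<inter> T)"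
    using analytic_germs_neighbourhood[where G = "\<lambda>x. \<psi> (F (inv_into U \<phi> x))", OF germ] by metis
  define N where "N = {x \<in> S. \<forall>i<pdim X. \<bar>\<phi> x i - \<phi> p i\<bar> < s}"
  have "N \<subseteq> U"
    using S(2) by (auto simp: N_def)
  have "openin (Euclidean_space (pdim X)) {y \<in> \<phi> ` S. y \<in> {y \<in> topspace (Euclidean_space (pdim X)). \<forall>i<pdim X. \<bar>y i - \<phi> p i\<bar> < s}}"
  proof (rule openin_analytic_preimage[OF analytic_germ_coordinate _ open_S])
    show "openin (Euclidean_space (pdim X)) {y \<in> topspace (Euclidean_space (pdim X)). \<forall>i<pdim X. \<bar>y i - \<phi> p i\<bar> < s}"
      unfolding openin_Euclidean_space_box
    proof (intro conjI ballI)
      fix a assume a: "a \<in> {y \<in> topspace (Euclidean_space (pdim X)). \<forall>i<pdim X. \<bar>y i - \<phi> p i\<bar> < s}"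
      define r where "r = Min (insert 1 ((\<lambda>i. s - \<bar>a i - \<phi> p i\<bar>) ` {..<pdim X}))"
      have "0 < r" "\<And>i. i < pdim X \<Longrightarrow> r \<le> s - \<bar>a i - \<phi> p i\<bar>"
        using a by (auto simp: r_def)
      then show "\<exists>r>0. \<forall>x\<in>topspace (Euclidean_space (pdim X)). (\<forall>i<pdim X. \<bar>x i - a i\<bar> < r) \<longrightarrow>
          x \<in> {y \<in> topspace (Euclidean_space (pdim X)). \<forall>i<pdim X. \<bar>y i - \<phi> p i\<bar> < s}"
        by (intro exI[of _ r]) force
    qed auto
  qed (use openin_subset[OF open_S] in auto)
  moreover have "{y \<in> \<phi> ` S. y \<in> {y \<in> topspace (Euclidean_space (pdim X)). \<forall>i<pdim X. \<bar>y i - \<phi> p i\<bar> < s}} = \<phi> ` N"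
    using openin_subset[OF open_S] unfolding N_def by blast
  ultimately have "atlas_open X N"
    using atlas_open_if_open_in_chart[OF X U \<open>N \<subseteq> U\<close>] by simp
  moreover have "p \<in> N"
    using S(1) s by (simp add: N_def)
  moreover have "F x \<in> T" if x: "x \<in> N" for x
  proof -
    have "x \<in> S" "\<psi> (F x) \<in> \<psi> ` (W \<inter> T)"
      using x near[of "\<phi> x"] inv by (auto simp: N_def)
    then show ?thesis
      using inj_on_image_mem_iff[OF chart_inj[OF Y W] FS, of x "W \<inter> T"] by simp
  qed
  ultimately show thesis
    using that by blast
qed

text \<open>
  A real analytic map has to be analytic in every pair of charts.  Near each point the expression in a given
  pair is the one in the chosen pair, composed with transition maps on both sides.
\<close>

theorem real_analytic_map_if_analytic_at:
  assumes X: "real_analytic_prevariety X" and Y: "real_analytic_prevariety Y"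
    and F: "\<And>p. p \<in> points X \<Longrightarrow> analytic_at X Y F p"
  shows "real_analytic_map X Y F"
proof -
  have preimage: "atlas_open X {p \<in> points X. F p \<in> T}" if T: "atlas_open Y T" for T
  proof (rule atlas_openI[OF X])
    fix p assume p: "p \<in> {p \<in> points X. F p \<in> T}"
    then obtain N where "atlas_open X N" "p \<in> N" "F ` N \<subseteq> T"
      using analytic_at_neighbourhood[OF X Y F T] by blast
    then show "\<exists>N. atlas_open X N \<and> p \<in> N \<and> N \<subseteq> {p \<in> points X. F p \<in> T}"
      by (intro exI[of _ N]) (auto simp: atlas_open_def)
  qed
  have in_Y: "F p \<in> points Y" if p: "p \<in> points X" for p
    using F[OF p] chart_subset_points[OF Y] unfolding analytic_at_def by blast
  have "continuous_map (ptop X) (ptop Y) F"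
    unfolding continuous_map_def topspace_ptop[OF X] topspace_ptop[OF Y] openin_ptop[OF X] openin_ptop[OF Y]
    by (intro conjI allI impI Pi_I in_Y preimage)
  moreover have "real_analytic_on (pdim X) (\<phi>\<^sub>1 ` (U\<^sub>1 \<inter> F -` W\<^sub>1)) (\<lambda>x. \<psi>\<^sub>1 (F (inv_into U\<^sub>1 \<phi>\<^sub>1 x)) i)"
    if U\<^sub>1: "(U\<^sub>1, \<phi>\<^sub>1) \<in> charts X" and W\<^sub>1: "(W\<^sub>1, \<psi>\<^sub>1) \<in> charts Y" and i: "i < pdim Y" for U\<^sub>1 \<phi>\<^sub>1 W\<^sub>1 \<psi>\<^sub>1 i
  proof (rule real_analytic_on_if_germ)
    let ?m = "pdim X" and ?k = "pdim Y"
    fix a assume "a \<in> \<phi>\<^sub>1 ` (U\<^sub>1 \<inter> F -` W\<^sub>1)"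
    then obtain p where p: "p \<in> U\<^sub>1" "F p \<in> W\<^sub>1" "a = \<phi>\<^sub>1 p"
      by auto
    then have pX: "p \<in> points X"
      using chart_subset_points[OF X U\<^sub>1] by blast
    obtain U \<phi> W \<psi> S where U: "(U, \<phi>) \<in> charts X" and W: "(W, \<psi>) \<in> charts Y"
      and S: "p \<in> S" "S \<subseteq> U" "F ` S \<subseteq> W" and open_S: "openin (Euclidean_space ?m) (\<phi> ` S)"
      and germ: "\<And>i. i < ?k \<Longrightarrow> analytic_germ ?m (\<phi> ` S) (\<lambda>x. \<psi> (F (inv_into U \<phi> x)) i) (\<phi> p)"
      using F[OF pX] unfolding analytic_at_def by blast
    define A where "A = S \<inter> U\<^sub>1 \<inter> {p \<in> points X. F p \<in> W\<^sub>1}"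
    have AS: "A \<subseteq> S" and AU\<^sub>1: "A \<subseteq> U\<^sub>1" and FW\<^sub>1: "\<And>x. x \<in> A \<Longrightarrow> F x \<in> W\<^sub>1" and FW: "\<And>x. x \<in> A \<Longrightarrow> F x \<in> W"
      using S by (auto simp: A_def)
    have AU: "A \<subseteq> U"
      using AS S(2) by blast
    have pA: "p \<in> A"
      using S(1) p pX by (simp add: A_def)
    have "atlas_open X A"
      unfolding A_def
      by (intro atlas_open_Int[OF X] preimage atlas_open_chart[OF X U\<^sub>1] atlas_open_chart[OF Y W\<^sub>1]
          atlas_open_if_open_in_chart[OF X U S(2) open_S])
    from atlas_open_chart_image[OF this U\<^sub>1] have open_A: "openin (Euclidean_space ?m) (\<phi>\<^sub>1 ` A)"
      using AU\<^sub>1 by (simp add: Int_absorb1)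
    have inv\<^sub>1: "inv_into U\<^sub>1 \<phi>\<^sub>1 (\<phi>\<^sub>1 x) = x" if "x \<in> U\<^sub>1" for x
      using chart_inv[OF X U\<^sub>1] that .
    have inv: "inv_into U \<phi> (\<phi> x) = x" if "x \<in> U" for x
      using chart_inv[OF X U] that .
    have invW: "inv_into W \<psi> (\<psi> x) = x" if "x \<in> W" for x
      using chart_inv[OF Y W] that .
    have inner: "analytic_germ ?m (\<phi>\<^sub>1 ` A) (\<lambda>x. \<phi> (inv_into U\<^sub>1 \<phi>\<^sub>1 x) j) a" if "j < ?m" for j
      by (rule analytic_germ_mono[OF chart_transition_germ[OF X U\<^sub>1 U that]])
        (use p pA AU AU\<^sub>1 in auto)
    have middle: "analytic_germ ?m (\<phi>\<^sub>1 ` A) (\<lambda>x. \<psi> (F (inv_into U \<phi> (\<phi> (inv_into U\<^sub>1 \<phi>\<^sub>1 x)))) j) a"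
      if "j < ?k" for j
    proof (rule analytic_germ_compose[where G = "\<lambda>x. \<phi> (inv_into U\<^sub>1 \<phi>\<^sub>1 x)" and T = "\<phi> ` S" and k = ?m])
      show "analytic_germ ?m (\<phi> ` S) (\<lambda>y. \<psi> (F (inv_into U \<phi> y)) j) (\<phi> (inv_into U\<^sub>1 \<phi>\<^sub>1 a))"
        using germ[OF that] p inv\<^sub>1 by simp
      show "\<phi> ` S \<subseteq> topspace (Euclidean_space ?m)"
        by (rule openin_subset[OF open_S])
      show "\<phi> (inv_into U\<^sub>1 \<phi>\<^sub>1 x) \<in> \<phi> ` S" if "x \<in> \<phi>\<^sub>1 ` A" for x
        using that AS AU\<^sub>1 inv\<^sub>1 by force
    qed (use inner pA p in auto)
    have "analytic_germ ?m (\<phi>\<^sub>1 ` A) (\<lambda>x. \<psi> (F (inv_into U\<^sub>1 \<phi>\<^sub>1 x)) j) a" if "j < ?k" for j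
      by (rule analytic_germ_cong[OF middle[OF that]]) (use AU AU\<^sub>1 inv inv\<^sub>1 in force)
    then have "analytic_germ ?m (\<phi>\<^sub>1 ` A) (\<lambda>x. \<psi>\<^sub>1 (inv_into W \<psi> (\<psi> (F (inv_into U\<^sub>1 \<phi>\<^sub>1 x)))) i) a"
    proof (rule analytic_germ_compose[where G = "\<lambda>x. \<psi> (F (inv_into U\<^sub>1 \<phi>\<^sub>1 x))" and T = "\<psi> ` (W \<inter> W\<^sub>1)" and k = ?k, rotated 2])
      show "analytic_germ ?k (\<psi> ` (W \<inter> W\<^sub>1)) (\<lambda>y. \<psi>\<^sub>1 (inv_into W \<psi> y) i) (\<psi> (F (inv_into U\<^sub>1 \<phi>\<^sub>1 a)))"
        by (rule chart_transition_germ[OF Y W W\<^sub>1 i]) (use p pA FW inv\<^sub>1 in auto)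
      show "\<psi> ` (W \<inter> W\<^sub>1) \<subseteq> topspace (Euclidean_space ?k)"
        by (rule openin_subset[OF chart_overlap_open[OF Y W W\<^sub>1]])
      show "\<psi> (F (inv_into U\<^sub>1 \<phi>\<^sub>1 x)) \<in> \<psi> ` (W \<inter> W\<^sub>1)" if "x \<in> \<phi>\<^sub>1 ` A" for x
        using that AU\<^sub>1 FW FW\<^sub>1 inv\<^sub>1 by force
    qed (use pA p in auto)
    then have germ\<^sub>1: "analytic_germ ?m (\<phi>\<^sub>1 ` A) (\<lambda>x. \<psi>\<^sub>1 (F (inv_into U\<^sub>1 \<phi>\<^sub>1 x)) i) a"
      by (rule analytic_germ_cong) (use AU\<^sub>1 FW inv\<^sub>1 invW in force)
    obtain r where r: "r > 0" "\<forall>x\<in>topspace (Euclidean_space ?m). (\<forall>i<?m. \<bar>x i - a i\<bar> < r) \<longrightarrow> x \<in> \<phi>\<^sub>1 ` A"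
      using open_A pA p(3) unfolding openin_Euclidean_space_box by blast
    show "analytic_germ ?m (\<phi>\<^sub>1 ` (U\<^sub>1 \<inter> F -` W\<^sub>1)) (\<lambda>x. \<psi>\<^sub>1 (F (inv_into U\<^sub>1 \<phi>\<^sub>1 x)) i) a"
      by (rule analytic_germ_local[OF germ\<^sub>1 r(1)]) (use r(2) chart_in_topspace[OF X U\<^sub>1] in blast)
  qed
  ultimately show ?thesis
    unfolding real_analytic_map_def by blast
qed

section \<open>Open subprevarieties and products\<close>

lemma real_analytic_prevarietyI:
  assumes "(\<Union>c\<in>charts X. fst c) = points X"
    and "\<And>U \<phi>. (U, \<phi>) \<in> charts X \<Longrightarrow> inj_on \<phi> U"
    and "\<And>U \<phi> W \<psi>. (U, \<phi>) \<in> charts X \<Longrightarrow> (W, \<psi>) \<in> charts X \<Longrightarrow>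
        openin (Euclidean_space (pdim X)) (\<phi> ` (U \<inter> W))"
    and "\<And>U \<phi> W \<psi> i a. (U, \<phi>) \<in> charts X \<Longrightarrow> (W, \<psi>) \<in> charts X \<Longrightarrow> i < pdim X \<Longrightarrow>
        a \<in> \<phi> ` (U \<inter> W) \<Longrightarrow>
        analytic_germ (pdim X) (\<phi> ` (U \<inter> W)) (\<lambda>x. \<psi> (inv_into U \<phi> x) i) a"
  shows "real_analytic_prevariety X"
  unfolding real_analytic_prevariety_def
proof (intro conjI)
  show "(\<Union>(U, \<phi>)\<in>charts X. U) = points X"
    using assms(1) by (simp add: case_prod_beta)
  have "openin (Euclidean_space (pdim X)) (\<phi> ` U)" if "(U, \<phi>) \<in> charts X" for U \<phi>
    using assms(3)[OF that that] by simp
  then show "\<forall>(U, \<phi>)\<in>charts X. inj_on \<phi> U \<and> openin (Euclidean_space (pdim X)) (\<phi> ` U)"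
    using assms(2) by auto
  have "real_analytic_on (pdim X) (\<phi> ` (U \<inter> W)) (\<lambda>x. \<psi> (inv_into U \<phi> x) i)"
    if "(U, \<phi>) \<in> charts X" "(W, \<psi>) \<in> charts X" "i < pdim X" for U \<phi> W \<psi> i
    by (rule real_analytic_on_if_germ[OF assms(4)[OF that]])
  then show "\<forall>(U, \<phi>)\<in>charts X. \<forall>(W, \<psi>)\<in>charts X.
      openin (Euclidean_space (pdim X)) (\<phi> ` (U \<inter> W)) \<and>
      (\<forall>i<pdim X. real_analytic_on (pdim X) (\<phi> ` (U \<inter> W)) (\<lambda>x. \<psi> (inv_into U \<phi> x) i))"
    using assms(3) by auto
qed

lemma real_analytic_prevariety_open_subprevariety:
  assumes X: "real_analytic_prevariety X" and S: "atlas_open X (points X \<inter> S)"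
  shows "real_analytic_prevariety (open_subprevariety X S)"
proof (rule real_analytic_prevarietyI)
  let ?Y = "open_subprevariety X S"
  have dim: "pdim ?Y = pdim X"
    by (simp add: open_subprevariety_def)
  have charts: "\<exists>U. U\<^sub>1 = U \<inter> S \<and> (U, \<phi>) \<in> charts X" if "(U\<^sub>1, \<phi>) \<in> charts ?Y" for U\<^sub>1 \<phi>
    using that by (auto simp: open_subprevariety_def)
  have "(\<Union>c\<in>charts X. fst c) = points X"
    using X by (simp add: real_analytic_prevariety_def case_prod_beta)
  then show "(\<Union>c\<in>charts ?Y. fst c) = points ?Y"
    by (auto simp: open_subprevariety_def case_prod_beta)
  show "inj_on \<phi> U\<^sub>1" if "(U\<^sub>1, \<phi>) \<in> charts ?Y" for U\<^sub>1 \<phi>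
    using charts[OF that] chart_inj[OF X] by (meson inj_on_subset Int_lower1)
  show overlap: "openin (Euclidean_space (pdim ?Y)) (\<phi> ` (U\<^sub>1 \<inter> W\<^sub>1))"
    if U\<^sub>1: "(U\<^sub>1, \<phi>) \<in> charts ?Y" and W\<^sub>1: "(W\<^sub>1, \<psi>) \<in> charts ?Y" for U\<^sub>1 \<phi> W\<^sub>1 \<psi>
  proof -
    obtain U where U: "U\<^sub>1 = U \<inter> S" "(U, \<phi>) \<in> charts X"
      using charts[OF U\<^sub>1] by blast
    obtain W where W: "W\<^sub>1 = W \<inter> S" "(W, \<psi>) \<in> charts X"
      using charts[OF W\<^sub>1] by blast
    have "U\<^sub>1 \<inter> W\<^sub>1 = U \<inter> (W \<inter> (points X \<inter> S))"
      using U(1) W(1) chart_subset_points[OF X U(2)] by blast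
    then show ?thesis
      using atlas_open_chart_image[OF atlas_open_Int[OF X atlas_open_chart[OF X W(2)] S] U(2)] dim
      by simp
  qed
  fix U\<^sub>1 \<phi> W\<^sub>1 \<psi> i a
  assume U\<^sub>1: "(U\<^sub>1, \<phi>) \<in> charts ?Y" and W\<^sub>1: "(W\<^sub>1, \<psi>) \<in> charts ?Y"
    and i: "i < pdim ?Y" and a: "a \<in> \<phi> ` (U\<^sub>1 \<inter> W\<^sub>1)"
  obtain U where U: "U\<^sub>1 = U \<inter> S" "(U, \<phi>) \<in> charts X"
    using charts[OF U\<^sub>1] by blast
  obtain W where W: "W\<^sub>1 = W \<inter> S" "(W, \<psi>) \<in> charts X"
    using charts[OF W\<^sub>1] by blast
  have sub: "\<phi> ` (U\<^sub>1 \<inter> W\<^sub>1) \<subseteq> \<phi> ` (U \<inter> W)"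
    using U W by blast
  have "analytic_germ (pdim X) (\<phi> ` (U \<inter> W)) (\<lambda>x. \<psi> (inv_into U \<phi> x) i) a"
    by (rule chart_transition_germ[OF X U(2) W(2)]) (use i dim a sub in auto)
  from analytic_germ_mono[OF this sub]
  have germ: "analytic_germ (pdim X) (\<phi> ` (U\<^sub>1 \<inter> W\<^sub>1)) (\<lambda>x. \<psi> (inv_into U \<phi> x) i) a" .
  have "inv_into U\<^sub>1 \<phi> (\<phi> p) = inv_into U \<phi> (\<phi> p)" if "p \<in> U\<^sub>1" for p
  proof -
    have "inj_on \<phi> U\<^sub>1"
      unfolding U(1) using chart_inj[OF X U(2)] by (rule inj_on_subset) simp
    then show ?thesis
      using that U(1) chart_inv[OF X U(2)] by simp
  qed
  then show "analytic_germ (pdim ?Y) (\<phi> ` (U\<^sub>1 \<inter> W\<^sub>1)) (\<lambda>x. \<psi> (inv_into U\<^sub>1 \<phi> x) i) a"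
    unfolding dim by (intro analytic_germ_cong[OF germ]) auto
qed

definition left_coords :: "nat \<Rightarrow> (nat \<Rightarrow> real) \<Rightarrow> nat \<Rightarrow> real" where
  "left_coords m v = (\<lambda>i. if i < m then v i else 0)"

definition right_coords :: "nat \<Rightarrow> (nat \<Rightarrow> real) \<Rightarrow> nat \<Rightarrow> real" where
  "right_coords m v = (\<lambda>i. v (i + m))"

lemma left_append_coords:
  "\<phi> x \<in> topspace (Euclidean_space m) \<Longrightarrow> left_coords m (append_coords m \<phi> \<psi> (x, y)) = \<phi> x"
  by (auto simp: left_coords_def append_coords_def topspace_Euclidean_space)

lemma right_append_coords: "right_coords m (append_coords m \<phi> \<psi> (x, y)) = \<psi> y"
  by (auto simp: right_coords_def append_coords_def)

lemma left_coords_in_topspace: "left_coords m v \<in> topspace (Euclidean_space m)"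
  by (simp add: left_coords_def topspace_Euclidean_space)

lemma right_coords_in_topspace:
  "v \<in> topspace (Euclidean_space (m + k)) \<Longrightarrow> right_coords m v \<in> topspace (Euclidean_space k)"
  by (simp add: right_coords_def topspace_Euclidean_space)

lemma append_coords_in_topspace:
  assumes "\<psi> y \<in> topspace (Euclidean_space k)"
  shows "append_coords m \<phi> \<psi> (x, y) \<in> topspace (Euclidean_space (m + k))"
  using assms by (auto simp: append_coords_def topspace_Euclidean_space)

lemma append_coords_eqI:
  "left_coords m v = \<phi> x \<Longrightarrow> right_coords m v = \<psi> y \<Longrightarrow> v = append_coords m \<phi> \<psi> (x, y)"
  unfolding left_coords_def right_coords_def append_coords_def fun_eq_iff split
  by (metis le_add_diff_inverse2 not_le)

lemma inj_on_append_coords: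
  assumes "inj_on \<phi> U" "inj_on \<psi> W" "\<And>x. x \<in> U \<Longrightarrow> \<phi> x \<in> topspace (Euclidean_space m)"
  shows "inj_on (append_coords m \<phi> \<psi>) (U \<times> W)"
proof (rule inj_onI)
  fix p q assume p: "p \<in> U \<times> W" and q: "q \<in> U \<times> W"
    and eq: "append_coords m \<phi> \<psi> p = append_coords m \<phi> \<psi> q"
  obtain x y x' y' where pq: "p = (x, y)" "q = (x', y')"
    by fastforce
  have "\<phi> x = \<phi> x'"
    using arg_cong[OF eq, of "left_coords m"] p q assms(3) by (simp add: pq left_append_coords)
  moreover have "\<psi> y = \<psi> y'"
    using arg_cong[OF eq, of "right_coords m"] by (simp add: pq right_append_coords)
  ultimately show "p = q"
    using p q assms(1,2) by (auto simp: pq dest: inj_onD)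
qed

lemma openin_append_coords:
  assumes A: "openin (Euclidean_space m) (\<phi> ` A)" and B: "openin (Euclidean_space k) (\<psi> ` B)"
  shows "openin (Euclidean_space (m + k)) (append_coords m \<phi> \<psi> ` (A \<times> B))"
proof -
  let ?E = "Euclidean_space (m + k)"
  let ?L = "{v \<in> topspace ?E. left_coords m v \<in> \<phi> ` A}"
  have L: "openin ?E ?L"
  proof (rule openin_analytic_preimage[OF _ _ openin_topspace A])
    show "analytic_germ (m + k) (topspace ?E) (\<lambda>x. left_coords m x i) a" if "i < m" for i a
      using that analytic_germ_coordinate[of i "m + k"] by (simp add: left_coords_def)
  qed (rule left_coords_in_topspace)
  have "openin ?E {v \<in> ?L. right_coords m v \<in> \<psi> ` B}"
  proof (rule openin_analytic_preimage[OF _ _ L B])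
    show "analytic_germ (m + k) ?L (\<lambda>x. right_coords m x i) a" if "i < k" for i a
      using that analytic_germ_coordinate[of "i + m" "m + k"] by (simp add: right_coords_def)
  qed (auto intro: right_coords_in_topspace)
  moreover have "{v \<in> ?L. right_coords m v \<in> \<psi> ` B} = append_coords m \<phi> \<psi> ` (A \<times> B)"
  proof (intro set_eqI iffI)
    fix v assume "v \<in> {v \<in> ?L. right_coords m v \<in> \<psi> ` B}"
    then obtain x y where "x \<in> A" "y \<in> B" "left_coords m v = \<phi> x" "right_coords m v = \<psi> y"
      by blast
    then show "v \<in> append_coords m \<phi> \<psi> ` (A \<times> B)"
      using append_coords_eqI[of m v \<phi> x \<psi> y] by blast
  next
    fix v assume "v \<in> append_coords m \<phi> \<psi> ` (A \<times> B)"
    then obtain x y where v: "v = append_coords m \<phi> \<psi> (x, y)" "x \<in> A" "y \<in> B"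
      by blast
    have "\<phi> x \<in> topspace (Euclidean_space m)" "\<psi> y \<in> topspace (Euclidean_space k)"
      using v openin_subset[OF A] openin_subset[OF B] by blast+
    then show "v \<in> {v \<in> ?L. right_coords m v \<in> \<psi> ` B}"
      using v by (simp add: left_append_coords right_append_coords append_coords_in_topspace)
  qed
  ultimately show ?thesis
    by simp
qed

text \<open>
  A transition map of product charts acts separately on the left and the right block of coordinates, and
  each block depends analytically on the whole coordinate vector.
\<close>

lemma real_analytic_prevariety_product:
  assumes X: "real_analytic_prevariety X" and Y: "real_analytic_prevariety Y"
  shows "real_analytic_prevariety (product_prevariety X Y)"
proof (rule real_analytic_prevarietyI)
  let ?Z = "product_prevariety X Y" and ?m = "pdim X" and ?k = "pdim Y"
  have dim: "pdim ?Z = ?m + ?k"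
    by (simp add: product_prevariety_def)
  have charts: "\<exists>U \<phi> W \<psi>. V = U \<times> W \<and> \<kappa> = append_coords ?m \<phi> \<psi> \<and> (U, \<phi>) \<in> charts X \<and> (W, \<psi>) \<in> charts Y"
    if "(V, \<kappa>) \<in> charts ?Z" for V \<kappa>
    using that by (auto simp: product_prevariety_def)
  show "(\<Union>c\<in>charts ?Z. fst c) = points ?Z"
  proof (intro set_eqI iffI)
    fix p assume "p \<in> (\<Union>c\<in>charts ?Z. fst c)"
    then obtain c where "c \<in> charts ?Z" "p \<in> fst c"
      by blast
    then obtain U \<phi> W \<psi> where "p \<in> U \<times> W" and U: "(U, \<phi>) \<in> charts X" and W: "(W, \<psi>) \<in> charts Y"
      using charts[of "fst c" "snd c"] by auto
    then show "p \<in> points ?Z"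
      using chart_subset_points[OF X U] chart_subset_points[OF Y W] by (auto simp: product_prevariety_def)
  next
    fix p assume "p \<in> points ?Z"
    then have p: "fst p \<in> points X" "snd p \<in> points Y"
      by (auto simp: product_prevariety_def)
    obtain U \<phi> where U: "(U, \<phi>) \<in> charts X" "fst p \<in> U"
      using point_in_chart[OF X p(1)] .
    obtain W \<psi> where W: "(W, \<psi>) \<in> charts Y" "snd p \<in> W"
      using point_in_chart[OF Y p(2)] .
    have "(U \<times> W, append_coords ?m \<phi> \<psi>) \<in> charts ?Z"
      using U(1) W(1) by (auto simp: product_prevariety_def)
    moreover have "p \<in> fst (U \<times> W, append_coords ?m \<phi> \<psi>)"
      using U(2) W(2) by (simp add: mem_Times_iff)
    ultimately show "p \<in> (\<Union>c\<in>charts ?Z. fst c)"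
      by blast
  qed
  have inj: "inj_on (append_coords ?m \<phi> \<psi>) (U \<times> W)"
    if "(U, \<phi>) \<in> charts X" "(W, \<psi>) \<in> charts Y" for U \<phi> W \<psi>
    by (rule inj_on_append_coords[OF chart_inj[OF X that(1)] chart_inj[OF Y that(2)] chart_in_topspace[OF X that(1)]])
  show "inj_on \<kappa> V" if "(V, \<kappa>) \<in> charts ?Z" for V \<kappa>
    using charts[OF that] inj by auto
  show "openin (Euclidean_space (pdim ?Z)) (\<kappa> ` (V \<inter> V'))"
    if V: "(V, \<kappa>) \<in> charts ?Z" and V': "(V', \<kappa>') \<in> charts ?Z" for V \<kappa> V' \<kappa>'
  proof -
    obtain U \<phi> W \<psi> where 1: "V = U \<times> W" "\<kappa> = append_coords ?m \<phi> \<psi>" "(U, \<phi>) \<in> charts X" "(W, \<psi>) \<in> charts Y"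
      using charts[OF V] by blast
    obtain U' \<phi>' W' \<psi>' where 2: "V' = U' \<times> W'" "(U', \<phi>') \<in> charts X" "(W', \<psi>') \<in> charts Y"
      using charts[OF V'] by blast
    show ?thesis
      unfolding dim 1(1,2) 2(1) Times_Int_Times
      by (intro openin_append_coords chart_overlap_open[OF X 1(3) 2(2)] chart_overlap_open[OF Y 1(4) 2(3)])
  qed
  fix V \<kappa> V' \<kappa>' i a
  assume V: "(V, \<kappa>) \<in> charts ?Z" and V': "(V', \<kappa>') \<in> charts ?Z"
    and i: "i < pdim ?Z" and a: "a \<in> \<kappa> ` (V \<inter> V')"
  obtain U \<phi> W \<psi> where 1: "V = U \<times> W" "\<kappa> = append_coords ?m \<phi> \<psi>" "(U, \<phi>) \<in> charts X" "(W, \<psi>) \<in> charts Y"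
    using charts[OF V] by blast
  obtain U' \<phi>' W' \<psi>' where 2: "V' = U' \<times> W'" "\<kappa>' = append_coords ?m \<phi>' \<psi>'"
    "(U', \<phi>') \<in> charts X" "(W', \<psi>') \<in> charts Y"
    using charts[OF V'] by blast
  let ?D = "append_coords ?m \<phi> \<psi> ` ((U \<inter> U') \<times> (W \<inter> W'))"
  have D: "\<kappa> ` (V \<inter> V') = ?D"
    unfolding 1 2 Times_Int_Times ..
  have left: "left_coords ?m (append_coords ?m \<phi> \<psi> (x, y)) = \<phi> x" if "x \<in> U" for x y
    by (simp add: left_append_coords chart_in_topspace[OF X 1(3) that])
  have inv: "inv_into V \<kappa> (append_coords ?m \<phi> \<psi> (x, y)) = (x, y)" if "x \<in> U" "y \<in> W" for x y
    unfolding 1(1,2) by (rule inv_into_f_f[OF inj[OF 1(3,4)]]) (use that in simp)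
  obtain x y where xy: "a = append_coords ?m \<phi> \<psi> (x, y)" "x \<in> U" "x \<in> U'" "y \<in> W" "y \<in> W'"
    using a unfolding D by blast
  have germ: "analytic_germ (?m + ?k) ?D (\<lambda>v. \<kappa>' (inv_into V \<kappa> v) i) a"
  proof (cases "i < ?m")
    case True
    have "analytic_germ (?m + ?k) ?D (\<lambda>v. \<phi>' (inv_into U \<phi> (left_coords ?m v)) i) a"
    proof (rule analytic_germ_compose[where G = "left_coords ?m" and T = "\<phi> ` (U \<inter> U')" and k = ?m])
      show "analytic_germ ?m (\<phi> ` (U \<inter> U')) (\<lambda>x. \<phi>' (inv_into U \<phi> x) i) (left_coords ?m a)"
        by (rule chart_transition_germ[OF X 1(3) 2(3) True]) (use xy left in auto)
      show "\<phi> ` (U \<inter> U') \<subseteq> topspace (Euclidean_space ?m)"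
        by (rule openin_subset[OF chart_overlap_open[OF X 1(3) 2(3)]])
      show "analytic_germ (?m + ?k) ?D (\<lambda>v. left_coords ?m v j) a" if "j < ?m" for j
        using that analytic_germ_coordinate[of j "?m + ?k"] by (simp add: left_coords_def)
    qed (use xy left in auto)
    then show ?thesis
      by (rule analytic_germ_cong) (use left inv True chart_inv[OF X 1(3)] in \<open>auto simp: 2(2) append_coords_def[of _ \<phi>']\<close>)
  next
    case False
    then have j: "i - ?m < ?k"
      using i dim by simp
    have "analytic_germ (?m + ?k) ?D (\<lambda>v. \<psi>' (inv_into W \<psi> (right_coords ?m v)) (i - ?m)) a"
    proof (rule analytic_germ_compose[where G = "right_coords ?m" and T = "\<psi> ` (W \<inter> W')" and k = ?k])
      show "analytic_germ ?k (\<psi> ` (W \<inter> W')) (\<lambda>x. \<psi>' (inv_into W \<psi> x) (i - ?m)) (right_coords ?m a)"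
        by (rule chart_transition_germ[OF Y 1(4) 2(4) j]) (use xy in \<open>auto simp: right_append_coords\<close>)
      show "\<psi> ` (W \<inter> W') \<subseteq> topspace (Euclidean_space ?k)"
        by (rule openin_subset[OF chart_overlap_open[OF Y 1(4) 2(4)]])
      show "analytic_germ (?m + ?k) ?D (\<lambda>v. right_coords ?m v j) a" if "j < ?k" for j
        using that analytic_germ_coordinate[of "j + ?m" "?m + ?k"] by (simp add: right_coords_def)
    qed (use xy in \<open>auto simp: right_append_coords\<close>)
    then show ?thesis
      by (rule analytic_germ_cong)
        (use inv False chart_inv[OF Y 1(4)] in \<open>auto simp: right_append_coords 2(2) append_coords_def[of _ \<phi>']\<close>)
  qed
  then show "analytic_germ (pdim ?Z) (\<kappa> ` (V \<inter> V')) (\<lambda>v. \<kappa>' (inv_into V \<kappa> v) i) a"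
    unfolding dim D .
qed

section \<open>Finite dimensional vector spaces\<close>

text \<open>
  The basis of the vector space whose coordinate functions are the components of \<open>\<phi>\<close>.
\<close>

definition coord_basis :: "('v \<Rightarrow> nat \<Rightarrow> real) \<Rightarrow> nat \<Rightarrow> 'v" where
  "coord_basis \<phi> i = inv \<phi> (\<lambda>j. if j = i then 1 else 0)"

lemma unit_vector_in_topspace: "i < k \<Longrightarrow> (\<lambda>j. if j = i then 1 else 0) \<in> topspace (Euclidean_space k)"
  by (auto simp: topspace_Euclidean_space)

lemma coordinate_expansion:
  fixes \<phi> :: "'v::real_vector \<Rightarrow> nat \<Rightarrow> real"
  assumes lin: "\<And>i. linear (\<lambda>v. \<phi> v i)" and bij: "bij_betw \<phi> UNIV (topspace (Euclidean_space k))"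
  shows "i < k \<Longrightarrow> \<phi> (coord_basis \<phi> i) j = (if j = i then 1 else 0)"
    and "x \<in> topspace (Euclidean_space k) \<Longrightarrow> \<phi> (\<Sum>i<k. x i *\<^sub>R coord_basis \<phi> i) = x"
    and "(\<Sum>i<k. \<phi> v i *\<^sub>R coord_basis \<phi> i) = v"
proof -
  have inj: "inj \<phi>" and onto: "range \<phi> = topspace (Euclidean_space k)"
    using bij by (simp_all add: bij_betw_def)
  have basis: "\<phi> (coord_basis \<phi> i) = (\<lambda>j. if j = i then 1 else 0)" if "i < k" for i
    unfolding coord_basis_def
    by (rule f_inv_into_f) (use unit_vector_in_topspace[OF that] onto in simp)
  then show "i < k \<Longrightarrow> \<phi> (coord_basis \<phi> i) j = (if j = i then 1 else 0)"
    by simp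
  have expand: "\<phi> (\<Sum>i<k. x i *\<^sub>R coord_basis \<phi> i) = x" if "x \<in> topspace (Euclidean_space k)" for x
  proof
    fix j
    have "\<phi> (\<Sum>i<k. x i *\<^sub>R coord_basis \<phi> i) j = (\<Sum>i<k. x i * \<phi> (coord_basis \<phi> i) j)"
      by (simp add: linear_sum[OF lin] linear_scale[OF lin])
    also have "\<dots> = (\<Sum>i<k. if j = i then x i else 0)"
      by (rule sum.cong) (auto simp: basis)
    also have "\<dots> = x j"
      using that by (simp add: topspace_Euclidean_space not_less)
    finally show "\<phi> (\<Sum>i<k. x i *\<^sub>R coord_basis \<phi> i) j = x j" .
  qed
  then show "x \<in> topspace (Euclidean_space k) \<Longrightarrow> \<phi> (\<Sum>i<k. x i *\<^sub>R coord_basis \<phi> i) = x"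
    by blast
  have "\<phi> (\<Sum>i<k. \<phi> v i *\<^sub>R coord_basis \<phi> i) = \<phi> v"
    by (rule expand) (use onto in blast)
  then show "(\<Sum>i<k. \<phi> v i *\<^sub>R coord_basis \<phi> i) = v"
    using inj by (simp add: inj_eq)
qed

text \<open>
  The number of coordinates need not be known to be the dimension in advance: it is the cardinality of the
  basis that the coordinates define.
\<close>

lemma linear_coordinatesI:
  fixes \<phi> :: "'v::real_vector \<Rightarrow> nat \<Rightarrow> real"
  assumes lin: "\<And>i. linear (\<lambda>v. \<phi> v i)" and bij: "bij_betw \<phi> UNIV (topspace (Euclidean_space k))"
  shows "dim (UNIV :: 'v set) = k" and "linear_coordinates \<phi>"
proof -
  note exp = coordinate_expansion[OF lin bij]
  let ?B = "coord_basis \<phi> ` {..<k}"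
  have inj: "inj_on (coord_basis \<phi>) {..<k}"
  proof (rule inj_onI)
    fix i j assume "i \<in> {..<k}" "j \<in> {..<k}" "coord_basis \<phi> i = coord_basis \<phi> j"
    then show "i = j"
      using exp(1)[of i i] exp(1)[of j i] by (auto split: if_splits)
  qed
  have "independent ?B"
  proof (rule independent_if_scalars_zero)
    fix f b assume *: "(\<Sum>b\<in>?B. f b *\<^sub>R b) = 0" "b \<in> ?B"
    then obtain j where j: "j < k" "b = coord_basis \<phi> j"
      by blast
    define x where "x i = (if i < k then f (coord_basis \<phi> i) else 0)" for i
    have "(\<Sum>i<k. x i *\<^sub>R coord_basis \<phi> i) = 0"
      using *(1) by (simp add: sum.reindex[OF inj] x_def)
    moreover have "\<phi> (\<Sum>i<k. x i *\<^sub>R coord_basis \<phi> i) = x"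
      by (rule exp(2)) (simp add: x_def topspace_Euclidean_space)
    ultimately have "x j = \<phi> 0 j"
      by simp
    then show "f b = 0"
      using j linear_0[OF lin] by (simp add: x_def)
  qed auto
  moreover have "v \<in> span ?B" for v
  proof -
    have "(\<Sum>i<k. \<phi> v i *\<^sub>R coord_basis \<phi> i) \<in> span ?B"
      by (intro span_sum span_scale span_base) auto
    then show ?thesis
      by (simp only: exp(3))
  qed
  ultimately show dim: "dim (UNIV :: 'v set) = k"
    using card_image[OF inj] by (intro dim_unique[of ?B]) auto
  show "linear_coordinates \<phi>"
    unfolding linear_coordinates_def dim using lin bij by blast
qed

lemma ex_linear_coordinates:
  fixes B :: "'v::real_vector set"
  assumes B: "finite B" "independent B" "span B = UNIV"
  obtains \<phi> :: "'v \<Rightarrow> nat \<Rightarrow> real" where "linear_coordinates \<phi>"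
proof -
  define d where "d = card B"
  obtain e where e: "bij_betw e {0..<d} B"
    using ex_bij_betw_nat_finite[OF B(1)] unfolding d_def by blast
  have eB: "e i \<in> B" if "i < d" for i
    using e that by (auto simp: bij_betw_def)
  have e_inj: "e i = e j \<longleftrightarrow> i = j" if "i < d" "j < d" for i j
    using e that by (auto simp: bij_betw_def inj_on_def)
  define \<phi> where "\<phi> v i = (if i < d then representation B v (e i) else 0)" for v i
  have rep_lin: "linear (\<lambda>v. representation B v b)" for b
    by (rule linearI) (simp_all add: representation_add[OF B(2)] representation_scale[OF B(2)] B(3))
  have lin: "linear (\<lambda>v. \<phi> v i)" for i
    by (cases "i < d") (simp_all add: \<phi>_def rep_lin linear_zero)
  have "inj \<phi>"
  proof (rule injI)
    fix v w assume eq: "\<phi> v = \<phi> w"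
    have "representation B v b = representation B w b" if b: "b \<in> B" for b
    proof -
      obtain i where "i < d" "b = e i"
        using b e by (auto simp: bij_betw_def)
      then show ?thesis
        using fun_cong[OF eq, of i] by (simp add: \<phi>_def)
    qed
    then have "(\<Sum>b\<in>B. representation B v b *\<^sub>R b) = (\<Sum>b\<in>B. representation B w b *\<^sub>R b)"
      by simp
    then show "v = w"
      by (simp add: sum_representation_eq[OF B(2) _ B(1)] B(3))
  qed
  moreover have "range \<phi> = topspace (Euclidean_space d)"
  proof (intro equalityI subsetI)
    fix x assume "x \<in> range \<phi>"
    then show "x \<in> topspace (Euclidean_space d)"
      by (auto simp: \<phi>_def topspace_Euclidean_space)
  next
    fix x assume x: "x \<in> topspace (Euclidean_space d)"
    have "\<phi> (\<Sum>i<d. x i *\<^sub>R e i) j = x j" for j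
    proof (cases "j < d")
      case True
      have "\<phi> (\<Sum>i<d. x i *\<^sub>R e i) j = (\<Sum>i<d. x i * representation B (e i) (e j))"
        using True by (simp add: \<phi>_def linear_sum[OF rep_lin] linear_scale[OF rep_lin])
      also have "\<dots> = (\<Sum>i<d. if j = i then x i else 0)"
        by (rule sum.cong) (auto simp: representation_basis[OF B(2) eB] e_inj True)
      also have "\<dots> = x j"
        using True by simp
      finally show ?thesis .
    next
      case False
      then show ?thesis
        using x by (simp add: \<phi>_def topspace_Euclidean_space)
    qed
    then show "x \<in> range \<phi>"
      by (metis ext rangeI)
  qed
  ultimately have "bij_betw \<phi> UNIV (topspace (Euclidean_space d))"
    by (simp add: bij_betw_def)
  then have "linear_coordinates \<phi>"
    by (rule linear_coordinatesI(2)[OF lin])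
  then show thesis
    by (rule that)
qed

lemma
  fixes \<phi> :: "'v::real_vector \<Rightarrow> nat \<Rightarrow> real"
  assumes "linear_coordinates \<phi>"
  shows linear_coordinate: "linear (\<lambda>v. \<phi> v i)"
    and linear_coordinates_bij: "bij_betw \<phi> UNIV (topspace (Euclidean_space (dim (UNIV :: 'v set))))"
    and linear_coordinates_inj: "inj \<phi>"
    and linear_coordinates_range: "range \<phi> = topspace (Euclidean_space (dim (UNIV :: 'v set)))"
    and linear_coordinates_inv: "inv \<phi> (\<phi> v) = v"
  using assms by (simp_all add: linear_coordinates_def bij_betw_def)

lemmas linear_coordinates_expansion =
  coordinate_expansion[OF linear_coordinate linear_coordinates_bij]

lemma linear_coordinates_product:
  fixes \<phi> :: "'v::real_vector \<Rightarrow> nat \<Rightarrow> real" and \<psi> :: "'w::real_vector \<Rightarrow> nat \<Rightarrow> real"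
  assumes \<phi>: "linear_coordinates \<phi>" and \<psi>: "linear_coordinates \<psi>"
  shows "dim (UNIV :: ('v \<times> 'w) set) = dim (UNIV :: 'v set) + dim (UNIV :: 'w set)"
    and "linear_coordinates (append_coords (dim (UNIV :: 'v set)) \<phi> \<psi>)"
proof -
  let ?m = "dim (UNIV :: 'v set)" and ?k = "dim (UNIV :: 'w set)"
  let ?\<kappa> = "append_coords ?m \<phi> \<psi>"
  have \<phi>_top: "\<phi> x \<in> topspace (Euclidean_space ?m)" for x
    using linear_coordinates_range[OF \<phi>] by blast
  have \<psi>_top: "\<psi> x \<in> topspace (Euclidean_space ?k)" for x
    using linear_coordinates_range[OF \<psi>] by blast
  have lin: "linear (\<lambda>p. ?\<kappa> p i)" for i
  proof (cases "i < ?m")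
    case True
    then show ?thesis
      using linear_compose[OF linear_fst linear_coordinate[OF \<phi>, of i]]
      by (simp add: append_coords_def case_prod_beta o_def)
  next
    case False
    then show ?thesis
      using linear_compose[OF linear_snd linear_coordinate[OF \<psi>, of "i - ?m"]]
      by (simp add: append_coords_def case_prod_beta o_def)
  qed
  have "inj_on ?\<kappa> (UNIV \<times> UNIV)"
    by (rule inj_on_append_coords[OF linear_coordinates_inj[OF \<phi>] linear_coordinates_inj[OF \<psi>] \<phi>_top])
  moreover have "range ?\<kappa> = topspace (Euclidean_space (?m + ?k))"
  proof (intro equalityI subsetI)
    fix v assume "v \<in> range ?\<kappa>"
    then show "v \<in> topspace (Euclidean_space (?m + ?k))"
      using append_coords_in_topspace[OF \<psi>_top] by auto
  next
    fix v assume "v \<in> topspace (Euclidean_space (?m + ?k))"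
    then have "right_coords ?m v \<in> range \<psi>" "left_coords ?m v \<in> range \<phi>"
      using right_coords_in_topspace left_coords_in_topspace
        linear_coordinates_range[OF \<phi>] linear_coordinates_range[OF \<psi>] by simp_all
    then obtain x y where "left_coords ?m v = \<phi> x" "right_coords ?m v = \<psi> y"
      by blast
    then have "v = ?\<kappa> (x, y)"
      by (rule append_coords_eqI)
    then show "v \<in> range ?\<kappa>"
      by blast
  qed
  ultimately have bij: "bij_betw ?\<kappa> UNIV (topspace (Euclidean_space (?m + ?k)))"
    by (simp add: bij_betw_def)
  show "dim (UNIV :: ('v \<times> 'w) set) = ?m + ?k" "linear_coordinates ?\<kappa>"
    using linear_coordinatesI[OF lin bij] by auto
qed

text \<open>
  Values on the basis of \<open>\<phi>\<close>, padded by \<open>0\<close> to a vector of \<^const>\<open>Euclidean_space\<close>.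
\<close>

definition dual_coords :: "('v::real_vector \<Rightarrow> nat \<Rightarrow> real) \<Rightarrow> 'v dual_space \<Rightarrow> nat \<Rightarrow> real" where
  "dual_coords \<phi> \<xi> i = (if i < dim (UNIV :: 'v set) then dual_apply \<xi> (coord_basis \<phi> i) else 0)"

lemma linear_dual_apply: "linear (dual_apply \<xi>)"
  using dual_apply[of \<xi>] by simp

lemma linear_dual_apply_left: "linear (\<lambda>\<xi>. dual_apply \<xi> v)"
  by (rule linearI) (simp_all add: plus_dual_space.rep_eq scaleR_dual_space.rep_eq)

lemma dual_apply_expansion:
  fixes \<phi> :: "'v::real_vector \<Rightarrow> nat \<Rightarrow> real"
  assumes \<phi>: "linear_coordinates \<phi>"
  shows "dual_apply \<xi> v = (\<Sum>i<dim (UNIV :: 'v set). \<phi> v i * dual_apply \<xi> (coord_basis \<phi> i))"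
proof -
  have "dual_apply \<xi> v = dual_apply \<xi> (\<Sum>i<dim (UNIV :: 'v set). \<phi> v i *\<^sub>R coord_basis \<phi> i)"
    by (simp only: linear_coordinates_expansion(3)[OF \<phi> \<phi>])
  then show ?thesis
    by (simp add: linear_sum[OF linear_dual_apply] linear_scale[OF linear_dual_apply])
qed

lemma linear_coordinates_dual:
  fixes \<phi> :: "'v::real_vector \<Rightarrow> nat \<Rightarrow> real"
  assumes \<phi>: "linear_coordinates \<phi>"
  shows "dim (UNIV :: 'v dual_space set) = dim (UNIV :: 'v set)" and "linear_coordinates (dual_coords \<phi>)"
proof -
  let ?d = "dim (UNIV :: 'v set)"
  have lin: "linear (\<lambda>\<xi>. dual_coords \<phi> \<xi> i)" for i
    by (cases "i < ?d") (simp_all add: dual_coords_def linear_dual_apply_left linear_zero)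
  have "inj (dual_coords \<phi>)"
  proof (rule injI)
    fix \<xi> \<eta> :: "'v dual_space" assume eq: "dual_coords \<phi> \<xi> = dual_coords \<phi> \<eta>"
    have "dual_apply \<xi> (coord_basis \<phi> i) = dual_apply \<eta> (coord_basis \<phi> i)" if "i < ?d" for i
      using fun_cong[OF eq, of i] that by (simp add: dual_coords_def)
    then have "dual_apply \<xi> v = dual_apply \<eta> v" for v
      unfolding dual_apply_expansion[OF \<phi>, of _ v] by simp
    then show "\<xi> = \<eta>"
      by (simp add: dual_apply_inject[symmetric] fun_eq_iff)
  qed
  moreover have "range (dual_coords \<phi>) = topspace (Euclidean_space ?d)"
  proof (intro equalityI subsetI)
    fix x assume "x \<in> range (dual_coords \<phi>)"
    then show "x \<in> topspace (Euclidean_space ?d)"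
      by (auto simp: dual_coords_def topspace_Euclidean_space)
  next
    fix x assume x: "x \<in> topspace (Euclidean_space ?d)"
    define \<xi> where "\<xi> = Dual (\<lambda>v. \<Sum>i<?d. x i * \<phi> v i)"
    have "linear (\<lambda>v. \<Sum>i<?d. x i * \<phi> v i)"
      using linear_compose_sum[of "{..<?d}" "\<lambda>i v. x i *\<^sub>R \<phi> v i"]
        linear_compose_scale_right[OF linear_coordinate[OF \<phi>]] by simp
    then have \<xi>: "dual_apply \<xi> v = (\<Sum>i<?d. x i * \<phi> v i)" for v
      by (simp add: \<xi>_def Dual_inverse)
    have "dual_coords \<phi> \<xi> j = x j" for j
    proof (cases "j < ?d")
      case True
      have "dual_coords \<phi> \<xi> j = (\<Sum>i<?d. x i * (if i = j then 1 else 0))"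
        using True by (simp add: dual_coords_def \<xi> linear_coordinates_expansion(1)[OF \<phi> \<phi>])
      also have "\<dots> = (\<Sum>i<?d. if j = i then x i else 0)"
        by (rule sum.cong) auto
      finally show ?thesis
        using True by simp
    next
      case False
      then show ?thesis
        using x by (simp add: dual_coords_def topspace_Euclidean_space)
    qed
    then show "x \<in> range (dual_coords \<phi>)"
      by (metis ext rangeI)
  qed
  ultimately have bij: "bij_betw (dual_coords \<phi>) UNIV (topspace (Euclidean_space ?d))"
    by (simp add: bij_betw_def)
  show "dim (UNIV :: 'v dual_space set) = ?d" "linear_coordinates (dual_coords \<phi>)"
    using linear_coordinatesI[OF lin bij] by auto
qed

text \<open>
  Analyticity at \<open>p\<close> of a function on a vector space, read in the coordinates \<open>\<phi>\<close>.  All charts that occur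
  below are parametrised by vector spaces, so that coordinates enter only through this predicate.
\<close>

definition vector_germ ::
  "('v::real_vector \<Rightarrow> nat \<Rightarrow> real) \<Rightarrow> 'v set \<Rightarrow> ('v \<Rightarrow> real) \<Rightarrow> 'v \<Rightarrow> bool" where
  "vector_germ \<phi> S g p \<longleftrightarrow>
     analytic_germ (dim (UNIV :: 'v set)) (\<phi> ` S) (\<lambda>x. g (inv \<phi> x)) (\<phi> p)"

lemma vector_germ_linear:
  fixes \<phi> :: "'v::real_vector \<Rightarrow> nat \<Rightarrow> real"
  assumes \<phi>: "linear_coordinates \<phi>" and l: "linear l"
  shows "vector_germ \<phi> S l p"
  unfolding vector_germ_def
proof (rule analytic_germ_cong)
  let ?d = "dim (UNIV :: 'v set)"
  show "analytic_germ ?d (\<phi> ` S) (\<lambda>x. \<Sum>i<?d. x i * l (coord_basis \<phi> i)) (\<phi> p)"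
    by (intro analytic_germ_sum analytic_germ_mult analytic_germ_coordinate analytic_germ_const) auto
  fix x assume "x \<in> \<phi> ` S"
  then obtain v where v: "x = \<phi> v"
    by blast
  have "l v = l (\<Sum>i<?d. \<phi> v i *\<^sub>R coord_basis \<phi> i)"
    by (simp only: linear_coordinates_expansion(3)[OF \<phi> \<phi>])
  then show "(\<Sum>i<?d. x i * l (coord_basis \<phi> i)) = l (inv \<phi> x)"
    by (simp add: v linear_coordinates_inv[OF \<phi>] linear_sum[OF l] linear_scale[OF l])
qed

lemma vector_germ_const: "vector_germ \<phi> S (\<lambda>_. k) p"
  unfolding vector_germ_def by (rule analytic_germ_const)

lemma vector_germ_add:
  "vector_germ \<phi> S g p \<Longrightarrow> vector_germ \<phi> S h p \<Longrightarrow> vector_germ \<phi> S (\<lambda>v. g v + h v) p"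
  unfolding vector_germ_def by (rule analytic_germ_add)

lemma vector_germ_mult:
  "vector_germ \<phi> S g p \<Longrightarrow> vector_germ \<phi> S h p \<Longrightarrow> vector_germ \<phi> S (\<lambda>v. g v * h v) p"
  unfolding vector_germ_def by (rule analytic_germ_mult)

lemma vector_germ_sum:
  "(\<And>k. k \<in> K \<Longrightarrow> vector_germ \<phi> S (g k) p) \<Longrightarrow> vector_germ \<phi> S (\<lambda>v. \<Sum>k\<in>K. g k v) p"
  unfolding vector_germ_def by (rule analytic_germ_sum)

lemma vector_germ_cong:
  assumes "linear_coordinates \<phi>" "vector_germ \<phi> S g p" "\<And>v. v \<in> S \<Longrightarrow> g v = h v"
  shows "vector_germ \<phi> S h p"
  using assms(2) unfolding vector_germ_def
  by (rule analytic_germ_cong) (use assms(3) linear_coordinates_inv[OF assms(1)] in auto)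

lemma vector_germ_inverse:
  assumes "linear_coordinates \<phi>" "vector_germ \<phi> S g p" "p \<in> S" "g p \<noteq> 0"
  shows "vector_germ \<phi> S (\<lambda>v. inverse (g v)) p"
  using assms unfolding vector_germ_def
  by (intro analytic_germ_inverse) (auto simp: linear_coordinates_inv)

lemma vector_germ_sqrt:
  assumes "linear_coordinates \<phi>" "vector_germ \<phi> S g p" "p \<in> S" "0 < g p"
  shows "vector_germ \<phi> S (\<lambda>v. sqrt (g v)) p"
  using assms unfolding vector_germ_def
  by (intro analytic_germ_sqrt) (auto simp: linear_coordinates_inv)

lemma
  fixes \<phi> :: "'v::real_vector \<Rightarrow> nat \<Rightarrow> real"
  assumes \<phi>: "linear_coordinates \<phi>"
  shows real_analytic_prevariety_vector: "real_analytic_prevariety (vector_prevariety :: 'v prevariety)"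
    and openin_vector: "openin (ptop (vector_prevariety :: 'v prevariety)) S \<longleftrightarrow>
          openin (Euclidean_space (dim (UNIV :: 'v set))) (\<phi> ` S)"
proof -
  let ?V = "vector_prevariety :: 'v prevariety" and ?d = "dim (UNIV :: 'v set)"
  have charts: "U = UNIV \<and> linear_coordinates \<psi>" if "(U, \<psi>) \<in> charts ?V" for U \<psi>
    using that by (simp add: vector_prevariety_def)
  have dim: "pdim ?V = ?d"
    by (simp add: vector_prevariety_def)
  show V: "real_analytic_prevariety ?V"
  proof (rule real_analytic_prevarietyI)
    show "(\<Union>c\<in>charts ?V. fst c) = points ?V"
      using \<phi> by (auto simp: vector_prevariety_def)
    show "inj_on \<psi> U" if "(U, \<psi>) \<in> charts ?V" for U \<psi>
      using charts[OF that] linear_coordinates_inj by auto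
    show "openin (Euclidean_space (pdim ?V)) (\<psi> ` (U \<inter> W))"
      if "(U, \<psi>) \<in> charts ?V" "(W, \<omega>) \<in> charts ?V" for U \<psi> W \<omega>
      using charts[OF that(1)] charts[OF that(2)] linear_coordinates_range[of \<psi>] by (simp add: dim)
    show "analytic_germ (pdim ?V) (\<psi> ` (U \<inter> W)) (\<lambda>x. \<omega> (inv_into U \<psi> x) i) a"
      if U: "(U, \<psi>) \<in> charts ?V" and W: "(W, \<omega>) \<in> charts ?V" and a: "a \<in> \<psi> ` (U \<inter> W)" for U \<psi> W \<omega> i a
    proof -
      have *: "U = UNIV" "linear_coordinates \<psi>" "linear_coordinates \<omega>"
        using charts[OF U] charts[OF W] by auto
      obtain p where "a = \<psi> p"
        using a by blast
      then show ?thesis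
        using vector_germ_linear[OF *(2) linear_coordinate[OF *(3)], of "U \<inter> W" i p]
        by (simp add: vector_germ_def dim *(1))
    qed
  qed
  have chart: "(UNIV, \<phi>) \<in> charts ?V"
    using \<phi> by (simp add: vector_prevariety_def)
  show "openin (ptop ?V) S \<longleftrightarrow> openin (Euclidean_space ?d) (\<phi> ` S)"
    using atlas_open_chart_image[OF _ chart, of S] atlas_open_if_open_in_chart[OF V chart, of S]
    by (auto simp: openin_ptop[OF V] dim)
qed

lemma openin_vector_positive:
  fixes \<phi> :: "'v::real_vector \<Rightarrow> nat \<Rightarrow> real"
  assumes \<phi>: "linear_coordinates \<phi>" and S: "openin (ptop (vector_prevariety :: 'v prevariety)) S"
    and g: "\<And>p. p \<in> S \<Longrightarrow> vector_germ \<phi> S g p"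
  shows "openin (ptop (vector_prevariety :: 'v prevariety)) {p \<in> S. 0 < g p}"
proof -
  let ?d = "dim (UNIV :: 'v set)"
  let ?T = "{y \<in> topspace (Euclidean_space 1). 0 < y 0}"
  have T: "openin (Euclidean_space 1) ?T"
    unfolding openin_Euclidean_space_box
  proof (intro conjI ballI)
    fix a assume "a \<in> ?T"
    then show "\<exists>r>0. \<forall>x\<in>topspace (Euclidean_space 1). (\<forall>i<1. \<bar>x i - a i\<bar> < r) \<longrightarrow> x \<in> ?T"
      by (intro exI[of _ "a 0"]) auto
  qed auto
  define G where "G x i = (if i = 0 then g (inv \<phi> x) else 0)" for x and i :: nat
  have "openin (Euclidean_space ?d) {x \<in> \<phi> ` S. G x \<in> ?T}"
  proof (rule openin_analytic_preimage[OF _ _ _ T])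
    show "openin (Euclidean_space ?d) (\<phi> ` S)"
      using S openin_vector[OF \<phi>] by blast
    show "analytic_germ ?d (\<phi> ` S) (\<lambda>x. G x i) a" if "i < 1" "a \<in> \<phi> ` S" for i a
      using that g by (auto simp: vector_germ_def G_def)
  qed (simp add: topspace_Euclidean_space G_def)
  also have "{x \<in> \<phi> ` S. G x \<in> ?T} = \<phi> ` {p \<in> S. 0 < g p}"
    by (auto simp: G_def topspace_Euclidean_space linear_coordinates_inv[OF \<phi>])
  finally show ?thesis
    using openin_vector[OF \<phi>] by blast
qed

text \<open>
  The criterion by which all maps below are shown to be analytic: \<open>\<kappa>\<close> parametrises an open part of a chart of
  \<open>X\<close> by an open subset \<open>S\<close> of a vector space, and the coordinates of \<open>F\<close> are examined as functions on \<open>S\<close>.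
\<close>

lemma analytic_at_via_vector_space:
  fixes \<Phi> :: "'v::real_vector \<Rightarrow> nat \<Rightarrow> real"
  assumes X: "real_analytic_prevariety X" and U: "(U, \<phi>) \<in> charts X" and W: "(W, \<psi>) \<in> charts Y"
    and \<Phi>: "linear_coordinates \<Phi>" and dim: "pdim X = dim (UNIV :: 'v set)"
    and S: "openin (ptop (vector_prevariety :: 'v prevariety)) S" "e \<in> S"
    and \<kappa>: "\<And>v. v \<in> S \<Longrightarrow> \<kappa> v \<in> U" "\<And>v. v \<in> S \<Longrightarrow> \<phi> (\<kappa> v) = \<Phi> v"
    and F: "\<And>v. v \<in> S \<Longrightarrow> F (\<kappa> v) \<in> W"
    and germ: "\<And>i. i < pdim Y \<Longrightarrow> vector_germ \<Phi> S (\<lambda>v. \<psi> (F (\<kappa> v)) i) e"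
  shows "analytic_at X Y F (\<kappa> e)"
  unfolding analytic_at_def
proof (rule exI[of _ U], rule exI[of _ \<phi>], rule exI[of _ W], rule exI[of _ \<psi>], rule exI[of _ "\<kappa> ` S"],
    intro conjI allI impI U W)
  have image: "\<phi> ` \<kappa> ` S = \<Phi> ` S"
    using \<kappa>(2) by (auto simp: image_image)
  show "openin (Euclidean_space (pdim X)) (\<phi> ` \<kappa> ` S)"
    unfolding image dim using S(1) openin_vector[OF \<Phi>] by blast
  fix i assume i: "i < pdim Y"
  show "analytic_germ (pdim X) (\<phi> ` \<kappa> ` S) (\<lambda>x. \<psi> (F (inv_into U \<phi> x)) i) (\<phi> (\<kappa> e))"
    unfolding image dim \<kappa>(2)[OF S(2)]
  proof (rule analytic_germ_cong[OF germ[OF i, unfolded vector_germ_def]])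
    fix x assume "x \<in> \<Phi> ` S"
    then obtain v where "v \<in> S" "x = \<Phi> v"
      by blast
    then show "\<psi> (F (\<kappa> (inv \<Phi> x))) i = \<psi> (F (inv_into U \<phi> x)) i"
      using chart_inv[OF X U \<kappa>(1)] \<kappa>(2) linear_coordinates_inv[OF \<Phi>] by metis
  qed
qed (use S(2) \<kappa> F in auto)

section \<open>The barrier and its slope\<close>

text \<open>
  A strictly convex function of \<open>v\<close> that depends on the parameter \<open>u\<close>.  For \<open>u \<noteq> 0\<close> it is finite on the whole
  line; for \<open>u = 0\<close> the denominator is \<open>2 * v\<close> on the positive half line and vanishes elsewhere, so that the
  domain shrinks to \<open>v > 0\<close>.  The quadratic term makes it coercive.
\<close>

definition barrier :: "real \<Rightarrow> real \<Rightarrow> real" where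
  "barrier u v = v\<^sup>2 / 2 + inverse (sqrt (u\<^sup>2 + v\<^sup>2) + v)"

text \<open>
  The derivative of the barrier in \<open>v\<close>.  For \<open>u \<noteq> 0\<close> it equals \<open>v + v / (r * u\<^sup>2) - 1 / u\<^sup>2\<close> with
  \<open>r = sqrt (u\<^sup>2 + v\<^sup>2)\<close>, an odd function of \<open>v\<close> up to a constant.
\<close>

definition slope :: "real \<Rightarrow> real \<Rightarrow> real" where
  "slope u v = v - inverse (sqrt (u\<^sup>2 + v\<^sup>2) * (sqrt (u\<^sup>2 + v\<^sup>2) + v))"

lemma
  assumes "u \<noteq> 0 \<or> 0 < v"
  shows sum_squares_pos: "0 < u\<^sup>2 + v\<^sup>2"
    and radius_pos: "0 < sqrt (u\<^sup>2 + v\<^sup>2)"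
    and radius_add_pos: "0 < sqrt (u\<^sup>2 + v\<^sup>2) + v"
proof -
  show squares: "0 < u\<^sup>2 + v\<^sup>2"
    using assms by (auto simp: sum_power2_gt_zero_iff)
  show radius: "0 < sqrt (u\<^sup>2 + v\<^sup>2)"
    by (rule real_sqrt_gt_zero[OF squares])
  show "0 < sqrt (u\<^sup>2 + v\<^sup>2) + v"
  proof (cases "0 < v")
    case True
    show ?thesis
      by (rule add_pos_pos[OF radius True])
  next
    case False
    then have "u \<noteq> 0"
      using assms by blast
    have "sqrt (v\<^sup>2) < sqrt (u\<^sup>2 + v\<^sup>2)"
      by (rule real_sqrt_less_mono) (simp add: \<open>u \<noteq> 0\<close>)
    then show ?thesis
      using abs_ge_minus_self[of v] by (simp only: real_sqrt_abs)
  qed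
qed

lemma radius_pos_iff: "0 < sqrt (u\<^sup>2 + v\<^sup>2) + v \<longleftrightarrow> u \<noteq> 0 \<or> 0 < v"
proof
  assume pos: "0 < sqrt (u\<^sup>2 + v\<^sup>2) + v"
  show "u \<noteq> 0 \<or> 0 < v"
  proof (rule ccontr)
    assume "\<not> (u \<noteq> 0 \<or> 0 < v)"
    then have "sqrt (u\<^sup>2 + v\<^sup>2) + v = \<bar>v\<bar> + v" "v \<le> 0"
      by simp_all
    then show False
      using pos by simp
  qed
qed (rule radius_add_pos)

text \<open>
  Stated for a general radius function \<open>R\<close> with \<open>R' = v / R\<close> in order to cover the real and the complex square
  root alike.
\<close>

lemma slope_field_derivative:
  fixes R :: "'a::real_normed_field \<Rightarrow> 'a"
  assumes R: "(R has_field_derivative v / R v) (at v)" and nz: "R v \<noteq> 0" "R v + v \<noteq> 0"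
  shows "((\<lambda>v. v - inverse (R v * (R v + v))) has_field_derivative 1 + inverse (R v ^ 3)) (at v)"
proof -
  define r s where "r = R v" and "s = R v + v"
  have nz': "r \<noteq> 0" "s \<noteq> 0" and v: "v = s - r"
    using nz by (simp_all add: r_def s_def)
  have "((\<lambda>v. v - inverse (R v * (R v + v))) has_field_derivative
      1 - - (inverse (r * s) * (v / r * s + (v / r + 1) * r) * inverse (r * s))) (at v)"
    unfolding r_def s_def
    by (intro DERIV_diff DERIV_ident DERIV_inverse' DERIV_mult DERIV_add R) (use nz in simp)
  moreover have "v / r * s + (v / r + 1) * r = s\<^sup>2 / r"
    using nz' by (simp add: v field_simps power2_eq_square)
  moreover have "inverse (r * s) * (s\<^sup>2 / r) * inverse (r * s) = inverse (r ^ 3)"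
    using nz' by (simp add: field_simps power2_eq_square power3_eq_cube)
  ultimately show ?thesis
    by (simp add: r_def)
qed

lemma radius_deriv:
  assumes "u \<noteq> 0 \<or> 0 < v"
  shows "((\<lambda>v. sqrt (u\<^sup>2 + v\<^sup>2)) has_real_derivative v / sqrt (u\<^sup>2 + v\<^sup>2)) (at v)"
proof -
  have "((\<lambda>v. u\<^sup>2 + v\<^sup>2) has_real_derivative 2 * v) (at v)"
    by (auto intro!: derivative_eq_intros)
  from DERIV_chain2[OF DERIV_real_sqrt[OF sum_squares_pos[OF assms]] this] show ?thesis
    by (rule DERIV_cong) (simp only: divide_inverse, simp)
qed

lemma barrier_deriv:
  assumes "u \<noteq> 0 \<or> 0 < v"
  shows "(barrier u has_real_derivative slope u v) (at v)"
proof -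
  define r s where "r = sqrt (u\<^sup>2 + v\<^sup>2)" and "s = sqrt (u\<^sup>2 + v\<^sup>2) + v"
  have pos: "0 < r" "0 < s" and v: "v = s - r"
    using radius_pos[OF assms] radius_add_pos[OF assms] by (simp_all add: r_def s_def)
  have "((\<lambda>v. v\<^sup>2 / 2) has_real_derivative v) (at v)"
    by (auto intro!: derivative_eq_intros)
  from DERIV_add[OF this DERIV_inverse'[OF DERIV_add[OF radius_deriv[OF assms] DERIV_ident]
      less_imp_neq[OF radius_add_pos[OF assms], symmetric]]]
  have "((\<lambda>v. v\<^sup>2 / 2 + inverse (sqrt (u\<^sup>2 + v\<^sup>2) + v)) has_real_derivative
      v + - (inverse s * (v / r + 1) * inverse s)) (at v)"
    by (simp only: r_def s_def)
  moreover have "inverse s * (v / r + 1) * inverse s = inverse (r * s)"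
    using pos by (simp add: v field_simps)
  moreover have "barrier u = (\<lambda>v. v\<^sup>2 / 2 + inverse (sqrt (u\<^sup>2 + v\<^sup>2) + v))"
    by (rule ext) (rule barrier_def)
  moreover have "slope u v = v + - inverse (r * s)"
    by (simp add: slope_def r_def s_def)
  ultimately show ?thesis
    by simp
qed

lemma slope_deriv:
  assumes "u \<noteq> 0 \<or> 0 < v"
  shows "(slope u has_real_derivative 1 + inverse (sqrt (u\<^sup>2 + v\<^sup>2) ^ 3)) (at v)"
proof -
  have eq: "slope u = (\<lambda>v. v - inverse (sqrt (u\<^sup>2 + v\<^sup>2) * (sqrt (u\<^sup>2 + v\<^sup>2) + v)))"
    by (rule ext) (rule slope_def)
  show ?thesis
    unfolding eq
    by (rule slope_field_derivative[OF radius_deriv[OF assms]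
          less_imp_neq[OF radius_pos[OF assms], symmetric] less_imp_neq[OF radius_add_pos[OF assms], symmetric]])
qed

lemma slope_increment:
  assumes "u \<noteq> 0 \<or> 0 < v" "v \<le> w"
  shows "w - v \<le> slope u w - slope u v"
proof -
  have "slope u v - v \<le> slope u w - w"
  proof (rule DERIV_nonneg_imp_nondecreasing[OF assms(2)])
    fix x assume x: "v \<le> x" "x \<le> w"
    then have good: "u \<noteq> 0 \<or> 0 < x"
      using assms(1) by auto
    have "((\<lambda>x. slope u x - x) has_real_derivative inverse (sqrt (u\<^sup>2 + x\<^sup>2) ^ 3)) (at x)"
      using DERIV_diff[OF slope_deriv[OF good] DERIV_ident] by simp
    then show "\<exists>y. ((\<lambda>x. slope u x - x) has_real_derivative y) (at x) \<and> 0 \<le> y"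
      by (intro exI conjI) auto
  qed
  then show ?thesis
    by simp
qed

lemma slope_monotone:
  assumes "u \<noteq> 0 \<or> 0 < v" "u \<noteq> 0 \<or> 0 < w"
  shows "(w - v)\<^sup>2 \<le> (slope u w - slope u v) * (w - v)"
proof (cases "v \<le> w")
  case True
  have "(w - v) * (w - v) \<le> (slope u w - slope u v) * (w - v)"
    by (rule mult_right_mono[OF slope_increment[OF assms(1) True]]) (use True in simp)
  then show ?thesis
    unfolding power2_eq_square .
next
  case False
  then have le: "w \<le> v"
    by simp
  have "(v - w) * (v - w) \<le> (slope u v - slope u w) * (v - w)"
    by (rule mult_right_mono[OF slope_increment[OF assms(2) le]]) (use le in simp)
  moreover have "(v - w) * (v - w) = (w - v)\<^sup>2"
    by (simp add: power2_eq_square algebra_simps)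
  moreover have "(slope u v - slope u w) * (v - w) = (slope u w - slope u v) * (w - v)"
    by (simp add: algebra_simps)
  ultimately show ?thesis
    by simp
qed

text \<open>
  With \<open>r = sqrt (u\<^sup>2 + v\<^sup>2)\<close> the product \<open>(r + v) * (r - v)\<close> is \<open>u\<^sup>2\<close>, so the fractions \<open>1 / (r * (r + v))\<close> and
  \<open>1 / (r * (r - v))\<close> add up to \<open>2 / u\<^sup>2\<close>.  That this does not depend on \<open>v\<close> is the reason why translations
  by covectors mean the same in all chambers, and the reason for the choice of the barrier.
\<close>

lemma slope_minus:
  assumes "u \<noteq> 0"
  shows "slope u (- v) = - slope u v - 2 / u\<^sup>2"
proof -
  define r where "r = sqrt (u\<^sup>2 + v\<^sup>2)"
  have r: "0 < r" "0 < r + v" "0 < r - v"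
    using radius_pos[of u v] radius_add_pos[of u v] radius_add_pos[of u "- v"] assms by (simp_all add: r_def)
  have u: "u\<^sup>2 = (r + v) * (r - v)"
    by (simp add: r_def algebra_simps power2_eq_square[symmetric])
  have sum_inverse: "inverse (r * a) + inverse (r * b) = (a + b) * inverse (r * (a * b))"
    if "a \<noteq> 0" "b \<noteq> 0" for a b
    using that r(1) by (simp add: field_simps)
  have "inverse (r * (r + v)) + inverse (r * (r - v)) = ((r + v) + (r - v)) * inverse (r * ((r + v) * (r - v)))"
    by (rule sum_inverse) (use r in auto)
  also have "\<dots> = 2 / u\<^sup>2"
    unfolding u using r(1) by (simp add: divide_inverse)
  finally have "inverse (r * (r + v)) + inverse (r * (r - v)) = 2 / u\<^sup>2" .
  then show ?thesis
    by (simp add: slope_def r_def)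
qed

definition complex_slope :: "complex \<Rightarrow> complex \<Rightarrow> complex" where
  "complex_slope u v = v - inverse (csqrt (u\<^sup>2 + v\<^sup>2) * (csqrt (u\<^sup>2 + v\<^sup>2) + v))"

lemma complex_slope_of_real: "complex_slope (of_real u) (of_real v) = of_real (slope u v)"
proof -
  have "csqrt ((of_real u)\<^sup>2 + (of_real v)\<^sup>2) = of_real (sqrt (u\<^sup>2 + v\<^sup>2))"
    using of_real_sqrt[of "u\<^sup>2 + v\<^sup>2"] by simp
  then show ?thesis
    by (simp add: complex_slope_def slope_def)
qed

text \<open>
  The points off the branch cut of the square root and off the poles of the complex slope.
\<close>

definition slope_regular :: "complex \<Rightarrow> complex \<Rightarrow> bool" where
  "slope_regular u v \<longleftrightarrow> u\<^sup>2 + v\<^sup>2 \<notin> \<real>\<^sub>\<le>\<^sub>0 \<and> csqrt (u\<^sup>2 + v\<^sup>2) + v \<noteq> 0"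

lemma slope_regularD: "slope_regular u v \<Longrightarrow> u\<^sup>2 + v\<^sup>2 \<noteq> 0"
  by (auto simp: slope_regular_def)

lemma complex_slope_holomorphic:
  assumes "u holomorphic_on U" "v holomorphic_on U" "\<And>t. t \<in> U \<Longrightarrow> slope_regular (u t) (v t)"
  shows "(\<lambda>t. complex_slope (u t) (v t)) holomorphic_on U"
  unfolding complex_slope_def
proof -
  have "(u t)\<^sup>2 + (v t)\<^sup>2 \<notin> \<real>\<^sub>\<le>\<^sub>0" "(u t)\<^sup>2 + (v t)\<^sup>2 \<noteq> 0" "csqrt ((u t)\<^sup>2 + (v t)\<^sup>2) + v t \<noteq> 0"
    if "t \<in> U" for t
    using assms(3)[OF that] slope_regularD[OF assms(3)[OF that]] by (simp_all add: slope_regular_def)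
  then show "(\<lambda>t. v t - inverse (csqrt ((u t)\<^sup>2 + (v t)\<^sup>2) * (csqrt ((u t)\<^sup>2 + (v t)\<^sup>2) + v t))) holomorphic_on U"
    by (intro holomorphic_intros assms(1,2)) auto
qed

lemma complex_slope_deriv:
  assumes "slope_regular u v"
  shows "(complex_slope u has_field_derivative 1 + inverse (csqrt (u\<^sup>2 + v\<^sup>2) ^ 3)) (at v)"
proof -
  have nz: "csqrt (u\<^sup>2 + v\<^sup>2) \<noteq> 0" "csqrt (u\<^sup>2 + v\<^sup>2) + v \<noteq> 0"
    using assms slope_regularD[OF assms] by (simp_all add: slope_regular_def)
  have "((\<lambda>v. u\<^sup>2 + v\<^sup>2) has_field_derivative 2 * v) (at v)"
    by (auto intro!: derivative_eq_intros)
  moreover have "(csqrt has_field_derivative inverse (2 * csqrt (u\<^sup>2 + v\<^sup>2))) (at (u\<^sup>2 + v\<^sup>2))"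
    using assms by (intro has_field_derivative_csqrt) (simp add: slope_regular_def)
  ultimately have "((\<lambda>v. csqrt (u\<^sup>2 + v\<^sup>2)) has_field_derivative inverse (2 * csqrt (u\<^sup>2 + v\<^sup>2)) * (2 * v)) (at v)"
    by (rule DERIV_chain2[rotated])
  then have deriv: "((\<lambda>v. csqrt (u\<^sup>2 + v\<^sup>2)) has_field_derivative v / csqrt (u\<^sup>2 + v\<^sup>2)) (at v)"
    by (rule DERIV_cong) (simp only: divide_inverse inverse_mult_distrib, simp)
  have eq: "complex_slope u = (\<lambda>v. v - inverse (csqrt (u\<^sup>2 + v\<^sup>2) * (csqrt (u\<^sup>2 + v\<^sup>2) + v)))"
    by (rule ext) (rule complex_slope_def)
  show ?thesis
    unfolding eq by (rule slope_field_derivative[OF deriv nz])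
qed

text \<open>
  A radius \<open>e\<close> around the real point \<open>(u\<^sub>0, v\<^sub>0)\<close> within which the complex slope is holomorphic, differs from
  the linear map given by its derivative in \<open>v\<close> by an \<open>\<epsilon>\<close>-Lipschitz function of \<open>v\<close>, and moves by less than
  \<open>\<epsilon>\<close> when only \<open>u\<close> changes.  These are the estimates that Newton's iteration with a fixed derivative uses.
\<close>

definition slope_radius :: "real \<Rightarrow> real \<Rightarrow> real \<Rightarrow> real \<Rightarrow> bool" where
  "slope_radius u\<^sub>0 v\<^sub>0 \<epsilon> e \<longleftrightarrow> 0 < e \<and>
     (\<forall>u v. norm (u - of_real u\<^sub>0) < e \<longrightarrow> norm (v - of_real v\<^sub>0) < e \<longrightarrow> slope_regular u v) \<and>
     (\<forall>u v w. norm (u - of_real u\<^sub>0) < e \<longrightarrow> norm (v - of_real v\<^sub>0) < e \<longrightarrow> norm (w - of_real v\<^sub>0) < e \<longrightarrow>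
        norm (complex_slope u v - complex_slope u w
          - of_real (1 + inverse (sqrt (u\<^sub>0\<^sup>2 + v\<^sub>0\<^sup>2) ^ 3)) * (v - w)) \<le> \<epsilon> * norm (v - w)) \<and>
     (\<forall>u. norm (u - of_real u\<^sub>0) < e \<longrightarrow>
        norm (complex_slope u (of_real v\<^sub>0) - of_real (slope u\<^sub>0 v\<^sub>0)) < \<epsilon>)"

lemma
  assumes "slope_radius u\<^sub>0 v\<^sub>0 \<epsilon> e" "norm (u - of_real u\<^sub>0) < e"
  shows slope_radius_regular: "norm (v - of_real v\<^sub>0) < e \<Longrightarrow> slope_regular u v"
    and slope_radius_lipschitz: "norm (v - of_real v\<^sub>0) < e \<Longrightarrow> norm (w - of_real v\<^sub>0) < e \<Longrightarrow>
        norm (complex_slope u v - complex_slope u w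
          - of_real (1 + inverse (sqrt (u\<^sub>0\<^sup>2 + v\<^sub>0\<^sup>2) ^ 3)) * (v - w)) \<le> \<epsilon> * norm (v - w)"
    and slope_radius_near: "norm (complex_slope u (of_real v\<^sub>0) - of_real (slope u\<^sub>0 v\<^sub>0)) < \<epsilon>"
  using assms unfolding slope_radius_def by simp_all

lemma slope_radius_antimono:
  assumes "slope_radius u\<^sub>0 v\<^sub>0 \<epsilon> e" "0 < e'" "e' \<le> e"
  shows "slope_radius u\<^sub>0 v\<^sub>0 \<epsilon> e'"
  unfolding slope_radius_def
  using assms(2) less_le_trans[OF _ assms(3)] slope_radius_regular[OF assms(1)]
    slope_radius_lipschitz[OF assms(1)] slope_radius_near[OF assms(1)]
  by (intro conjI allI impI) simp_all

text \<open>
  The derivative \<open>1 + 1 / r\<^sup>3\<close> of the complex slope is continuous, and the mean value inequality turns the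
  \<open>\<epsilon>\<close>-variation of the derivative into the Lipschitz estimate.
\<close>

lemma ex_slope_radius:
  assumes good: "u\<^sub>0 \<noteq> 0 \<or> 0 < v\<^sub>0" and \<epsilon>: "0 < \<epsilon>"
  shows "\<exists>e. slope_radius u\<^sub>0 v\<^sub>0 \<epsilon> e"
proof -
  define p\<^sub>0 :: "complex \<times> complex" where "p\<^sub>0 = (of_real u\<^sub>0, of_real v\<^sub>0)"
  define R where "R p = csqrt ((fst p)\<^sup>2 + (snd p)\<^sup>2)" for p
  define r\<^sub>0 where "r\<^sub>0 = sqrt (u\<^sub>0\<^sup>2 + v\<^sub>0\<^sup>2)"
  note r\<^sub>0 = sum_squares_pos[OF good] radius_pos[OF good, folded r\<^sub>0_def] radius_add_pos[OF good, folded r\<^sub>0_def]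
  have sq: "(fst p\<^sub>0)\<^sup>2 + (snd p\<^sub>0)\<^sup>2 = of_real (u\<^sub>0\<^sup>2 + v\<^sub>0\<^sup>2)"
    by (simp add: p\<^sub>0_def)
  have R\<^sub>0: "R p\<^sub>0 = of_real r\<^sub>0"
    unfolding R_def sq r\<^sub>0_def by (rule of_real_sqrt[symmetric]) simp
  have pos: "of_real (u\<^sub>0\<^sup>2 + v\<^sub>0\<^sup>2) \<notin> (\<real>\<^sub>\<le>\<^sub>0 :: complex set)"
    using r\<^sub>0(1) by (simp only: nonpos_Reals_of_real_iff not_le)
  have "isCont (\<lambda>p. (fst p)\<^sup>2 + (snd p)\<^sup>2) p\<^sub>0"
    by (intro continuous_intros)
  moreover have "isCont csqrt ((fst p\<^sub>0)\<^sup>2 + (snd p\<^sub>0)\<^sup>2)"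
    unfolding sq using pos by (rule continuous_at_csqrt)
  ultimately have cont_R: "isCont R p\<^sub>0"
    unfolding R_def by (rule isCont_o2)
  have "eventually (\<lambda>p. (fst p)\<^sup>2 + (snd p)\<^sup>2 \<in> - \<real>\<^sub>\<le>\<^sub>0) (nhds p\<^sub>0)"
  proof (rule topological_tendstoD[where l = "(fst p\<^sub>0)\<^sup>2 + (snd p\<^sub>0)\<^sup>2"])
    show "((\<lambda>p. (fst p)\<^sup>2 + (snd p)\<^sup>2) \<longlongrightarrow> (fst p\<^sub>0)\<^sup>2 + (snd p\<^sub>0)\<^sup>2) (nhds p\<^sub>0)"
      by (intro tendsto_intros filterlim_ident)
    show "open (- \<real>\<^sub>\<le>\<^sub>0 :: complex set)"
      by (simp add: open_Compl)
  qed (use pos sq in simp)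
  moreover have "eventually (\<lambda>p. R p + snd p \<noteq> 0) (nhds p\<^sub>0)"
  proof (rule tendsto_imp_eventually_ne)
    show "((\<lambda>p. R p + snd p) \<longlongrightarrow> of_real (r\<^sub>0 + v\<^sub>0)) (nhds p\<^sub>0)"
      using cont_R R\<^sub>0 unfolding isCont_def tendsto_at_iff_tendsto_nhds
      by (auto intro!: tendsto_eq_intros filterlim_ident simp: p\<^sub>0_def)
    show "of_real (r\<^sub>0 + v\<^sub>0) \<noteq> (0 :: complex)"
      using r\<^sub>0(3) by (simp only: of_real_eq_0_iff)
  qed
  moreover have "eventually (\<lambda>p. dist (inverse (R p ^ 3)) (inverse (of_real r\<^sub>0 ^ 3)) < \<epsilon>) (nhds p\<^sub>0)"
  proof (rule tendstoD[OF _ \<epsilon>])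
    show "((\<lambda>p. inverse (R p ^ 3)) \<longlongrightarrow> inverse (of_real r\<^sub>0 ^ 3)) (nhds p\<^sub>0)"
      using cont_R R\<^sub>0 r\<^sub>0(2) unfolding isCont_def tendsto_at_iff_tendsto_nhds
      by (auto intro!: tendsto_eq_intros)
  qed
  moreover have "eventually (\<lambda>p. dist (snd p - inverse (R p * (R p + snd p))) (of_real (slope u\<^sub>0 v\<^sub>0)) < \<epsilon>) (nhds p\<^sub>0)"
  proof (rule tendstoD[OF _ \<epsilon>])
    have "((\<lambda>p. snd p - inverse (R p * (R p + snd p))) \<longlongrightarrow>
        of_real v\<^sub>0 - inverse (of_real r\<^sub>0 * (of_real r\<^sub>0 + of_real v\<^sub>0))) (nhds p\<^sub>0)"
      using cont_R R\<^sub>0 r\<^sub>0(2,3) unfolding isCont_def tendsto_at_iff_tendsto_nhds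
      by (auto intro!: tendsto_eq_intros filterlim_ident simp: p\<^sub>0_def simp flip: of_real_add)
    then show "((\<lambda>p. snd p - inverse (R p * (R p + snd p))) \<longlongrightarrow> of_real (slope u\<^sub>0 v\<^sub>0)) (nhds p\<^sub>0)"
      by (simp add: slope_def r\<^sub>0_def)
  qed
  ultimately have "eventually (\<lambda>p. slope_regular (fst p) (snd p) \<and>
      norm (inverse (R p ^ 3) - inverse (of_real r\<^sub>0 ^ 3)) \<le> \<epsilon> \<and>
      norm (complex_slope (fst p) (snd p) - of_real (slope u\<^sub>0 v\<^sub>0)) < \<epsilon>) (nhds p\<^sub>0)"
    by eventually_elim (auto simp: slope_regular_def R_def complex_slope_def dist_norm)
  then obtain d where d: "d > 0" and near: "\<And>p. dist p p\<^sub>0 < d \<Longrightarrow> slope_regular (fst p) (snd p) \<and>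
      norm (inverse (R p ^ 3) - inverse (of_real r\<^sub>0 ^ 3)) \<le> \<epsilon> \<and>
      norm (complex_slope (fst p) (snd p) - of_real (slope u\<^sub>0 v\<^sub>0)) < \<epsilon>"
    unfolding eventually_nhds_metric by blast
  have near': "dist (u, v) p\<^sub>0 < d" if "norm (u - of_real u\<^sub>0) < d / 2" "norm (v - of_real v\<^sub>0) < d / 2" for u v
  proof -
    have "dist (u, v) p\<^sub>0 \<le> dist u (of_real u\<^sub>0) + dist v (of_real v\<^sub>0)"
      unfolding p\<^sub>0_def dist_Pair_Pair by (rule sqrt_sum_squares_le_sum) simp_all
    then show ?thesis
      using that by (simp add: dist_norm)
  qed
  have "slope_radius u\<^sub>0 v\<^sub>0 \<epsilon> (d / 2)"
    unfolding slope_radius_def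
  proof (intro conjI allI impI)
    show "slope_regular u v" if "norm (u - of_real u\<^sub>0) < d / 2" "norm (v - of_real v\<^sub>0) < d / 2" for u v
      using near[OF near'[OF that]] by simp
    show "norm (complex_slope u (of_real v\<^sub>0) - of_real (slope u\<^sub>0 v\<^sub>0)) < \<epsilon>"
      if "norm (u - of_real u\<^sub>0) < d / 2" for u
      using near[OF near'[OF that, of "of_real v\<^sub>0"]] d by simp
    fix u v w :: complex assume u: "norm (u - of_real u\<^sub>0) < d / 2" and v: "norm (v - of_real v\<^sub>0) < d / 2"
      and w: "norm (w - of_real v\<^sub>0) < d / 2"
    define k where "k = complex_of_real (1 + inverse (r\<^sub>0 ^ 3))"
    have "norm ((complex_slope u v - k * v) - (complex_slope u w - k * w)) \<le> \<epsilon> * norm (v - w)"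
    proof (rule field_differentiable_bound[of "ball (of_real v\<^sub>0) (d / 2)"])
      fix z assume "z \<in> ball (complex_of_real v\<^sub>0) (d / 2)"
      then have z: "norm (z - of_real v\<^sub>0) < d / 2"
        by (simp add: dist_norm norm_minus_commute)
      note near_z = near[OF near'[OF u z]]
      have "((\<lambda>z. complex_slope u z - k * z) has_field_derivative
          (1 + inverse (csqrt (u\<^sup>2 + z\<^sup>2) ^ 3)) - k) (at z)"
        using DERIV_diff[OF complex_slope_deriv DERIV_cmult_Id] near_z by simp
      then show "((\<lambda>z. complex_slope u z - k * z) has_field_derivative
          inverse (csqrt (u\<^sup>2 + z\<^sup>2) ^ 3) - inverse (of_real r\<^sub>0 ^ 3)) (at z within ball (of_real v\<^sub>0) (d / 2))"
        by (simp add: k_def has_field_derivative_at_within)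
      show "norm (inverse (csqrt (u\<^sup>2 + z\<^sup>2) ^ 3) - inverse (of_real r\<^sub>0 ^ 3)) \<le> \<epsilon>"
        using near_z by (simp add: R_def)
    qed (use v w in \<open>auto simp: dist_norm norm_minus_commute\<close>)
    then show "norm (complex_slope u v - complex_slope u w
        - of_real (1 + inverse (sqrt (u\<^sub>0\<^sup>2 + v\<^sub>0\<^sup>2) ^ 3)) * (v - w)) \<le> \<epsilon> * norm (v - w)"
      by (simp add: k_def r\<^sub>0_def algebra_simps)
  qed (use d in simp)
  then show ?thesis
    by blast
qed

lemma ex_common_slope_radius:
  fixes J :: "'j set"
  assumes J: "finite J" and good: "\<And>j. j \<in> J \<Longrightarrow> u\<^sub>0 j \<noteq> 0 \<or> 0 < v\<^sub>0 j" and \<epsilon>: "0 < \<epsilon>"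
  obtains e where "0 < e" "\<And>j. j \<in> J \<Longrightarrow> slope_radius (u\<^sub>0 j) (v\<^sub>0 j) \<epsilon> e"
proof -
  have "\<exists>e. slope_radius (u\<^sub>0 j) (v\<^sub>0 j) \<epsilon> e" if "j \<in> J" for j
    by (rule ex_slope_radius[OF good[OF that] \<epsilon>])
  then obtain e where e: "\<And>j. j \<in> J \<Longrightarrow> slope_radius (u\<^sub>0 j) (v\<^sub>0 j) \<epsilon> (e j)"
    by metis
  have e_pos: "0 < e j" if "j \<in> J" for j
    using e[OF that] unfolding slope_radius_def by (rule conjunct1)
  define m where "m = Min (insert 1 (e ` J))"
  have m: "0 < m" "\<And>j. j \<in> J \<Longrightarrow> m \<le> e j"
    using J e_pos by (auto simp: m_def)
  show thesis
    by (rule that[OF m(1) slope_radius_antimono[OF e m(1) m(2)]])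
qed

section \<open>Fixed points depending holomorphically on parameters\<close>

text \<open>
  The iterates from the constant start \<open>b\<close> are holomorphic in the parameter and converge uniformly, at a
  geometric rate, so their limit is holomorphic too.  The first step has length at most \<open>\<rho> / 4\<close> and lengths
  halve, so the iterates stay within \<open>\<rho> / 2\<close> of \<open>b\<close>.  The last clause records that an iteration which
  preserves real points has a real limit.
\<close>

theorem holomorphic_fixed_point:
  fixes T :: "(nat \<Rightarrow> complex) \<Rightarrow> (nat \<Rightarrow> complex) \<Rightarrow> nat \<Rightarrow> complex"
  assumes r: "0 < \<rho>"
    and hol: "\<And>U p w i. i < d \<Longrightarrow> open U \<Longrightarrow> (\<And>j. j < m \<Longrightarrow> (\<lambda>t. p t j) holomorphic_on U) \<Longrightarrow>
        (\<And>j. j < d \<Longrightarrow> (\<lambda>t. w t j) holomorphic_on U) \<Longrightarrow>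
        (\<And>t. t \<in> U \<Longrightarrow> p t \<in> polydisc m a r) \<Longrightarrow> (\<And>t. t \<in> U \<Longrightarrow> w t \<in> polydisc d b \<rho>) \<Longrightarrow>
        (\<lambda>t. T (p t) (w t) i) holomorphic_on U"
    and contract: "\<And>p w w' s i. p \<in> polydisc m a r \<Longrightarrow> w \<in> polydisc d b \<rho> \<Longrightarrow> w' \<in> polydisc d b \<rho> \<Longrightarrow>
        (\<And>j. j < d \<Longrightarrow> norm (w j - w' j) \<le> s) \<Longrightarrow> i < d \<Longrightarrow> norm (T p w i - T p w' i) \<le> s / 2"
    and start: "\<And>p i. p \<in> polydisc m a r \<Longrightarrow> i < d \<Longrightarrow> norm (T p b i - b i) \<le> \<rho> / 4"
  shows "\<exists>W. (\<forall>i<d. bounded_holomorphic m (polydisc m a r) (\<lambda>p. W p i)) \<and>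
    (\<forall>p\<in>polydisc m a r. W p \<in> polydisc d b \<rho> \<and> (\<forall>i<d. T p (W p) i = W p i) \<and>
      ((\<forall>j<d. b j \<in> \<real>) \<longrightarrow> (\<forall>w\<in>polydisc d b \<rho>. (\<forall>j<d. w j \<in> \<real>) \<longrightarrow> (\<forall>j<d. T p w j \<in> \<real>)) \<longrightarrow>
        (\<forall>i<d. W p i \<in> \<real>)))"
proof -
  define P where "P = polydisc m a r"
  define W where "W k p = ((\<lambda>w. T p w) ^^ k) b" for k p
  have W_Suc: "W (Suc k) p = T p (W k p)" and W_0: "W 0 p = b" for k p
    by (simp_all add: W_def)
  have step: "(\<forall>i<d. norm (W k p i - b i) \<le> \<rho> / 2 * (1 - (1/2) ^ k)) \<and>
      (\<forall>i<d. norm (W (Suc k) p i - W k p i) \<le> \<rho> / 4 * (1/2) ^ k)" if p: "p \<in> P" for k p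
  proof (induction k)
    case 0
    then show ?case
      using start p by (simp add: W_Suc W_0 P_def)
  next
    case (Suc k)
    have A: "norm (W (Suc k) p i - b i) \<le> \<rho> / 2 * (1 - (1/2) ^ Suc k)" if "i < d" for i
    proof -
      have "norm (W (Suc k) p i - b i) \<le> norm (W (Suc k) p i - W k p i) + norm (W k p i - b i)"
        using norm_triangle_ineq[of "W (Suc k) p i - W k p i" "W k p i - b i"] by simp
      also have "\<dots> \<le> \<rho> / 4 * (1/2) ^ k + \<rho> / 2 * (1 - (1/2) ^ k)"
        using Suc.IH that by (intro add_mono) auto
      also have "\<dots> = \<rho> / 2 * (1 - (1/2) ^ Suc k)"
        by (simp add: field_simps)
      finally show ?thesis .
    qed
    have less: "\<rho> / 2 * (1 - (1/2) ^ l) < \<rho>" for l :: nat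
    proof -
      have "\<rho> / 2 * (1 - (1/2) ^ l) \<le> \<rho> / 2 * 1"
        using r by (intro mult_left_mono) auto
      also have "\<rho> / 2 * 1 < \<rho>"
        using r by simp
      finally show ?thesis .
    qed
    have "W k p \<in> polydisc d b \<rho>" "W (Suc k) p \<in> polydisc d b \<rho>"
      unfolding polydisc_def using Suc.IH A le_less_trans[OF _ less] by blast+
    then have "norm (T p (W (Suc k) p) i - T p (W k p) i) \<le> (\<rho> / 4 * (1/2) ^ k) / 2" if "i < d" for i
      using contract[of p "W (Suc k) p" "W k p" "\<rho> / 4 * (1/2) ^ k" i] p Suc.IH that by (simp add: P_def)
    then have "\<forall>i<d. norm (W (Suc (Suc k)) p i - W (Suc k) p i) \<le> \<rho> / 4 * (1/2) ^ Suc k"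
      by (simp add: W_Suc)
    then show ?case
      using A by blast
  qed
  have W_half: "norm (W k p i - b i) \<le> \<rho> / 2" if "p \<in> P" "i < d" for k p i
  proof -
    have "norm (W k p i - b i) \<le> \<rho> / 2 * (1 - (1/2) ^ k)"
      using step[OF that(1)] that(2) by blast
    also have "\<dots> \<le> \<rho> / 2 * 1"
      using r by (intro mult_left_mono) auto
    finally show ?thesis
      by simp
  qed
  then have W_in: "W k p \<in> polydisc d b \<rho>" if "p \<in> P" for k p
    unfolding polydisc_def using that r by (auto intro: le_less_trans[of _ "\<rho> / 2"])
  have hol_W: "bounded_holomorphic m P (\<lambda>p. W k p i)" if "i < d" for k i
  proof (rule bounded_holomorphicI[where M = "norm (b i) + \<rho> / 2"])
    show "norm (W k z i) \<le> norm (b i) + \<rho> / 2" if "z \<in> P" for z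
      using W_half[OF that \<open>i < d\<close>, of k] norm_triangle_ineq[of "b i" "W k z i - b i"] by simp
    fix U :: "complex set" and c
    assume U: "open U" and c: "\<And>i. i < m \<Longrightarrow> (\<lambda>t. c t i) holomorphic_on U" "c ` U \<subseteq> P"
    have "(\<lambda>t. W k (c t) i) holomorphic_on U" if "i < d" for i
      using that
    proof (induction k arbitrary: i)
      case 0
      then show ?case
        by (simp add: W_0)
    next
      case (Suc k)
      show ?case
        unfolding W_Suc
        by (rule hol[OF Suc.prems U c(1) Suc.IH]) (use c(2) W_in in \<open>auto simp: P_def\<close>)
    qed
    then show "(\<lambda>t. W k (c t) i) holomorphic_on U"
      using that .
  qed
  define L where "L i p = (\<Sum>k. W (Suc k) p i - W k p i)" for i p
  have telescope: "(\<Sum>k<n. W (Suc k) p i - W k p i) = W n p i - b i" for n p i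
    using sum_lessThan_telescope[of "\<lambda>k. W k p i" n] by (simp add: W_0)
  have L: "uniform_limit P (\<lambda>n p. W n p i - b i) (L i) sequentially" if i: "i < d" for i
  proof -
    have "uniform_limit P (\<lambda>n p. \<Sum>k<n. W (Suc k) p i - W k p i) (L i) sequentially"
      unfolding L_def
    proof (rule Weierstrass_m_test)
      show "norm (W (Suc k) p i - W k p i) \<le> \<rho> / 4 * (1/2) ^ k" if "p \<in> P" for k p
        using step[OF that] i by blast
      show "summable (\<lambda>k. \<rho> / 4 * (1/2) ^ k)"
        by (intro summable_mult summable_geometric) simp
    qed
    then show ?thesis
      unfolding telescope .
  qed
  define V where "V p i = L i p + b i" for p i
  have V: "uniform_limit P (\<lambda>n p. W n p i) (\<lambda>p. V p i) sequentially" if "i < d" for i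
    using uniform_limit_add[OF L[OF that] uniform_limit_const[where c = "\<lambda>_. b i"]]
    by (simp add: V_def)
  have lim: "(\<lambda>n. W n p i) \<longlonglongrightarrow> V p i" if "p \<in> P" "i < d" for p i
    using tendsto_uniform_limitI[OF V[OF that(2)] that(1)] .
  have V_in: "V p \<in> polydisc d b \<rho>" if p: "p \<in> P" for p
    unfolding polydisc_def
  proof (intro CollectI allI impI)
    fix i assume i: "i < d"
    have "(\<lambda>n. norm (W n p i - b i)) \<longlonglongrightarrow> norm (V p i - b i)"
      by (intro tendsto_intros lim p i)
    then have "norm (V p i - b i) \<le> \<rho> / 2"
      by (rule LIMSEQ_le_const2) (use W_half[OF p i] in auto)
    then show "norm (V p i - b i) < \<rho>"
      using r by simp
  qed
  have fixed: "T p (V p) i = V p i" if p: "p \<in> P" and i: "i < d" for p i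
  proof -
    define s where "s n = (\<Sum>j<d. norm (W n p j - V p j))" for n
    have "s \<longlonglongrightarrow> (\<Sum>j<d. norm (V p j - V p j))"
      unfolding s_def by (intro tendsto_intros lim p) auto
    then have s0: "(\<lambda>n. s n / 2) \<longlonglongrightarrow> 0"
      by (auto intro: tendsto_eq_intros)
    have "norm (W n p j - V p j) \<le> s n" if "j < d" for n j
      unfolding s_def using that by (intro member_le_sum) auto
    then have "norm (T p (W n p) i - T p (V p) i) \<le> s n / 2" for n
      using contract[of p "W n p" "V p" "s n" i] W_in[OF p] V_in[OF p] p i by (simp add: P_def)
    then have "(\<lambda>n. T p (W n p) i - T p (V p) i) \<longlonglongrightarrow> 0"
      by (intro Lim_null_comparison[OF _ s0]) auto
    then have "(\<lambda>n. W (Suc n) p i) \<longlonglongrightarrow> T p (V p) i"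
      by (simp add: W_Suc LIM_zero_iff)
    then show ?thesis
      using LIMSEQ_Suc[OF lim[OF p i]] LIMSEQ_unique by blast
  qed
  show ?thesis
  proof (intro exI[of _ V] conjI allI ballI impI)
    show "bounded_holomorphic m (polydisc m a r) (\<lambda>p. V p i)" if "i < d" for i
      using bounded_holomorphic_uniform_limit[OF _ V[OF that]] hol_W[OF that] by (simp add: P_def)
    show "V p \<in> polydisc d b \<rho>" if "p \<in> polydisc m a r" for p
      using V_in that by (simp add: P_def)
    show "T p (V p) i = V p i" if "p \<in> polydisc m a r" "i < d" for p i
      using fixed that by (simp add: P_def)
    fix p i
    assume p: "p \<in> polydisc m a r" and i: "i < d" and b: "\<forall>j<d. b j \<in> \<real>"
      and T: "\<forall>w\<in>polydisc d b \<rho>. (\<forall>j<d. w j \<in> \<real>) \<longrightarrow> (\<forall>j<d. T p w j \<in> \<real>)"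
    have "\<forall>j<d. W k p j \<in> \<real>" for k
    proof (induction k)
      case 0
      then show ?case
        using b by (simp add: W_0)
    next
      case (Suc k)
      have "W k p \<in> polydisc d b \<rho>"
        using W_in p by (simp add: P_def)
      then show ?case
        unfolding W_Suc using T Suc.IH by blast
    qed
    then have "\<forall>n. W n p i \<in> \<real>"
      using i by blast
    then show "V p i \<in> \<real>"
      using closed_sequentially[OF closed_complex_Reals _ lim[of p i]] p i by (simp add: P_def)
  qed
qed

section \<open>Analytic solution of systems of slope equations\<close>

lemma norm_linear_form_diff_le:
  fixes c :: "nat \<Rightarrow> real" and z w :: "nat \<Rightarrow> complex"
  assumes "\<And>i. i < d \<Longrightarrow> norm (z i - w i) \<le> s"
  shows "norm ((\<Sum>i<d. of_real (c i) * z i) - (\<Sum>i<d. of_real (c i) * w i)) \<le> (\<Sum>i<d. \<bar>c i\<bar>) * s"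
proof -
  have "norm (\<Sum>i<d. of_real (c i) * (z i - w i)) \<le> (\<Sum>i<d. \<bar>c i\<bar> * s)"
  proof (rule sum_norm_le)
    show "norm (of_real (c i) * (z i - w i)) \<le> \<bar>c i\<bar> * s" if "i \<in> {..<d}" for i
      using assms[of i] that unfolding norm_mult norm_of_real by (intro mult_left_mono) auto
  qed
  then show ?thesis
    by (simp add: sum_subtractf right_diff_distrib sum_distrib_right)
qed

lemma norm_matrix_apply_le:
  fixes B :: "nat \<Rightarrow> nat \<Rightarrow> real" and z :: "nat \<Rightarrow> complex"
  assumes "i < d" "\<And>k. k < d \<Longrightarrow> norm (z k) \<le> E k"
  shows "norm (\<Sum>k<d. of_real (B i k) * z k) \<le> (\<Sum>i<d. \<Sum>k<d. \<bar>B i k\<bar> * E k)"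
proof -
  have E: "0 \<le> E k" if "k < d" for k
    using order_trans[OF norm_ge_zero assms(2)[OF that]] .
  have "norm (\<Sum>k<d. of_real (B i k) * z k) \<le> (\<Sum>k<d. \<bar>B i k\<bar> * E k)"
  proof (rule sum_norm_le)
    show "norm (of_real (B i k) * z k) \<le> \<bar>B i k\<bar> * E k" if "k \<in> {..<d}" for k
      using assms(2)[of k] that unfolding norm_mult norm_of_real by (intro mult_left_mono) auto
  qed
  also have "\<dots> \<le> (\<Sum>i<d. \<Sum>k<d. \<bar>B i k\<bar> * E k)"
    using assms(1) E by (intro member_le_sum[of i "{..<d}" "\<lambda>i. \<Sum>k<d. \<bar>B i k\<bar> * E k"] sum_nonneg) auto
  finally show ?thesis .
qed

text \<open>
  Transposing \<open>B * A = 1\<close> yields \<open>A * B\<^sup>T = 1\<close>; associativity then gives \<open>B = B * A * B\<^sup>T = B\<^sup>T\<close>,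
  so \<open>B\<close> is also a right inverse of \<open>A\<close>.
\<close>

lemma symmetric_left_inverse_injective:
  fixes A B :: "nat \<Rightarrow> nat \<Rightarrow> real" and z :: "nat \<Rightarrow> complex"
  assumes BA: "\<And>i l. i < d \<Longrightarrow> l < d \<Longrightarrow> (\<Sum>k<d. B i k * A k l) = (if i = l then 1 else 0)"
    and sym: "\<And>k l. A k l = A l k"
    and z: "\<And>i. i < d \<Longrightarrow> (\<Sum>k<d. of_real (B i k) * z k) = 0" and l: "l < d"
  shows "z l = 0"
proof -
  have AB: "(\<Sum>i<d. A k i * B l i) = (if l = k then 1 else 0)" if "l < d" "k < d" for l k
  proof -
    have "(\<Sum>i<d. A k i * B l i) = (\<Sum>i<d. B l i * A i k)"
      by (rule sum.cong) (simp_all add: sym[of k] mult.commute)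
    then show ?thesis
      using BA[OF that] by simp
  qed
  have BT: "B i l = B l i" if i: "i < d" and l: "l < d" for i l
  proof -
    have "(\<Sum>k<d. \<Sum>j<d. B i k * A k j * B l j) = (\<Sum>k<d. B i k * (\<Sum>j<d. A k j * B l j))"
      by (simp add: sum_distrib_left mult.assoc)
    also have "\<dots> = (\<Sum>k<d. if l = k then B i k else 0)"
      using l by (intro sum.cong) (simp_all add: AB)
    also have "\<dots> = B i l"
      using l by simp
    finally have 1: "(\<Sum>k<d. \<Sum>j<d. B i k * A k j * B l j) = B i l" .
    have "(\<Sum>k<d. \<Sum>j<d. B i k * A k j * B l j) = (\<Sum>j<d. \<Sum>k<d. B i k * A k j * B l j)"
      by (rule sum.swap)
    also have "\<dots> = (\<Sum>j<d. (\<Sum>k<d. B i k * A k j) * B l j)"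
      by (simp add: sum_distrib_right)
    also have "\<dots> = (\<Sum>j<d. if i = j then B l j else 0)"
      using i by (intro sum.cong) (simp_all add: BA)
    also have "\<dots> = B l i"
      using i by simp
    finally show ?thesis
      using 1 by simp
  qed
  have "(\<Sum>i<d. of_real (A l i) * (\<Sum>k<d. of_real (B i k) * z k)) = (0 :: complex)"
    using z by simp
  moreover have "(\<Sum>i<d. of_real (A l i) * (\<Sum>k<d. of_real (B i k) * z k))
      = (\<Sum>i<d. \<Sum>k<d. of_real (A l i * B i k) * z k)"
    by (simp add: sum_distrib_left mult.assoc)
  moreover have "\<dots> = (\<Sum>k<d. \<Sum>i<d. of_real (A l i * B i k) * z k)"
    by (rule sum.swap)
  moreover have "\<dots> = (\<Sum>k<d. of_real (\<Sum>i<d. A l i * B i k) * z k)"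
    by (simp add: sum_distrib_right)
  moreover have "\<dots> = (\<Sum>k<d. if l = k then z k else 0)"
  proof (rule sum.cong[OF refl])
    fix k assume "k \<in> {..<d}"
    then have "(\<Sum>i<d. A l i * B i k) = (if k = l then 1 else 0)"
      using AB[of k l] l BT by simp
    then show "of_real (\<Sum>i<d. A l i * B i k) * z k = (if l = k then z k else 0)"
      by simp
  qed
  ultimately show ?thesis
    using l by simp
qed

text \<open>
  An analytic inverse function theorem with parameters for the system
  \<open>\<Sum>j. slope (u j) (v j) * \<alpha> j k = \<xi> k\<close> in the unknown \<open>w\<close>, where the \<open>u j\<close> are affine in the first half of
  the parameter vector, the \<open>v j\<close> are linear in \<open>w\<close>, and \<open>\<xi>\<close> is the second half.  With \<open>B\<close> the inverse of the
  derivative at the known solution, the map \<open>w \<mapsto> w - B (G w - \<xi>)\<close> has small derivative there, hence is a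
  contraction, and its fixed points are the solutions because \<open>B\<close> is injective.  It preserves real points,
  so the solution for real parameters is real.
\<close>

theorem slope_system_solution:
  fixes J :: "'j set" and c :: "'j \<Rightarrow> real" and l \<alpha> :: "'j \<Rightarrow> nat \<Rightarrow> real"
    and p\<^sub>0 w\<^sub>0 :: "nat \<Rightarrow> real" and B :: "nat \<Rightarrow> nat \<Rightarrow> real" and d :: nat
  defines "u\<^sub>0 \<equiv> \<lambda>j. c j + (\<Sum>i<d. l j i * p\<^sub>0 i)" and "v\<^sub>0 \<equiv> \<lambda>j. \<Sum>i<d. \<alpha> j i * w\<^sub>0 i"
  assumes J: "finite J" and good: "\<And>j. j \<in> J \<Longrightarrow> u\<^sub>0 j \<noteq> 0 \<or> 0 < v\<^sub>0 j"
    and BA: "\<And>i m. i < d \<Longrightarrow> m < d \<Longrightarrow>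
      (\<Sum>k<d. B i k * (\<Sum>j\<in>J. (1 + inverse (sqrt ((u\<^sub>0 j)\<^sup>2 + (v\<^sub>0 j)\<^sup>2) ^ 3)) * \<alpha> j k * \<alpha> j m))
      = (if i = m then 1 else 0)"
    and solves: "\<And>k. k < d \<Longrightarrow> (\<Sum>j\<in>J. slope (u\<^sub>0 j) (v\<^sub>0 j) * \<alpha> j k) = p\<^sub>0 (d + k)"
  obtains r W where "0 < r"
    and "\<And>i. i < d \<Longrightarrow> bounded_holomorphic (d + d) (polydisc (d + d) (cvec p\<^sub>0) r) (\<lambda>z. W z i)"
    and "\<And>p. cvec p \<in> polydisc (d + d) (cvec p\<^sub>0) r \<Longrightarrow>
      \<exists>w :: nat \<Rightarrow> real. (\<forall>i<d. W (cvec p) i = of_real (w i)) \<and>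
        (\<forall>j\<in>J. c j + (\<Sum>i<d. l j i * p i) \<noteq> 0 \<or> 0 < (\<Sum>i<d. \<alpha> j i * w i)) \<and>
        (\<forall>k<d. (\<Sum>j\<in>J. slope (c j + (\<Sum>i<d. l j i * p i)) (\<Sum>i<d. \<alpha> j i * w i) * \<alpha> j k) = p (d + k))"
proof -
  define \<kappa> where "\<kappa> j = 1 + inverse (sqrt ((u\<^sub>0 j)\<^sup>2 + (v\<^sub>0 j)\<^sup>2) ^ 3)" for j
  define u where "u j z = of_real (c j) + (\<Sum>i<d. of_real (l j i) * z i)" for j and z :: "nat \<Rightarrow> complex"
  define v where "v j z = (\<Sum>i<d. of_real (\<alpha> j i) * z i)" for j and z :: "nat \<Rightarrow> complex"
  define N where "N j = (\<Sum>i<d. \<bar>\<alpha> j i\<bar>)" for j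
  define C where "C = (\<Sum>i<d. \<Sum>k<d. \<bar>B i k\<bar> * (\<Sum>j\<in>J. \<bar>\<alpha> j k\<bar> * N j))"
  define D where "D = (\<Sum>i<d. \<Sum>k<d. \<bar>B i k\<bar> * ((\<Sum>j\<in>J. \<bar>\<alpha> j k\<bar>) + 1))"
  have N: "0 \<le> N j" for j
    by (simp add: N_def sum_nonneg)
  have C: "0 \<le> C" and D: "0 \<le> D"
    unfolding C_def D_def using N by (auto intro!: sum_nonneg mult_nonneg_nonneg add_nonneg_nonneg)
  \<comment> \<open>\<open>C\<close> is the factor by which an \<open>\<epsilon>\<close>-error in the slopes is amplified, so the iteration contracts
    by \<open>\<epsilon> * C \<le> 1 / 2\<close>.\<close>
  define \<epsilon> where "\<epsilon> = 1 / (2 * (C + 1))"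
  have \<epsilon>: "0 < \<epsilon>" "\<epsilon> * C \<le> 1 / 2"
    using C by (simp_all add: \<epsilon>_def field_simps)
  have u_cvec: "u j (cvec p) = of_real (c j + (\<Sum>i<d. l j i * p i))" for j p
    by (simp add: u_def cvec_def)
  have v_cvec: "v j (cvec w) = of_real (\<Sum>i<d. \<alpha> j i * w i)" for j w
    by (simp add: v_def cvec_def)
  obtain e where e: "0 < e" and radius: "\<And>j. j \<in> J \<Longrightarrow> slope_radius (u\<^sub>0 j) (v\<^sub>0 j) \<epsilon> e"
    using ex_common_slope_radius[where u\<^sub>0 = u\<^sub>0 and v\<^sub>0 = v\<^sub>0, OF J good \<epsilon>(1)] by blast
  note regular = slope_radius_regular[OF radius]
  note lipschitz = slope_radius_lipschitz[OF radius, folded \<kappa>_def]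
  \<comment> \<open>If \<open>w\<close> stays within \<open>\<rho>\<close> of \<open>w\<^sub>0\<close> then each \<open>v j\<close> stays within \<open>e\<close> of its initial value.\<close>
  define \<rho> where "\<rho> = e / ((\<Sum>j\<in>J. N j) + 1)"
  have \<rho>: "0 < \<rho>"
    using e N by (simp add: \<rho>_def add_nonneg_pos sum_nonneg)
  have N\<rho>: "N j * \<rho> < e" if "j \<in> J" for j
  proof -
    have "N j \<le> (\<Sum>j\<in>J. N j)"
      using that J N by (intro member_le_sum) auto
    then have "N j * \<rho> < ((\<Sum>j\<in>J. N j) + 1) * \<rho>"
      using \<rho> by simp
    also have "\<dots> = e"
      using N sum_nonneg[of J N] by (simp add: \<rho>_def)
    finally show ?thesis .
  qed
  \<comment> \<open>If the equations fail by at most \<open>\<delta>\<close> in each slope and in each right-hand side, then the first step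
    is at most \<open>\<rho> / 4\<close> long.  The radius \<open>r\<close> of the parameters is chosen afterwards.\<close>
  define \<delta> where "\<delta> = \<rho> / (8 * (D + 1))"
  have \<delta>: "0 < \<delta>" "2 * \<delta> * D \<le> \<rho> / 4"
    using \<rho> D by (simp_all add: \<delta>_def field_simps)
  obtain e' where e': "0 < e'" and radius': "\<And>j. j \<in> J \<Longrightarrow> slope_radius (u\<^sub>0 j) (v\<^sub>0 j) \<delta> e'"
    using ex_common_slope_radius[where u\<^sub>0 = u\<^sub>0 and v\<^sub>0 = v\<^sub>0, OF J good \<delta>(1)] by blast
  note start = slope_radius_near[OF radius']
  define L where "L = (\<Sum>j\<in>J. \<Sum>i<d. \<bar>l j i\<bar>) + 1"
  have L: "0 < L" "\<And>j. j \<in> J \<Longrightarrow> (\<Sum>i<d. \<bar>l j i\<bar>) < L"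
  proof -
    show "0 < L"
      by (simp add: L_def add_nonneg_pos sum_nonneg)
    show "(\<Sum>i<d. \<bar>l j i\<bar>) < L" if "j \<in> J" for j
      using member_le_sum[OF that, of "\<lambda>j. \<Sum>i<d. \<bar>l j i\<bar>"] J by (simp add: L_def sum_nonneg)
  qed
  define r where "r = min \<delta> (min e e' / L)"
  have r: "0 < r" "r \<le> \<delta>" "L * r \<le> e" "L * r \<le> e'"
    using \<delta>(1) e e' L(1) by (auto simp: r_def min_def field_simps)
  let ?P = "polydisc (d + d) (cvec p\<^sub>0) r"
  let ?Q = "polydisc d (cvec w\<^sub>0) \<rho>"
  have u_near: "norm (u j p - of_real (u\<^sub>0 j)) < e" "norm (u j p - of_real (u\<^sub>0 j)) < e'"
    if j: "j \<in> J" and p: "p \<in> ?P" for j p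
  proof -
    have "norm (p i - cvec p\<^sub>0 i) \<le> r" if "i < d" for i
      using p that by (simp add: polydisc_def less_imp_le)
    from norm_linear_form_diff_le[OF this, of d "\<lambda>i. i" "l j"]
    have "norm (u j p - u j (cvec p\<^sub>0)) \<le> (\<Sum>i<d. \<bar>l j i\<bar>) * r"
      by (simp add: u_def)
    also have "\<dots> < L * r"
      using L(2)[OF j] r(1) by simp
    finally have "norm (u j p - of_real (u\<^sub>0 j)) < L * r"
      unfolding u_cvec u\<^sub>0_def .
    then show "norm (u j p - of_real (u\<^sub>0 j)) < e" "norm (u j p - of_real (u\<^sub>0 j)) < e'"
      using r by simp_all
  qed
  have v_diff: "norm (v j w - v j w') \<le> N j * s" if "\<And>i. i < d \<Longrightarrow> norm (w i - w' i) \<le> s" for j w w' s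
    using norm_linear_form_diff_le[OF that] by (simp add: v_def N_def)
  have v_near: "norm (v j w - of_real (v\<^sub>0 j)) < e" if j: "j \<in> J" and w: "w \<in> ?Q" for j w
  proof -
    have "norm (v j w - v j (cvec w\<^sub>0)) \<le> N j * \<rho>"
      using w by (intro v_diff) (simp add: polydisc_def less_imp_le)
    then show ?thesis
      using N\<rho>[OF j] unfolding v_cvec v\<^sub>0_def by simp
  qed
  define G where "G p w k = (\<Sum>j\<in>J. complex_slope (u j p) (v j w) * of_real (\<alpha> j k))" for p w k
  define T where "T p w i = w i - (\<Sum>k<d. of_real (B i k) * (G p w k - p (d + k)))" for p w i
  define A where "A k m = (\<Sum>j\<in>J. \<kappa> j * \<alpha> j k * \<alpha> j m)" for k m
  have BA': "(\<Sum>k<d. B i k * A k m) = (if i = m then 1 else 0)" if "i < d" "m < d" for i m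
    using BA[OF that] by (simp add: A_def \<kappa>_def)
  have A_sym: "A k m = A m k" for k m
    unfolding A_def by (rule sum.cong) (simp_all add: mult_ac)
  have contract: "norm (T p w i - T p w' i) \<le> s / 2"
    if p: "p \<in> ?P" and w: "w \<in> ?Q" and w': "w' \<in> ?Q"
      and s: "\<And>j. j < d \<Longrightarrow> norm (w j - w' j) \<le> s" and i: "i < d" for p w w' s i
  proof -
    \<comment> \<open>The linear part of the iteration cancels since \<open>B * A = 1\<close>; only the remainders \<open>R j\<close> are left.\<close>
    define R where "R j = complex_slope (u j p) (v j w) - complex_slope (u j p) (v j w') - of_real (\<kappa> j) * (v j w - v j w')" for j
    have s0: "0 \<le> s"
      using s[OF i] norm_ge_zero order_trans by blast
    have R: "norm (R j) \<le> \<epsilon> * (N j * s)" if j: "j \<in> J" for j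
    proof -
      have "norm (R j) \<le> \<epsilon> * norm (v j w - v j w')"
        unfolding R_def by (rule lipschitz[OF j u_near(1)[OF j p] v_near[OF j w] v_near[OF j w']])
      also have "\<dots> \<le> \<epsilon> * (N j * s)"
        using \<epsilon>(1) by (intro mult_left_mono v_diff s) auto
      finally show ?thesis .
    qed
    have "w i - w' i = (\<Sum>m<d. if i = m then w m - w' m else 0)"
      using i by simp
    also have "\<dots> = (\<Sum>m<d. of_real (\<Sum>k<d. B i k * A k m) * (w m - w' m))"
      using i by (intro sum.cong) (simp_all add: BA')
    also have "\<dots> = (\<Sum>m<d. \<Sum>k<d. of_real (B i k) * (of_real (A k m) * (w m - w' m)))"
      by (simp add: sum_distrib_right mult.assoc)
    also have "\<dots> = (\<Sum>k<d. of_real (B i k) * (\<Sum>m<d. of_real (A k m) * (w m - w' m)))"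
      by (subst sum.swap) (simp add: sum_distrib_left)
    also have "\<dots> = (\<Sum>k<d. of_real (B i k) * (\<Sum>j\<in>J. of_real (\<alpha> j k) * (of_real (\<kappa> j) * (v j w - v j w'))))"
    proof (intro sum.cong refl arg_cong2[where f = "(*)"])
      fix k
      have "(\<Sum>m<d. of_real (A k m) * (w m - w' m)) =
          (\<Sum>m<d. \<Sum>j\<in>J. of_real (\<alpha> j k) * (of_real (\<kappa> j) * (of_real (\<alpha> j m) * (w m - w' m))))"
        unfolding A_def of_real_sum sum_distrib_right by (intro sum.cong refl) (simp add: mult_ac)
      also have "\<dots> = (\<Sum>j\<in>J. \<Sum>m<d. of_real (\<alpha> j k) * (of_real (\<kappa> j) * (of_real (\<alpha> j m) * (w m - w' m))))"
        by (rule sum.swap)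
      also have "\<dots> = (\<Sum>j\<in>J. of_real (\<alpha> j k) * (of_real (\<kappa> j) * (v j w - v j w')))"
        unfolding v_def sum_subtractf[symmetric] sum_distrib_left
        by (intro sum.cong refl) (simp add: algebra_simps)
      finally show "(\<Sum>m<d. of_real (A k m) * (w m - w' m)) =
          (\<Sum>j\<in>J. of_real (\<alpha> j k) * (of_real (\<kappa> j) * (v j w - v j w')))" .
    qed
    finally have w_diff: "w i - w' i = (\<Sum>k<d. of_real (B i k) * (\<Sum>j\<in>J. of_real (\<alpha> j k) * (of_real (\<kappa> j) * (v j w - v j w'))))" .
    have G_diff: "G p w k - G p w' k - (\<Sum>j\<in>J. of_real (\<alpha> j k) * (of_real (\<kappa> j) * (v j w - v j w')))
        = (\<Sum>j\<in>J. of_real (\<alpha> j k) * R j)" for k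
      unfolding G_def sum_subtractf[symmetric] by (intro sum.cong refl) (simp add: R_def algebra_simps)
    have "T p w i - T p w' i = (w i - w' i) - (\<Sum>k<d. of_real (B i k) * (G p w k - G p w' k))"
      by (simp add: T_def algebra_simps sum_subtractf sum.distrib)
    also have "\<dots> = - (\<Sum>k<d. of_real (B i k) * (\<Sum>j\<in>J. of_real (\<alpha> j k) * R j))"
      unfolding w_diff G_diff[symmetric] sum_subtractf[symmetric] sum_negf[symmetric]
      by (intro sum.cong refl) (simp add: right_diff_distrib)
    finally have "norm (T p w i - T p w' i) = norm (\<Sum>k<d. of_real (B i k) * (\<Sum>j\<in>J. of_real (\<alpha> j k) * R j))"
      by simp
    also have "\<dots> \<le> (\<Sum>i<d. \<Sum>k<d. \<bar>B i k\<bar> * (\<Sum>j\<in>J. \<bar>\<alpha> j k\<bar> * (\<epsilon> * (N j * s))))"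
    proof (rule norm_matrix_apply_le[OF i], rule sum_norm_le)
      show "norm (of_real (\<alpha> j k) * R j) \<le> \<bar>\<alpha> j k\<bar> * (\<epsilon> * (N j * s))" if "j \<in> J" for j k
        using R[OF that] unfolding norm_mult norm_of_real by (intro mult_left_mono) auto
    qed
    also have "\<dots> = (\<epsilon> * C) * s"
      by (simp add: C_def sum_distrib_left sum_distrib_right mult_ac)
    also have "\<dots> \<le> 1 / 2 * s"
      using \<epsilon>(2) s0 by (rule mult_right_mono)
    finally show ?thesis
      by simp
  qed
  have start_T: "norm (T p (cvec w\<^sub>0) i - cvec w\<^sub>0 i) \<le> \<rho> / 4" if p: "p \<in> ?P" and i: "i < d" for p i
  proof -
    have "norm (G p (cvec w\<^sub>0) k - p (d + k)) \<le> 2 * \<delta> * ((\<Sum>j\<in>J. \<bar>\<alpha> j k\<bar>) + 1)" if k: "k < d" for k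
    proof -
      have "norm (G p (cvec w\<^sub>0) k - of_real (p\<^sub>0 (d + k)))
        = norm (\<Sum>j\<in>J. (complex_slope (u j p) (of_real (v\<^sub>0 j)) - of_real (slope (u\<^sub>0 j) (v\<^sub>0 j))) * of_real (\<alpha> j k))"
        unfolding solves[OF k, symmetric] G_def v_cvec v\<^sub>0_def by (simp add: sum_subtractf left_diff_distrib)
      also have "\<dots> \<le> (\<Sum>j\<in>J. \<delta> * \<bar>\<alpha> j k\<bar>)"
      proof (rule sum_norm_le)
        fix j assume j: "j \<in> J"
        show "norm ((complex_slope (u j p) (of_real (v\<^sub>0 j)) - of_real (slope (u\<^sub>0 j) (v\<^sub>0 j))) * of_real (\<alpha> j k)) \<le> \<delta> * \<bar>\<alpha> j k\<bar>"
          unfolding norm_mult norm_of_real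
          by (rule mult_right_mono[OF less_imp_le[OF start[OF j u_near(2)[OF j p]]]]) simp
      qed
      finally have 1: "norm (G p (cvec w\<^sub>0) k - of_real (p\<^sub>0 (d + k))) \<le> \<delta> * (\<Sum>j\<in>J. \<bar>\<alpha> j k\<bar>)"
        by (simp add: sum_distrib_left)
      have "norm (p (d + k) - cvec p\<^sub>0 (d + k)) < r"
        using p k by (simp add: polydisc_def)
      then have 2: "norm (of_real (p\<^sub>0 (d + k)) - p (d + k)) \<le> \<delta>"
        using r(2) by (simp add: cvec_def norm_minus_commute)
      have "norm (G p (cvec w\<^sub>0) k - p (d + k)) \<le> \<delta> * (\<Sum>j\<in>J. \<bar>\<alpha> j k\<bar>) + \<delta>"
        using norm_triangle_ineq[of "G p (cvec w\<^sub>0) k - of_real (p\<^sub>0 (d + k))" "of_real (p\<^sub>0 (d + k)) - p (d + k)"] 1 2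
        by simp
      also have "\<dots> = \<delta> * ((\<Sum>j\<in>J. \<bar>\<alpha> j k\<bar>) + 1)"
        by (simp add: algebra_simps)
      also have "\<dots> \<le> 2 * \<delta> * ((\<Sum>j\<in>J. \<bar>\<alpha> j k\<bar>) + 1)"
        using \<delta>(1) by (intro mult_right_mono) (auto intro!: add_nonneg_nonneg sum_nonneg)
      finally show ?thesis .
    qed
    from norm_matrix_apply_le[OF i this, of "\<lambda>k. k"]
    have "norm (\<Sum>k<d. of_real (B i k) * (G p (cvec w\<^sub>0) k - p (d + k)))
        \<le> (\<Sum>i<d. \<Sum>k<d. \<bar>B i k\<bar> * (2 * \<delta> * ((\<Sum>j\<in>J. \<bar>\<alpha> j k\<bar>) + 1)))"
      by simp
    also have "\<dots> = 2 * \<delta> * D"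
      by (simp add: D_def sum_distrib_left mult_ac)
    finally show ?thesis
      using \<delta>(2) by (simp add: T_def)
  qed
  have hol_T: "(\<lambda>t. T (p t) (w t) i) holomorphic_on U"
    if i: "i < d" and U: "open U" and p: "\<And>j. j < d + d \<Longrightarrow> (\<lambda>t. p t j) holomorphic_on U"
      and w: "\<And>j. j < d \<Longrightarrow> (\<lambda>t. w t j) holomorphic_on U"
      and pP: "\<And>t. t \<in> U \<Longrightarrow> p t \<in> ?P" and wQ: "\<And>t. t \<in> U \<Longrightarrow> w t \<in> ?Q" for U p w i
  proof -
    have "(\<lambda>t. u j (p t)) holomorphic_on U" for j
      unfolding u_def by (intro holomorphic_intros p) auto
    moreover have "(\<lambda>t. v j (w t)) holomorphic_on U" for j
      unfolding v_def by (intro holomorphic_intros w) auto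
    ultimately have "(\<lambda>t. complex_slope (u j (p t)) (v j (w t))) holomorphic_on U" if "j \<in> J" for j
      using regular[OF that u_near(1)[OF that pP] v_near[OF that wQ]] by (rule complex_slope_holomorphic)
    then show ?thesis
      unfolding T_def G_def by (intro holomorphic_intros p w i) auto
  qed
  have "\<exists>W. (\<forall>i<d. bounded_holomorphic (d + d) ?P (\<lambda>p. W p i)) \<and>
    (\<forall>p\<in>?P. W p \<in> ?Q \<and> (\<forall>i<d. T p (W p) i = W p i) \<and>
      ((\<forall>j<d. cvec w\<^sub>0 j \<in> \<real>) \<longrightarrow> (\<forall>w\<in>?Q. (\<forall>j<d. w j \<in> \<real>) \<longrightarrow> (\<forall>j<d. T p w j \<in> \<real>)) \<longrightarrow>
        (\<forall>i<d. W p i \<in> \<real>)))"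
    by (rule holomorphic_fixed_point[OF \<rho>]) (rule hol_T contract start_T; assumption)+
  then obtain W where W_hol: "\<forall>i<d. bounded_holomorphic (d + d) ?P (\<lambda>p. W p i)"
    and W: "\<forall>p\<in>?P. W p \<in> ?Q \<and> (\<forall>i<d. T p (W p) i = W p i) \<and>
      ((\<forall>j<d. cvec w\<^sub>0 j \<in> \<real>) \<longrightarrow> (\<forall>w\<in>?Q. (\<forall>j<d. w j \<in> \<real>) \<longrightarrow> (\<forall>j<d. T p w j \<in> \<real>)) \<longrightarrow>
        (\<forall>i<d. W p i \<in> \<real>))"
    by (elim exE conjE)
  have G_real: "G (cvec p) w k = of_real (\<Sum>j\<in>J. slope (c j + (\<Sum>i<d. l j i * p i)) (\<Sum>i<d. \<alpha> j i * x i) * \<alpha> j k)"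
    if "\<And>i. i < d \<Longrightarrow> w i = of_real (x i)" for p w x k
  proof -
    have v: "v j w = of_real (\<Sum>i<d. \<alpha> j i * x i)" for j
      unfolding v_def using that by simp
    show ?thesis
      unfolding G_def u_cvec v complex_slope_of_real by simp
  qed
  show thesis
  proof (rule that[OF r(1)])
    show "bounded_holomorphic (d + d) ?P (\<lambda>p. W p i)" if "i < d" for i
      using W_hol that by blast
    fix p assume p: "cvec p \<in> ?P"
    note W_p = bspec[OF W p]
    have "\<forall>j<d. T (cvec p) w j \<in> \<real>" if w: "\<forall>j<d. w j \<in> \<real>" for w
    proof (intro allI impI)
      fix j assume j: "j < d"
      have "w i = of_real (Re (w i))" if "i < d" for i
        using w that by (simp add: complex_is_Real_iff complex_eq_iff)
      from G_real[OF this] have "G (cvec p) w k \<in> \<real>" for k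
        by simp
      then show "T (cvec p) w j \<in> \<real>"
        unfolding T_def using w j by (intro Reals_diff sum_in_Reals Reals_mult) (auto simp: cvec_def)
    qed
    moreover have "\<forall>j<d. cvec w\<^sub>0 j \<in> \<real>"
      by (simp add: cvec_def)
    ultimately have "W (cvec p) i \<in> \<real>" if "i < d" for i
      using W_p that by blast
    then have W_Re: "W (cvec p) i = of_real (Re (W (cvec p) i))" if "i < d" for i
      using that by (simp add: complex_is_Real_iff complex_eq_iff)
    define w where "w i = Re (W (cvec p) i)" for i
    have Ww: "W (cvec p) i = of_real (w i)" if "i < d" for i
      using W_Re[OF that] by (simp add: w_def)
    have "c j + (\<Sum>i<d. l j i * p i) \<noteq> 0 \<or> 0 < (\<Sum>i<d. \<alpha> j i * w i)" if j: "j \<in> J" for j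
    proof -
      \<comment> \<open>The complex slope is regular along the solution; at a real point this forces \<open>r + v \<noteq> 0\<close>, and
        \<open>r + v\<close> is never negative.\<close>
      let ?u = "c j + (\<Sum>i<d. l j i * p i)" and ?v = "\<Sum>i<d. \<alpha> j i * w i"
      have "v j (W (cvec p)) = of_real ?v"
        unfolding v_def using Ww by simp
      then have "slope_regular (of_real ?u) (of_real ?v)"
        using regular[OF j u_near(1)[OF j p] v_near[OF j conjunct1[OF W_p]]] by (simp only: u_cvec)
      then have "csqrt (of_real (?u\<^sup>2 + ?v\<^sup>2)) + of_real ?v \<noteq> 0"
        by (simp add: slope_regular_def)
      then have "complex_of_real (sqrt (?u\<^sup>2 + ?v\<^sup>2) + ?v) \<noteq> 0"
        by (simp add: of_real_sqrt[symmetric])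
      then have "sqrt (?u\<^sup>2 + ?v\<^sup>2) + ?v \<noteq> 0"
        by (simp only: of_real_eq_0_iff not_False_eq_True)
      moreover have "\<bar>?v\<bar> \<le> sqrt (?u\<^sup>2 + ?v\<^sup>2)"
        by (rule real_sqrt_ge_abs2)
      ultimately have "0 < sqrt (?u\<^sup>2 + ?v\<^sup>2) + ?v"
        using abs_ge_minus_self[of ?v] by linarith
      then show ?thesis
        by (simp only: radius_pos_iff)
    qed
    moreover have "(\<Sum>j\<in>J. slope (c j + (\<Sum>i<d. l j i * p i)) (\<Sum>i<d. \<alpha> j i * w i) * \<alpha> j k) = p (d + k)"
      if k: "k < d" for k
    proof -
      have "(\<Sum>k<d. of_real (B i k) * (G (cvec p) (W (cvec p)) k - cvec p (d + k))) = 0" if "i < d" for i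
        using W_p that by (simp add: T_def)
      from symmetric_left_inverse_injective[OF BA' A_sym this k]
      have "G (cvec p) (W (cvec p)) k = of_real (p (d + k))"
        by (simp add: cvec_def)
      moreover have "G (cvec p) (W (cvec p)) k =
          of_real (\<Sum>j\<in>J. slope (c j + (\<Sum>i<d. l j i * p i)) (\<Sum>i<d. \<alpha> j i * w i) * \<alpha> j k)"
        by (rule G_real[OF Ww])
      ultimately show ?thesis
        by (simp only: of_real_eq_iff)
    qed
    ultimately show "\<exists>w. (\<forall>i<d. W (cvec p) i = of_real (w i)) \<and>
        (\<forall>j\<in>J. c j + (\<Sum>i<d. l j i * p i) \<noteq> 0 \<or> 0 < (\<Sum>i<d. \<alpha> j i * w i)) \<and>
        (\<forall>k<d. (\<Sum>j\<in>J. slope (c j + (\<Sum>i<d. l j i * p i)) (\<Sum>i<d. \<alpha> j i * w i) * \<alpha> j k) = p (d + k))"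
      using Ww by (intro exI[of _ w]) blast
  qed
qed

section \<open>Gradients of sums of barriers\<close>

lemma span_image_coefficients:
  fixes g :: "'j \<Rightarrow> 'w::real_vector"
  assumes J: "finite J" and v: "v \<in> span (g ` J)"
  obtains c where "v = (\<Sum>j\<in>J. c j *\<^sub>R g j)"
proof -
  define C where "C = range (\<lambda>c. \<Sum>j\<in>J. c j *\<^sub>R g j)"
  have "subspace C"
  proof (rule subspaceI)
    show "0 \<in> C"
      unfolding C_def by (rule range_eqI[where x = "\<lambda>_. 0"]) simp
    show "x + y \<in> C" if "x \<in> C" "y \<in> C" for x y
    proof -
      obtain b c where "x = (\<Sum>j\<in>J. b j *\<^sub>R g j)" "y = (\<Sum>j\<in>J. c j *\<^sub>R g j)"
        using \<open>x \<in> C\<close> \<open>y \<in> C\<close> by (auto simp: C_def)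
      then show ?thesis
        unfolding C_def by (intro range_eqI[where x = "\<lambda>j. b j + c j"]) (simp add: scaleR_left_distrib sum.distrib)
    qed
    show "t *\<^sub>R x \<in> C" if "x \<in> C" for t x
    proof -
      obtain b where "x = (\<Sum>j\<in>J. b j *\<^sub>R g j)"
        using \<open>x \<in> C\<close> by (auto simp: C_def)
      then show ?thesis
        unfolding C_def by (intro range_eqI[where x = "\<lambda>j. t * b j"]) (simp add: scaleR_sum_right)
    qed
  qed
  moreover have "g j \<in> C" if "j \<in> J" for j
  proof -
    have "(\<Sum>i\<in>J. (if j = i then 1 else 0) *\<^sub>R g i) = (\<Sum>i\<in>J. if j = i then g i else 0)"
      by (rule sum.cong) auto
    then show ?thesis
      unfolding C_def using J that by (intro range_eqI[where x = "\<lambda>i. if j = i then 1 else 0"]) simp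
  qed
  ultimately have "span (g ` J) \<subseteq> C"
    by (intro span_minimal) auto
  then show thesis
    using v that by (auto simp: C_def)
qed

lemma compact_box: "compact {t :: nat \<Rightarrow> real. \<forall>i. \<bar>t i\<bar> \<le> R i}"
proof -
  have "compactin (product_topology (\<lambda>_. euclideanreal) UNIV) (\<Pi>\<^sub>E i\<in>UNIV. {- R i..R i})"
    unfolding compactin_PiE by simp
  moreover have "(\<Pi>\<^sub>E i\<in>UNIV. {- R i..R i}) = {t. \<forall>i. \<bar>t i\<bar> \<le> R i}"
    by (auto simp: PiE_UNIV_domain abs_le_iff minus_le_iff)
  ultimately show ?thesis
    by (simp add: euclidean_product_topology)
qed

text \<open>
  The situation over one chamber: affine functions \<open>f j\<close> with covectors \<open>a j\<close>, which in the application are the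
  linear parts of the \<open>f j\<close> multiplied by the signs of the \<open>f j\<close> on the chamber.
\<close>

locale barrier_family =
  fixes J :: "'j set" and f :: "'j \<Rightarrow> 'v::real_vector \<Rightarrow> real" and a :: "'j \<Rightarrow> 'v dual_space"
    and \<phi> :: "'v \<Rightarrow> nat \<Rightarrow> real"
  assumes finite_J: "finite J" and affine: "\<And>j. j \<in> J \<Longrightarrow> affine_linear (f j)"
    and spanning: "span (a ` J) = UNIV" and coordinates: "linear_coordinates \<phi>"
    and nonempty: "\<And>x. \<exists>y. \<forall>j\<in>J. f j x \<noteq> 0 \<or> 0 < dual_apply (a j) y"
begin

definition fibre :: "'v \<Rightarrow> 'v set" where
  "fibre x = {y. \<forall>j\<in>J. f j x \<noteq> 0 \<or> 0 < dual_apply (a j) y}"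

text \<open>
  The derivative at \<open>y\<close> of the function \<open>y \<mapsto> \<Sum>j. barrier (f j x) (a j y)\<close> on the open convex set \<open>fibre x\<close>.
\<close>

definition gradient :: "'v \<Rightarrow> 'v \<Rightarrow> 'v dual_space" where
  "gradient x y = (\<Sum>j\<in>J. slope (f j x) (dual_apply (a j) y) *\<^sub>R a j)"

definition solve :: "'v \<Rightarrow> 'v dual_space \<Rightarrow> 'v" where
  "solve x \<xi> = (THE y. y \<in> fibre x \<and> gradient x y = \<xi>)"

lemma dual_apply_combination:
  "dual_apply (\<Sum>j\<in>J. c j *\<^sub>R a j) w = (\<Sum>j\<in>J. c j * dual_apply (a j) w)"
  by (simp add: linear_sum[OF linear_dual_apply_left] linear_scale[OF linear_dual_apply_left])

lemma functional_coefficients: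
  obtains c where "\<And>w. dual_apply \<xi> w = (\<Sum>j\<in>J. c j * dual_apply (a j) w)"
proof -
  obtain c where "\<xi> = (\<Sum>j\<in>J. c j *\<^sub>R a j)"
    using span_image_coefficients[OF finite_J, of \<xi> a] spanning by auto
  then show thesis
    using that dual_apply_combination by blast
qed

lemma dual_eqI: "(\<And>w. dual_apply \<xi> w = dual_apply \<eta> w) \<Longrightarrow> \<xi> = \<eta>"
  by (simp add: dual_apply_inject[symmetric] fun_eq_iff)

lemma coordinate_coefficients:
  obtains m where "\<And>w i. \<phi> w i = (\<Sum>j\<in>J. m i j * dual_apply (a j) w)"
proof -
  have "\<exists>c. \<forall>w. \<phi> w i = (\<Sum>j\<in>J. c j * dual_apply (a j) w)" for i
  proof -
    have "dual_apply (Dual (\<lambda>v. \<phi> v i)) w = \<phi> w i" for w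
      using linear_coordinate[OF coordinates] by (simp add: Dual_inverse)
    then show ?thesis
      using functional_coefficients[of "Dual (\<lambda>v. \<phi> v i)"] by metis
  qed
  then show thesis
    using that by metis
qed

lemma separating:
  assumes "\<And>j. j \<in> J \<Longrightarrow> dual_apply (a j) w = 0"
  shows "w = 0"
proof -
  obtain m where "\<And>w i. \<phi> w i = (\<Sum>j\<in>J. m i j * dual_apply (a j) w)"
    using coordinate_coefficients by blast
  then have "\<phi> w = \<phi> 0"
    using assms by (simp add: fun_eq_iff linear_0[OF linear_dual_apply])
  then show ?thesis
    using linear_coordinates_inj[OF coordinates] by (simp add: inj_eq)
qed

text \<open>
  The gradient is strongly monotone: its pairing with \<open>z - y\<close> grows by at least \<open>\<Sum>j. (a j (z - y))\<^sup>2\<close>, and the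
  \<open>a j\<close> separate points.
\<close>

lemma gradient_injective:
  assumes y: "y \<in> fibre x" and z: "z \<in> fibre x" and eq: "gradient x y = gradient x z"
  shows "y = z"
proof -
  let ?v = "\<lambda>j. dual_apply (a j) y" and ?w = "\<lambda>j. dual_apply (a j) z"
  have mono: "(?w j - ?v j)\<^sup>2 \<le> (slope (f j x) (?w j) - slope (f j x) (?v j)) * (?w j - ?v j)" if "j \<in> J" for j
    using y z that by (intro slope_monotone) (auto simp: fibre_def)
  have "(\<Sum>j\<in>J. (?w j - ?v j)\<^sup>2) \<le> (\<Sum>j\<in>J. (slope (f j x) (?w j) - slope (f j x) (?v j)) * (?w j - ?v j))"
    by (rule sum_mono) (rule mono)
  also have "\<dots> = dual_apply (gradient x z) (z - y) - dual_apply (gradient x y) (z - y)"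
    unfolding gradient_def dual_apply_combination linear_diff[OF linear_dual_apply]
    by (simp add: left_diff_distrib right_diff_distrib sum_subtractf)
  also have "\<dots> = 0"
    by (simp add: eq)
  finally have "(\<Sum>j\<in>J. (?w j - ?v j)\<^sup>2) = 0"
    by (intro antisym sum_nonneg) auto
  then have "dual_apply (a j) (z - y) = 0" if "j \<in> J" for j
    using that finite_J by (simp add: sum_nonneg_eq_0_iff linear_diff[OF linear_dual_apply])
  then show ?thesis
    using separating[of "z - y"] by simp
qed

text \<open>
  A solution of \<open>gradient x y = \<xi>\<close> is a critical point of the barrier function minus \<open>\<xi>\<close>, so a minimum will do.
  The function is coercive because of the quadratic terms and infinite on the boundary of the fibre, so its
  sublevel sets are compact.
\<close>

lemma gradient_surjective:
  obtains y where "y \<in> fibre x" "gradient x y = \<xi>"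
proof -
  let ?d = "dim (UNIV :: 'v set)"
  define v where "v j y = dual_apply (a j) y" for j y
  define u where "u j = f j x" for j
  obtain c where c: "\<And>w. dual_apply \<xi> w = (\<Sum>j\<in>J. c j * v j w)"
    using functional_coefficients unfolding v_def by blast
  obtain m where m: "\<And>w i. \<phi> w i = (\<Sum>j\<in>J. m i j * v j w)"
    using coordinate_coefficients unfolding v_def by blast
  have fibre: "y \<in> fibre x \<longleftrightarrow> (\<forall>j\<in>J. u j \<noteq> 0 \<or> 0 < v j y)" for y
    by (simp add: fibre_def u_def v_def)
  obtain y\<^sub>0 where y\<^sub>0: "y\<^sub>0 \<in> fibre x"
    using nonempty[of x] by (auto simp: fibre_def)
  \<comment> \<open>Up to a constant, the function \<open>S\<close> to be minimised is the sum of the nonnegative terms \<open>q j\<close>, which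
    arise by completing the square.\<close>
  define S where "S y = (\<Sum>j\<in>J. barrier (u j) (v j y) - c j * v j y)" for y
  define q where "q j y = (v j y - c j)\<^sup>2 / 2 + inverse (sqrt ((u j)\<^sup>2 + (v j y)\<^sup>2) + v j y)" for j y
  define K where "K = S y\<^sub>0 + (\<Sum>j\<in>J. (c j)\<^sup>2 / 2)"
  have S_q: "S y + (\<Sum>j\<in>J. (c j)\<^sup>2 / 2) = (\<Sum>j\<in>J. q j y)" for y
    unfolding S_def q_def barrier_def sum.distrib[symmetric]
    by (rule sum.cong[OF refl]) (simp add: power2_eq_square field_simps)
  have radius: "0 < sqrt ((u j)\<^sup>2 + (v j y)\<^sup>2) + v j y" if "y \<in> fibre x" "j \<in> J" for j y
    using that radius_add_pos unfolding fibre by blast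
  have q_nonneg: "0 \<le> q j y" if "y \<in> fibre x" "j \<in> J" for j y
    unfolding q_def using radius[OF that] by (intro add_nonneg_nonneg) auto
  have K: "0 \<le> K"
    unfolding K_def S_q using q_nonneg[OF y\<^sub>0] by (rule sum_nonneg)
  \<comment> \<open>On the sublevel set of \<open>y\<^sub>0\<close> each \<open>q j\<close> is at most \<open>K\<close>, which bounds \<open>v j\<close> by \<open>\<beta> j\<close> and keeps \<open>r + v\<close>
    above \<open>1 / K\<close>; \<open>K + 1\<close> in its place also covers \<open>K = 0\<close>.\<close>
  define \<beta> where "\<beta> j = \<bar>c j\<bar> + 2 * K + 1" for j
  define A where "A = {y. \<forall>j\<in>J. \<bar>v j y\<bar> \<le> \<beta> j \<and> inverse (K + 1) \<le> sqrt ((u j)\<^sup>2 + (v j y)\<^sup>2) + v j y}"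
  have A_fibre: "y \<in> fibre x" if "y \<in> A" for y
    unfolding fibre
  proof
    fix j assume "j \<in> J"
    then have "inverse (K + 1) \<le> sqrt ((u j)\<^sup>2 + (v j y)\<^sup>2) + v j y"
      using that by (simp add: A_def)
    moreover have "0 < inverse (K + 1)"
      using K by simp
    ultimately show "u j \<noteq> 0 \<or> 0 < v j y"
      unfolding radius_pos_iff[symmetric] by (rule less_le_trans[rotated])
  qed
  have sublevel: "y \<in> A" if y: "y \<in> fibre x" and S: "S y \<le> S y\<^sub>0" for y
    unfolding A_def
  proof (intro CollectI ballI conjI)
    fix j assume j: "j \<in> J"
    have "q j y \<le> (\<Sum>j\<in>J. q j y)"
      using j finite_J q_nonneg[OF y] by (intro member_le_sum) auto
    also have "\<dots> \<le> K"
      unfolding K_def S_q[symmetric] using S by simp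
    finally have "q j y \<le> K" .
    then have square: "(v j y - c j)\<^sup>2 \<le> 2 * K" and inv: "inverse (sqrt ((u j)\<^sup>2 + (v j y)\<^sup>2) + v j y) \<le> K"
      unfolding q_def using radius[OF y j] inverse_nonnegative_iff_nonnegative[of "sqrt ((u j)\<^sup>2 + (v j y)\<^sup>2) + v j y"]
        zero_le_power2[of "v j y - c j"] by linarith+
    have "(v j y - c j)\<^sup>2 \<le> (2 * K + 1)\<^sup>2"
    proof -
      have "2 * K \<le> (2 * K + 1)\<^sup>2"
        using K by (simp add: power2_eq_square algebra_simps)
      then show ?thesis
        using square by simp
    qed
    then have "\<bar>v j y - c j\<bar> \<le> 2 * K + 1"
      using K by (simp add: abs_le_square_iff[symmetric])
    then show "\<bar>v j y\<bar> \<le> \<beta> j"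
      unfolding \<beta>_def by linarith
    have "inverse (K + 1) \<le> inverse (inverse (sqrt ((u j)\<^sup>2 + (v j y)\<^sup>2) + v j y))"
      using inv radius[OF y j] K by (intro le_imp_inverse_le) auto
    then show "inverse (K + 1) \<le> sqrt ((u j)\<^sup>2 + (v j y)\<^sup>2) + v j y"
      by simp
  qed
  \<comment> \<open>Compactness is available in the space of coordinate vectors.  Bounds on the \<open>v j\<close> bound all
    coordinates, since the coordinate functions are combinations of the \<open>v j\<close>.\<close>
  define Y where "Y t = (\<Sum>i<?d. t i *\<^sub>R coord_basis \<phi> i)" for t
  have Y_\<phi>: "Y (\<phi> y) = y" for y
    unfolding Y_def by (rule linear_coordinates_expansion(3)[OF coordinates coordinates])
  have cont_v: "continuous_on T (\<lambda>t. v j (Y t))" for j T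
    unfolding v_def Y_def linear_sum[OF linear_dual_apply] linear_scale[OF linear_dual_apply] real_scaleR_def
    by (intro continuous_intros continuous_on_subset[OF continuous_on_product_coordinates]) auto
  define TA where "TA = {t. \<forall>i. \<bar>t i\<bar> \<le> (\<Sum>j\<in>J. \<bar>m i j\<bar> * \<beta> j)} \<inter>
    (\<Inter>j\<in>J. {t. \<bar>v j (Y t)\<bar> \<le> \<beta> j} \<inter> {t. inverse (K + 1) \<le> sqrt ((u j)\<^sup>2 + (v j (Y t))\<^sup>2) + v j (Y t)})"
  have "compact TA"
    unfolding TA_def
    by (intro compact_Int_closed compact_box closed_INT ballI closed_Int closed_Collect_le continuous_intros cont_v)
  moreover have TA_A: "Y t \<in> A" if "t \<in> TA" for t
    using that by (auto simp: TA_def A_def)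
  have A_TA: "\<phi> y \<in> TA" if y: "y \<in> A" for y
  proof -
    have "\<bar>\<phi> y i\<bar> \<le> (\<Sum>j\<in>J. \<bar>m i j\<bar> * \<beta> j)" for i
    proof -
      have "\<bar>\<phi> y i\<bar> \<le> (\<Sum>j\<in>J. \<bar>m i j * v j y\<bar>)"
        unfolding m by (rule sum_abs)
      also have "\<dots> \<le> (\<Sum>j\<in>J. \<bar>m i j\<bar> * \<beta> j)"
        unfolding abs_mult using y by (intro sum_mono mult_left_mono) (auto simp: A_def)
      finally show ?thesis .
    qed
    then show ?thesis
      using y by (auto simp: TA_def A_def Y_\<phi>)
  qed
  moreover have "TA \<noteq> {}"
    using A_TA[OF sublevel[OF y\<^sub>0 order_refl]] by blast
  moreover have "continuous_on TA (\<lambda>t. S (Y t))"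
    unfolding S_def barrier_def
  proof (intro continuous_intros cont_v ballI)
    fix j t assume "j \<in> J" "t \<in> TA"
    then show "sqrt ((u j)\<^sup>2 + (v j (Y t))\<^sup>2) + v j (Y t) \<noteq> 0"
      using radius[OF A_fibre[OF TA_A]] by force
  qed simp_all
  ultimately obtain t where t: "t \<in> TA" "\<And>t'. t' \<in> TA \<Longrightarrow> S (Y t) \<le> S (Y t')"
    using continuous_attains_inf[of TA "\<lambda>t. S (Y t)"] by blast
  define y where "y = Y t"
  have y: "y \<in> fibre x"
    unfolding y_def by (rule A_fibre[OF TA_A[OF t(1)]])
  have minimal: "S y \<le> S z" if z: "z \<in> fibre x" for z
  proof (cases "S z \<le> S y\<^sub>0")
    case True
    then show ?thesis
      using t(2)[OF A_TA[OF sublevel[OF z True]]] by (simp add: y_def Y_\<phi>)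
  next
    case False
    then show ?thesis
      using t(2)[OF A_TA[OF sublevel[OF y\<^sub>0 order_refl]]] by (simp add: y_def Y_\<phi>)
  qed
  have "dual_apply (gradient x y) w = dual_apply \<xi> w" for w
  proof -
    have v_line: "v j (y + s *\<^sub>R w) = v j y + s * v j w" for j s
      unfolding v_def by (simp add: linear_add[OF linear_dual_apply] linear_scale[OF linear_dual_apply])
    have deriv: "((\<lambda>s. S (y + s *\<^sub>R w)) has_real_derivative (\<Sum>j\<in>J. slope (u j) (v j y) * v j w - c j * v j w)) (at 0)"
      unfolding S_def v_line
    proof (intro DERIV_sum DERIV_diff)
      fix j assume j: "j \<in> J"
      have line: "((\<lambda>s. v j y + s * v j w) has_real_derivative v j w) (at 0)"
        by (auto intro!: derivative_eq_intros)
      have "(barrier (u j) has_real_derivative slope (u j) (v j y)) (at (v j y + 0 * v j w))"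
        using barrier_deriv[of "u j" "v j y"] y j unfolding fibre by simp
      from DERIV_chain2[OF this line]
      show "((\<lambda>s. barrier (u j) (v j y + s * v j w)) has_real_derivative slope (u j) (v j y) * v j w) (at 0)" .
      show "((\<lambda>s. c j * (v j y + s * v j w)) has_real_derivative c j * v j w) (at 0)"
        by (rule DERIV_cmult[OF line])
    qed
    have "eventually (\<lambda>s. \<forall>j\<in>J. u j \<noteq> 0 \<or> 0 < v j (y + s *\<^sub>R w)) (nhds 0)"
    proof (intro eventually_ball_finite finite_J ballI)
      fix j assume j: "j \<in> J"
      show "eventually (\<lambda>s. u j \<noteq> 0 \<or> 0 < v j (y + s *\<^sub>R w)) (nhds 0)"
      proof (cases "u j = 0")
        case True
        then have "0 < v j y"
          using y j unfolding fibre by blast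
        moreover have "((\<lambda>s. v j y + s * v j w) \<longlongrightarrow> v j y + 0 * v j w) (nhds 0)"
          by (intro tendsto_intros filterlim_ident)
        ultimately have "eventually (\<lambda>s. 0 < v j y + s * v j w) (nhds 0)"
          by (intro order_tendstoD) simp_all
        then show ?thesis
          unfolding v_line by (rule eventually_mono) simp
      qed simp
    qed
    then obtain e where e: "e > 0" "\<And>s. dist s 0 < e \<Longrightarrow> y + s *\<^sub>R w \<in> fibre x"
      unfolding eventually_nhds_metric fibre by blast
    have "\<forall>s. \<bar>0 - s\<bar> < e \<longrightarrow> S (y + 0 *\<^sub>R w) \<le> S (y + s *\<^sub>R w)"
      using minimal e(2) by (simp add: dist_real_def)
    from DERIV_local_min[OF deriv e(1) this]
    have "(\<Sum>j\<in>J. slope (u j) (v j y) * v j w) = (\<Sum>j\<in>J. c j * v j w)"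
      by (simp add: sum_subtractf)
    then show ?thesis
      unfolding gradient_def dual_apply_combination c by (simp add: u_def v_def)
  qed
  then show thesis
    using that[OF y] dual_eqI by blast
qed

lemma solve_unique:
  assumes "y \<in> fibre x" "gradient x y = \<xi>"
  shows "solve x \<xi> = y"
  unfolding solve_def using assms gradient_injective by (intro the_equality) blast+

lemma solve_in_fibre: "solve x \<xi> \<in> fibre x"
  and gradient_solve: "gradient x (solve x \<xi>) = \<xi>"
  using gradient_surjective[of x \<xi>] solve_unique by metis+

lemma solve_gradient: "y \<in> fibre x \<Longrightarrow> solve x (gradient x y) = y"
  by (rule solve_unique) simp_all

definition pair_coords :: "'v \<times> 'v dual_space \<Rightarrow> nat \<Rightarrow> real" where
  "pair_coords = append_coords (dim (UNIV :: 'v set)) \<phi> (dual_coords \<phi>)"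

lemma linear_coordinates_pair: "linear_coordinates pair_coords"
  and dim_pair: "dim (UNIV :: ('v \<times> 'v dual_space) set) = dim (UNIV :: 'v set) + dim (UNIV :: 'v set)"
  unfolding pair_coords_def
  using linear_coordinates_product[OF coordinates linear_coordinates_dual(2)[OF coordinates]]
    linear_coordinates_dual(1)[OF coordinates] by auto

lemma affine_expansion:
  assumes "j \<in> J"
  shows "f j x = f j 0 + (\<Sum>i<dim (UNIV :: 'v set). (f j (coord_basis \<phi> i) - f j 0) * \<phi> x i)"
proof -
  have "f j x - f j 0 = (\<Sum>i<dim (UNIV :: 'v set). \<phi> x i * (f j (coord_basis \<phi> i) - f j 0))"
    using dual_apply_expansion[OF coordinates, of "linear_form (f j)" x]
    by (simp add: dual_apply_linear_form[OF affine[OF assms]])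
  then show ?thesis
    by (simp add: mult.commute)
qed

text \<open>
  The matrix is that of the positive definite form \<open>\<Sum>j. \<kappa> j * (a j y)\<^sup>2\<close>; definiteness makes the induced map
  from the space to its dual injective.
\<close>

lemma hessian_inverse:
  assumes \<kappa>: "\<And>j. j \<in> J \<Longrightarrow> 0 < \<kappa> j"
  shows "\<exists>B :: nat \<Rightarrow> nat \<Rightarrow> real. \<forall>i<dim (UNIV :: 'v set). \<forall>m<dim (UNIV :: 'v set).
      (\<Sum>k<dim (UNIV :: 'v set). B i k * (\<Sum>j\<in>J. \<kappa> j * dual_apply (a j) (coord_basis \<phi> k)
        * dual_apply (a j) (coord_basis \<phi> m))) = (if i = m then 1 else 0)"
proof -
  let ?d = "dim (UNIV :: 'v set)" and ?b = "coord_basis \<phi>"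
  note dual = linear_coordinates_dual[OF coordinates]
  define L where "L y = (\<Sum>j\<in>J. (\<kappa> j * dual_apply (a j) y) *\<^sub>R a j)" for y
  have L_apply: "dual_apply (L y) w = (\<Sum>j\<in>J. \<kappa> j * dual_apply (a j) y * dual_apply (a j) w)" for y w
    unfolding L_def dual_apply_combination ..
  have "linear L"
    by (rule linearI)
      (simp_all add: L_def linear_add[OF linear_dual_apply] linear_scale[OF linear_dual_apply]
        algebra_simps sum.distrib scaleR_sum_right)
  moreover have "inj L"
  proof (subst linear_injective_0[OF \<open>linear L\<close>], intro allI impI)
    fix y assume "L y = 0"
    then have "(\<Sum>j\<in>J. \<kappa> j * dual_apply (a j) y * dual_apply (a j) y) = 0"
      using L_apply[of y y] by (simp add: zero_dual_space.rep_eq)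
    moreover have "0 \<le> \<kappa> j * dual_apply (a j) y * dual_apply (a j) y" if "j \<in> J" for j
      using \<kappa>[OF that] by (simp add: mult.assoc)
    ultimately have "\<kappa> j * dual_apply (a j) y * dual_apply (a j) y = 0" if "j \<in> J" for j
      using that finite_J by (simp add: sum_nonneg_eq_0_iff)
    then show "y = 0"
      using \<kappa> by (intro separating) force
  qed
  ultimately obtain M where M: "linear M" "M \<circ> L = id"
    using linear_injective_left_inverse by blast
  define B where "B i k = \<phi> (M (coord_basis (dual_coords \<phi>) k)) i" for i k
  show ?thesis
  proof (intro exI[of _ B] allI impI)
    fix i m assume i: "i < ?d" and m: "m < ?d"
    have "?b m = M (L (?b m))"
      using M(2) by (metis comp_apply id_apply)
    also have "L (?b m) = (\<Sum>k<?d. dual_coords \<phi> (L (?b m)) k *\<^sub>R coord_basis (dual_coords \<phi>) k)"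
      using linear_coordinates_expansion(3)[OF dual(2) dual(2), of "L (?b m)"] dual(1) by simp
    finally have expand: "?b m = M (\<Sum>k<?d. dual_coords \<phi> (L (?b m)) k *\<^sub>R coord_basis (dual_coords \<phi>) k)" .
    have "\<phi> (M (\<Sum>k<?d. c k *\<^sub>R coord_basis (dual_coords \<phi>) k)) i = (\<Sum>k<?d. c k * B i k)" for c
      by (simp add: linear_sum[OF M(1)] linear_scale[OF M(1)] linear_sum[OF linear_coordinate[OF coordinates]]
          linear_scale[OF linear_coordinate[OF coordinates]] B_def)
    from trans[OF arg_cong[OF expand, of "\<lambda>v. \<phi> v i"] this]
    have "\<phi> (?b m) i = (\<Sum>k<?d. dual_coords \<phi> (L (?b m)) k * B i k)" .
    also have "\<dots> = (\<Sum>k<?d. B i k * (\<Sum>j\<in>J. \<kappa> j * dual_apply (a j) (?b k) * dual_apply (a j) (?b m)))"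
      by (rule sum.cong[OF refl]) (simp add: dual_coords_def L_apply mult_ac)
    finally show "(\<Sum>k<?d. B i k * (\<Sum>j\<in>J. \<kappa> j * dual_apply (a j) (?b k) * dual_apply (a j) (?b m)))
        = (if i = m then 1 else 0)"
      using linear_coordinates_expansion(1)[OF coordinates coordinates m, of i] by simp
  qed
qed

text \<open>
  The inverse function theorem provides an analytic solution near \<open>(x\<^sub>0, \<xi>\<^sub>0)\<close>; it coincides with \<open>solve\<close>
  because solutions are unique.
\<close>

theorem solve_analytic:
  assumes i: "i < dim (UNIV :: 'v set)"
  shows "vector_germ pair_coords UNIV (\<lambda>e. \<phi> (solve (fst e) (snd e)) i) (x\<^sub>0, \<xi>\<^sub>0)"
proof -
  let ?d = "dim (UNIV :: 'v set)" and ?b = "coord_basis \<phi>"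
  define y\<^sub>0 where "y\<^sub>0 = solve x\<^sub>0 \<xi>\<^sub>0"
  define p\<^sub>0 where "p\<^sub>0 = pair_coords (x\<^sub>0, \<xi>\<^sub>0)"
  define l where "l j i = f j (?b i) - f j 0" for j i
  define \<alpha> where "\<alpha> j i = dual_apply (a j) (?b i)" for j i
  have left: "pair_coords (x, \<xi>) k = \<phi> x k" and right: "pair_coords (x, \<xi>) (?d + k) = dual_apply \<xi> (?b k)"
    if "k < ?d" for x \<xi> k
    using that by (simp_all add: pair_coords_def append_coords_def dual_coords_def)
  have u: "f j 0 + (\<Sum>i<?d. l j i * pair_coords (x, \<xi>) i) = f j x" if "j \<in> J" for j x \<xi>
    using affine_expansion[OF that, of x] by (simp add: l_def left)
  have v: "(\<Sum>i<?d. \<alpha> j i * w i) = dual_apply (a j) (\<Sum>i<?d. w i *\<^sub>R ?b i)" for j w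
    by (simp add: \<alpha>_def linear_sum[OF linear_dual_apply] linear_scale[OF linear_dual_apply] mult.commute)
  have v\<^sub>0: "(\<Sum>i<?d. \<alpha> j i * \<phi> y\<^sub>0 i) = dual_apply (a j) y\<^sub>0" for j
    unfolding v by (simp only: linear_coordinates_expansion(3)[OF coordinates coordinates])
  have good: "f j 0 + (\<Sum>i<?d. l j i * p\<^sub>0 i) \<noteq> 0 \<or> 0 < (\<Sum>i<?d. \<alpha> j i * \<phi> y\<^sub>0 i)" if "j \<in> J" for j
    unfolding v\<^sub>0 p\<^sub>0_def u[OF that]
    using solve_in_fibre[of x\<^sub>0 \<xi>\<^sub>0] that by (simp add: fibre_def y\<^sub>0_def)
  define \<kappa> where "\<kappa> j = 1 + inverse (sqrt ((f j 0 + (\<Sum>i<?d. l j i * p\<^sub>0 i))\<^sup>2 + (\<Sum>i<?d. \<alpha> j i * \<phi> y\<^sub>0 i)\<^sup>2) ^ 3)" for j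
  have \<kappa>: "0 < \<kappa> j" for j
    unfolding \<kappa>_def by (rule add_pos_nonneg) simp_all
  have "\<exists>B :: nat \<Rightarrow> nat \<Rightarrow> real. \<forall>i<?d. \<forall>m<?d.
      (\<Sum>k<?d. B i k * (\<Sum>j\<in>J. \<kappa> j * \<alpha> j k * \<alpha> j m)) = (if i = m then 1 else 0)"
    unfolding \<alpha>_def by (rule hessian_inverse[OF \<kappa>])
  then obtain B :: "nat \<Rightarrow> nat \<Rightarrow> real" where
    B: "\<forall>i<?d. \<forall>m<?d. (\<Sum>k<?d. B i k * (\<Sum>j\<in>J. \<kappa> j * \<alpha> j k * \<alpha> j m)) = (if i = m then 1 else 0)" ..
  have solves: "(\<Sum>j\<in>J. slope (f j 0 + (\<Sum>i<?d. l j i * p\<^sub>0 i)) (\<Sum>i<?d. \<alpha> j i * \<phi> y\<^sub>0 i) * \<alpha> j k) = p\<^sub>0 (?d + k)"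
    if k: "k < ?d" for k
  proof -
    have "p\<^sub>0 (?d + k) = dual_apply (gradient x\<^sub>0 y\<^sub>0) (?b k)"
      unfolding p\<^sub>0_def right[OF k] y\<^sub>0_def gradient_solve ..
    also have "\<dots> = (\<Sum>j\<in>J. slope (f j x\<^sub>0) (dual_apply (a j) y\<^sub>0) * \<alpha> j k)"
      unfolding gradient_def dual_apply_combination \<alpha>_def ..
    finally show ?thesis
      unfolding v\<^sub>0 p\<^sub>0_def using u by (simp cong: sum.cong)
  qed
  obtain r W where r: "0 < r"
    and W: "\<And>i. i < ?d \<Longrightarrow> bounded_holomorphic (?d + ?d) (polydisc (?d + ?d) (cvec p\<^sub>0) r) (\<lambda>z. W z i)"
    and sol: "\<And>p. cvec p \<in> polydisc (?d + ?d) (cvec p\<^sub>0) r \<Longrightarrow>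
      \<exists>w :: nat \<Rightarrow> real. (\<forall>i<?d. W (cvec p) i = of_real (w i)) \<and>
        (\<forall>j\<in>J. f j 0 + (\<Sum>i<?d. l j i * p i) \<noteq> 0 \<or> 0 < (\<Sum>i<?d. \<alpha> j i * w i)) \<and>
        (\<forall>k<?d. (\<Sum>j\<in>J. slope (f j 0 + (\<Sum>i<?d. l j i * p i)) (\<Sum>i<?d. \<alpha> j i * w i) * \<alpha> j k) = p (?d + k))"
    using slope_system_solution[where J = J and c = "\<lambda>j. f j 0" and l = l and \<alpha> = \<alpha> and d = ?d and p\<^sub>0 = p\<^sub>0
        and w\<^sub>0 = "\<phi> y\<^sub>0" and B = B, folded \<kappa>_def, OF finite_J good B[rule_format] solves] by blast
  show ?thesis
    unfolding vector_germ_def dim_pair analytic_germ_def p\<^sub>0_def[symmetric]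
  proof (intro exI[of _ r] conjI exI[of _ "\<lambda>z. W z i"] r W i ballI impI)
    fix p assume "p \<in> range pair_coords" and near: "\<forall>i<?d + ?d. \<bar>p i - p\<^sub>0 i\<bar> < r"
    then obtain x \<xi> where p: "p = pair_coords (x, \<xi>)"
      by auto
    obtain w :: "nat \<Rightarrow> real" where w: "\<forall>i<?d. W (cvec p) i = of_real (w i)"
      and w_good: "\<forall>j\<in>J. f j 0 + (\<Sum>i<?d. l j i * p i) \<noteq> 0 \<or> 0 < (\<Sum>i<?d. \<alpha> j i * w i)"
      and w_solves: "\<forall>k<?d. (\<Sum>j\<in>J. slope (f j 0 + (\<Sum>i<?d. l j i * p i)) (\<Sum>i<?d. \<alpha> j i * w i) * \<alpha> j k) = p (?d + k)"
      using sol[of p] near unfolding cvec_in_polydisc by blast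
    define y where "y = (\<Sum>i<?d. w i *\<^sub>R ?b i)"
    have "y \<in> fibre x"
      using w_good u unfolding p v y_def[symmetric] by (simp add: fibre_def)
    moreover have "gradient x y = \<xi>"
    proof -
      have "dual_apply (gradient x y) (?b k) = dual_apply \<xi> (?b k)" if k: "k < ?d" for k
      proof -
        have "dual_apply (gradient x y) (?b k) = (\<Sum>j\<in>J. slope (f j x) (dual_apply (a j) y) * \<alpha> j k)"
          unfolding gradient_def dual_apply_combination \<alpha>_def ..
        also have "\<dots> = p (?d + k)"
          using w_solves k u unfolding p v y_def[symmetric] by (simp cong: sum.cong)
        finally show ?thesis
          unfolding p right[OF k] .
      qed
      then have "dual_apply (gradient x y) w = dual_apply \<xi> w" for w
        unfolding dual_apply_expansion[OF coordinates, of _ w] by simp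
      then show ?thesis
        by (rule dual_eqI)
    qed
    ultimately have "solve x \<xi> = y"
      by (rule solve_unique)
    moreover have "\<phi> y i = w i"
    proof -
      define w' where "w' i = (if i < ?d then w i else 0)" for i
      have "y = (\<Sum>i<?d. w' i *\<^sub>R ?b i)"
        by (simp add: y_def w'_def)
      moreover have "w' \<in> topspace (Euclidean_space ?d)"
        by (simp add: w'_def topspace_Euclidean_space)
      ultimately show ?thesis
        using linear_coordinates_expansion(2)[OF coordinates coordinates, of w'] i by (simp add: w'_def)
    qed
    ultimately show "W (cvec p) i = of_real (\<phi> (solve (fst (inv pair_coords p)) (snd (inv pair_coords p))) i)"
      using w i by (simp add: p linear_coordinates_inv[OF linear_coordinates_pair])
  qed
qed

end

section \<open>Chambers and their gradients\<close>

lemma vector_germ_compose: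
  fixes \<Phi> :: "'e::real_vector \<Rightarrow> nat \<Rightarrow> real" and \<Psi> :: "'w::real_vector \<Rightarrow> nat \<Rightarrow> real"
  assumes \<Phi>: "linear_coordinates \<Phi>" and \<Psi>: "linear_coordinates \<Psi>"
    and G: "\<And>i. i < dim (UNIV :: 'w set) \<Longrightarrow> vector_germ \<Phi> S (\<lambda>e. \<Psi> (G e) i) p"
    and h: "vector_germ \<Psi> UNIV h (G p)" and p: "p \<in> S"
  shows "vector_germ \<Phi> S (\<lambda>e. h (G e)) p"
proof -
  have "analytic_germ (dim (UNIV :: 'e set)) (\<Phi> ` S) (\<lambda>x. h (inv \<Psi> (\<Psi> (G (inv \<Phi> x))))) (\<Phi> p)"
  proof (rule analytic_germ_compose[where G = "\<lambda>x. \<Psi> (G (inv \<Phi> x))" and T = "range \<Psi>" and k = "dim (UNIV :: 'w set)"])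
    show "analytic_germ (dim (UNIV :: 'w set)) (range \<Psi>) (\<lambda>y. h (inv \<Psi> y)) (\<Psi> (G (inv \<Phi> (\<Phi> p))))"
      using h by (simp add: vector_germ_def linear_coordinates_inv[OF \<Phi>])
    show "range \<Psi> \<subseteq> topspace (Euclidean_space (dim (UNIV :: 'w set)))"
      by (simp add: linear_coordinates_range[OF \<Psi>])
    show "analytic_germ (dim (UNIV :: 'e set)) (\<Phi> ` S) (\<lambda>x. \<Psi> (G (inv \<Phi> x)) i) (\<Phi> p)"
      if "i < dim (UNIV :: 'w set)" for i
      using G[OF that] by (simp add: vector_germ_def)
  qed (use p in auto)
  then show ?thesis
    by (simp add: vector_germ_def linear_coordinates_inv[OF \<Psi>])
qed

lemma vector_germ_slope:
  assumes \<Phi>: "linear_coordinates \<Phi>" and u: "vector_germ \<Phi> S u p" and v: "vector_germ \<Phi> S v p"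
    and p: "p \<in> S" and good: "u p \<noteq> 0 \<or> 0 < v p"
  shows "vector_germ \<Phi> S (\<lambda>e. slope (u e) (v e)) p"
proof -
  let ?r = "\<lambda>e. sqrt (u e * u e + v e * v e)"
  have r: "vector_germ \<Phi> S ?r p"
    by (rule vector_germ_sqrt[OF \<Phi> vector_germ_add[OF vector_germ_mult[OF u u] vector_germ_mult[OF v v]] p])
      (use sum_squares_pos[OF good] in \<open>simp add: power2_eq_square\<close>)
  have "?r p * (?r p + v p) \<noteq> 0"
    using less_imp_neq[OF radius_pos[OF good]] less_imp_neq[OF radius_add_pos[OF good]]
    unfolding power2_eq_square mult_eq_0_iff by metis
  then have "vector_germ \<Phi> S (\<lambda>e. v e + (- 1) * inverse (?r e * (?r e + v e))) p"
    by (intro vector_germ_add v vector_germ_mult vector_germ_const vector_germ_inverse[OF \<Phi>] r p)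
  then show ?thesis
    by (simp add: slope_def power2_eq_square)
qed

lemma openin_Collect_ball:
  assumes J: "finite J" and P: "\<And>j. j \<in> J \<Longrightarrow> openin X {x \<in> topspace X. P j x}"
  shows "openin X {x \<in> topspace X. \<forall>j\<in>J. P j x}"
  using J P
proof (induction J rule: finite_induct)
  case (insert k J)
  have "openin X ({x \<in> topspace X. P k x} \<inter> {x \<in> topspace X. \<forall>j\<in>J. P j x})"
    using insert by (intro openin_Int) auto
  moreover have "{x \<in> topspace X. P k x} \<inter> {x \<in> topspace X. \<forall>j\<in>J. P j x}
      = {x \<in> topspace X. \<forall>j\<in>insert k J. P j x}"
    by auto
  ultimately show ?case
    by simp
qed auto

lemma product_chart:
  "(U, \<phi>) \<in> charts X \<Longrightarrow> (W, \<psi>) \<in> charts Y \<Longrightarrow>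
    (U \<times> W, append_coords (pdim X) \<phi> \<psi>) \<in> charts (product_prevariety X Y)"
  by (auto simp: product_prevariety_def)

lemma real_analytic_group_vector:
  fixes \<psi> :: "'g::real_vector \<Rightarrow> nat \<Rightarrow> real"
  assumes \<psi>: "linear_coordinates \<psi>"
  shows "real_analytic_group (vector_prevariety :: 'g prevariety)"
proof -
  let ?G = "vector_prevariety :: 'g prevariety" and ?d = "dim (UNIV :: 'g set)"
  note G = real_analytic_prevariety_vector[OF \<psi>]
  note GG = real_analytic_prevariety_product[OF G G]
  note prod = linear_coordinates_product[OF \<psi> \<psi>]
  have pdim: "pdim ?G = ?d" and chart: "(UNIV, \<psi>) \<in> charts ?G"
    using \<psi> by (simp_all add: vector_prevariety_def)
  have chart2: "(UNIV \<times> UNIV, append_coords ?d \<psi> \<psi>) \<in> charts (product_prevariety ?G ?G)"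
    using product_chart[OF chart chart] by (simp only: pdim)
  have "analytic_at (product_prevariety ?G ?G) ?G (\<lambda>(g, h). g + h) p" for p
  proof (rule analytic_at_via_vector_space[OF GG chart2 chart prod(2), where \<kappa> = "\<lambda>v. v" and S = UNIV])
    show "pdim (product_prevariety ?G ?G) = dim (UNIV :: ('g \<times> 'g) set)"
      by (simp add: product_prevariety_def pdim prod(1))
    show "openin (ptop (vector_prevariety :: ('g \<times> 'g) prevariety)) UNIV"
      unfolding openin_vector[OF prod(2)] linear_coordinates_range[OF prod(2)] by (rule openin_topspace)
    show "vector_germ (append_coords ?d \<psi> \<psi>) UNIV (\<lambda>v. \<psi> (case v of (g, h) \<Rightarrow> g + h) i) p" for i
    proof (rule vector_germ_linear[OF prod(2)])
      show "linear (\<lambda>v. \<psi> (case v of (g, h) \<Rightarrow> g + h) i)"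
        by (rule linearI)
          (simp_all add: case_prod_beta linear_add[OF linear_coordinate[OF \<psi>]] linear_scale[OF linear_coordinate[OF \<psi>]]
            algebra_simps)
    qed
  qed auto
  then have "real_analytic_map (product_prevariety ?G ?G) ?G (\<lambda>(g, h). g + h)"
    by (intro real_analytic_map_if_analytic_at GG G)
  moreover have "analytic_at ?G ?G uminus p" for p
  proof (rule analytic_at_via_vector_space[OF G chart chart \<psi>, where \<kappa> = "\<lambda>v. v" and S = UNIV])
    show "openin (ptop ?G) UNIV"
      unfolding openin_vector[OF \<psi>] linear_coordinates_range[OF \<psi>] by (rule openin_topspace)
    show "vector_germ \<psi> UNIV (\<lambda>v. \<psi> (- v) i) p" for i
    proof (rule vector_germ_linear[OF \<psi>])
      show "linear (\<lambda>v. \<psi> (- v) i)"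
        using linear_compose[OF linear_uminus linear_coordinate[OF \<psi>, of i]] by (simp add: o_def)
    qed
  qed (auto simp: pdim)
  then have "real_analytic_map ?G ?G uminus"
    by (intro real_analytic_map_if_analytic_at G)
  ultimately show ?thesis
    using G by (simp add: real_analytic_group_def vector_prevariety_def)
qed

text \<open>
  The coordinates \<open>\<phi>\<close> of the ambient space are fixed once and for all; nothing but analyticity is expressed
  with them.
\<close>

locale arrangement =
  fixes f :: "nat \<Rightarrow> 'v::real_vector \<Rightarrow> real" and n :: nat and \<phi> :: "'v \<Rightarrow> nat \<Rightarrow> real"
  assumes affine: "\<And>j. j \<in> {1..n} \<Longrightarrow> affine_linear (f j)"
    and spanning: "span ((\<lambda>j. linear_form (f j)) ` {1..n}) = (UNIV :: 'v dual_space set)"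
    and coordinates: "linear_coordinates \<phi>"
begin

abbreviation "V \<equiv> vector_prevariety :: 'v prevariety"

definition J :: "nat set" where
  "J = {1..n}"

lemma finite_J: "finite J" and affine_J: "\<And>j. j \<in> J \<Longrightarrow> affine_linear (f j)"
  and spanning_J: "span ((\<lambda>j. linear_form (f j)) ` J) = UNIV"
  using affine spanning by (simp_all add: J_def)

lemma vector_germ_affine:
  fixes \<Phi> :: "'e::real_vector \<Rightarrow> nat \<Rightarrow> real"
  assumes \<Phi>: "linear_coordinates \<Phi>" and X: "linear X" and j: "j \<in> J"
  shows "vector_germ \<Phi> S (\<lambda>e. f j (X e)) p"
proof -
  have "vector_germ \<Phi> S (\<lambda>e. dual_apply (linear_form (f j)) (X e)) p"
    using linear_compose[OF X linear_dual_apply] by (intro vector_germ_linear[OF \<Phi>]) (simp add: o_def)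
  from vector_germ_add[OF this vector_germ_const[where k = "f j 0"]] show ?thesis
    by (simp add: dual_apply_linear_form[OF affine_J[OF j]])
qed

lemma topspace_vector:
  fixes \<Phi> :: "'e::real_vector \<Rightarrow> nat \<Rightarrow> real"
  assumes \<Phi>: "linear_coordinates \<Phi>"
  shows "topspace (ptop (vector_prevariety :: 'e prevariety)) = UNIV"
  using topspace_ptop[OF real_analytic_prevariety_vector[OF \<Phi>]] by (simp add: vector_prevariety_def)

lemma openin_positive:
  fixes \<Phi> :: "'e::real_vector \<Rightarrow> nat \<Rightarrow> real"
  assumes \<Phi>: "linear_coordinates \<Phi>" and g: "\<And>p. vector_germ \<Phi> UNIV g p"
  shows "openin (ptop (vector_prevariety :: 'e prevariety)) {e. 0 < g e}"
proof -
  have "openin (ptop (vector_prevariety :: 'e prevariety)) UNIV"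
    using openin_topspace[of "ptop (vector_prevariety :: 'e prevariety)"] by (simp only: topspace_vector[OF \<Phi>])
  from openin_vector_positive[OF \<Phi> this g] show ?thesis
    by simp
qed

lemma openin_off_hyperplane:
  fixes \<Phi> :: "'e::real_vector \<Rightarrow> nat \<Rightarrow> real"
  assumes \<Phi>: "linear_coordinates \<Phi>" and X: "linear X" and j: "j \<in> J"
  shows "openin (ptop (vector_prevariety :: 'e prevariety)) {e. f j (X e) \<noteq> 0}"
proof -
  have "{e. f j (X e) \<noteq> 0} = {e. 0 < f j (X e) * f j (X e)}"
    by (auto simp: zero_less_mult_iff neq_iff)
  then show ?thesis
    using openin_positive[OF \<Phi> vector_germ_mult[OF vector_germ_affine[OF assms] vector_germ_affine[OF assms]]] by simp
qed

text \<open>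
  Used for chambers, on which \<open>f j\<close> has a constant sign.
\<close>

definition sign :: "'v set \<Rightarrow> nat \<Rightarrow> real" where
  "sign C j = (if \<forall>x\<in>C. 0 < f j x then 1 else - 1)"

lemma chamber_nonempty: "C \<in> chambers f n \<Longrightarrow> C \<noteq> {}"
  unfolding chambers_def by (rule nonempty_connected_components_of)

lemma chamber_off_hyperplanes:
  assumes C: "C \<in> chambers f n" and x: "x \<in> C" and j: "j \<in> J"
  shows "f j x \<noteq> 0"
  using connected_components_of_subset[OF C[unfolded chambers_def]] x j
  by (auto simp: J_def hyperplane_def)

text \<open>
  A chamber is connected and disjoint from the hyperplane, so it cannot meet both of its sides.
\<close>

lemma chamber_sign:
  assumes C: "C \<in> chambers f n" and j: "j \<in> J" and x: "x \<in> C"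
  shows "0 < sign C j * f j x"
proof (cases "\<forall>x\<in>C. 0 < f j x")
  case True
  then show ?thesis
    using x by (simp add: sign_def)
next
  case False
  then obtain y where y: "y \<in> C" "f j y < 0"
    using chamber_off_hyperplanes[OF C _ j] by (meson linorder_neqE_linordered_idom)
  have "f j x < 0"
  proof (rule ccontr)
    assume "\<not> f j x < 0"
    then have pos: "0 < f j x"
      using chamber_off_hyperplanes[OF C x j] by simp
    let ?P = "{x. 0 < f j x}" and ?N = "{x. 0 < (- 1) * f j x}"
    have germ: "vector_germ \<phi> UNIV (f j) p" for p
      using vector_germ_affine[OF coordinates linear_ident j] by simp
    have "openin (ptop V) ?P" "openin (ptop V) ?N"
      by (intro openin_positive[OF coordinates] vector_germ_mult vector_germ_const germ)+
    moreover have "connectedin (ptop V) C"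
      using connectedin_connected_components_of[OF C[unfolded chambers_def]] by (simp add: connectedin_subtopology)
    moreover have "C \<subseteq> ?P \<union> ?N"
      using chamber_off_hyperplanes[OF C _ j] by (auto simp: neq_iff)
    moreover have "?P \<inter> ?N \<inter> C = {}" "?P \<inter> C \<noteq> {}" "?N \<inter> C \<noteq> {}"
      using x y pos by auto
    ultimately show False
      unfolding connectedin by blast
  qed
  then show ?thesis
    using False by (simp add: sign_def)
qed

lemma sign_cases: "sign C j = 1 \<or> sign C j = - 1"
  by (simp add: sign_def)

lemma sign_square: "sign C j * sign C j = 1"
  by (simp add: sign_def)

lemma separates_iff_sign:
  assumes C: "C \<in> chambers f n" and C': "C' \<in> chambers f n" and j: "j \<in> J"
  shows "separates (f j) C C' \<longleftrightarrow> sign C j \<noteq> sign C' j"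
proof -
  obtain x x' where x: "x \<in> C" "x' \<in> C'"
    using chamber_nonempty[OF C] chamber_nonempty[OF C'] by blast
  have sgn: "(\<forall>y\<in>D. 0 < f j y) \<longleftrightarrow> sign D j = 1" "(\<forall>y\<in>D. f j y < 0) \<longleftrightarrow> sign D j = - 1"
    if D: "D \<in> chambers f n" for D
  proof -
    obtain z where z: "z \<in> D"
      using chamber_nonempty[OF D] by blast
    have pos: "0 < sign D j * f j y" if "y \<in> D" for y
      by (rule chamber_sign[OF D j that])
    show "(\<forall>y\<in>D. 0 < f j y) \<longleftrightarrow> sign D j = 1" "(\<forall>y\<in>D. f j y < 0) \<longleftrightarrow> sign D j = - 1"
      using sign_cases[of D j] pos z by (force, force)
  qed
  show ?thesis
    unfolding separates_def sgn[OF C] sgn[OF C'] using sign_cases[of C j] sign_cases[of C' j] by auto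
qed

lemma ex_chamber:
  assumes "\<And>j. j \<in> J \<Longrightarrow> f j x \<noteq> 0"
  obtains C where "C \<in> chambers f n" "x \<in> C"
proof -
  have "x \<in> topspace (subtopology (ptop V) (UNIV - (\<Union>j\<in>{1..n}. hyperplane (f j))))"
    using assms by (simp add: J_def topspace_vector[OF coordinates] hyperplane_def)
  then show thesis
    using that unfolding chambers_def Union_connected_components_of[symmetric] by blast
qed

definition normal :: "'v set \<Rightarrow> nat \<Rightarrow> 'v dual_space" where
  "normal C j = sign C j *\<^sub>R linear_form (f j)"

lemma dual_apply_normal: "j \<in> J \<Longrightarrow> dual_apply (normal C j) y = sign C j * (f j y - f j 0)"
  by (simp add: normal_def scaleR_dual_space.rep_eq dual_apply_linear_form[OF affine_J])

lemma affine_diff: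
  assumes j: "j \<in> J"
  shows "f j (x - y) - f j 0 = f j x - f j y"
  using linear_diff[OF linear_dual_apply, of "linear_form (f j)" x y]
  by (simp add: dual_apply_linear_form[OF affine_J[OF j]])

text \<open>
  No fibre is empty: for a point \<open>c\<close> of the chamber, the vector \<open>c - x\<close> leads into it and belongs to the fibre
  over \<open>x\<close>.
\<close>

lemma barrier_family:
  assumes C: "C \<in> chambers f n"
  shows "barrier_family J f (normal C) \<phi>"
proof
  have "linear_form (f j) \<in> span (normal C ` J)" if "j \<in> J" for j
  proof -
    have "linear_form (f j) = sign C j *\<^sub>R normal C j"
      by (simp add: normal_def sign_square)
    then show ?thesis
      using that by (simp add: span_scale span_base)
  qed
  then have "span ((\<lambda>j. linear_form (f j)) ` J) \<subseteq> span (normal C ` J)"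
    by (intro span_minimal subspace_span) auto
  then show "span (normal C ` J) = UNIV"
    using spanning_J by blast
  fix x
  obtain p where p: "p \<in> C"
    using chamber_nonempty[OF C] by blast
  have "f j x \<noteq> 0 \<or> 0 < dual_apply (normal C j) (p - x)" if j: "j \<in> J" for j
    using chamber_sign[OF C j p] by (auto simp: dual_apply_normal[OF j] affine_diff[OF j])
  then show "\<exists>y. \<forall>j\<in>J. f j x \<noteq> 0 \<or> 0 < dual_apply (normal C j) y"
    by blast
qed (simp_all add: affine_J finite_J coordinates)

abbreviation "fibre C \<equiv> barrier_family.fibre J f (normal C)"
abbreviation "gradient C \<equiv> barrier_family.gradient J f (normal C)"
abbreviation "solve C \<equiv> barrier_family.solve J f (normal C)"
abbreviation "pair_coords \<equiv> barrier_family.pair_coords \<phi>"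

lemmas gradient_solve = barrier_family.gradient_solve[OF barrier_family]
lemmas solve_in_fibre = barrier_family.solve_in_fibre[OF barrier_family]
lemmas solve_gradient = barrier_family.solve_gradient[OF barrier_family]
lemmas solve_unique = barrier_family.solve_unique[OF barrier_family]

lemma fibre_iff:
  assumes "C \<in> chambers f n"
  shows "y \<in> fibre C x \<longleftrightarrow> (\<forall>j\<in>J. f j x \<noteq> 0 \<or> 0 < sign C j * (f j y - f j 0))"
  unfolding barrier_family.fibre_def[OF barrier_family[OF assms]] by (simp add: dual_apply_normal)

lemma common_fibre_sign:
  assumes C: "C \<in> chambers f n" and C': "C' \<in> chambers f n" and y: "y \<in> fibre C x" "y \<in> fibre C' x"
    and j: "j \<in> J" and x: "f j x = 0"
  shows "sign C j = sign C' j"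
proof -
  have "0 < sign C j * (f j y - f j 0)" "0 < sign C' j * (f j y - f j 0)"
    using y x j unfolding fibre_iff[OF C] fibre_iff[OF C'] by blast+
  then show ?thesis
    using sign_cases[of C j] sign_cases[of C' j] by auto
qed

text \<open>
  Only the signs at the hyperplanes through \<open>x\<close> matter for the fibre over \<open>x\<close>.
\<close>

lemma fibre_eq:
  assumes C: "C \<in> chambers f n" and C': "C' \<in> chambers f n"
    and sgn: "\<And>j. j \<in> J \<Longrightarrow> f j x = 0 \<Longrightarrow> sign C j = sign C' j"
  shows "fibre C x = fibre C' x"
proof -
  have "(f j x \<noteq> 0 \<or> 0 < sign C j * t) \<longleftrightarrow> (f j x \<noteq> 0 \<or> 0 < sign C' j * t)" if "j \<in> J" for j t
    using sgn[OF that] by (cases "f j x = 0") simp_all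
  then show ?thesis
    by (intro set_eqI) (simp add: fibre_iff[OF C] fibre_iff[OF C'])
qed

text \<open>
  Where the signs of \<open>C\<close> and \<open>C'\<close> differ, \<open>f j\<close> does not vanish at \<open>x\<close> and the reflection formula for the slope
  applies.  It changes the summand of \<open>j\<close> by a covector that depends on \<open>x\<close> alone.
\<close>

lemma gradient_transition:
  assumes C: "C \<in> chambers f n" and C': "C' \<in> chambers f n"
  obtains \<tau> where "\<And>y. y \<in> fibre C x \<Longrightarrow> y \<in> fibre C' x \<Longrightarrow> gradient C x y = gradient C' x y + \<tau>"
proof -
  define \<tau> where "\<tau> = (\<Sum>j\<in>J. (if sign C j = sign C' j then 0 else 2 / (f j x)\<^sup>2) *\<^sub>R normal C' j)"
  have "gradient C x y = gradient C' x y + \<tau>" if y: "y \<in> fibre C x" "y \<in> fibre C' x" for y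
    unfolding barrier_family.gradient_def[OF barrier_family[OF C]]
      barrier_family.gradient_def[OF barrier_family[OF C']] \<tau>_def sum.distrib[symmetric]
  proof (rule sum.cong[OF refl])
    fix j assume j: "j \<in> J"
    show "slope (f j x) (dual_apply (normal C j) y) *\<^sub>R normal C j
      = slope (f j x) (dual_apply (normal C' j) y) *\<^sub>R normal C' j
        + (if sign C j = sign C' j then 0 else 2 / (f j x)\<^sup>2) *\<^sub>R normal C' j"
    proof (cases "sign C j = sign C' j")
      case True
      then have "normal C j = normal C' j"
        by (simp add: normal_def)
      then show ?thesis
        using True by simp
    next
      case False
      then have neg: "sign C j = - sign C' j"
        using sign_cases[of C j] sign_cases[of C' j] by auto
      have u: "f j x \<noteq> 0"
        using False common_fibre_sign[OF C C' y j] by blast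
      have normal: "normal C j = - normal C' j"
        by (simp add: normal_def neg)
      have "dual_apply (normal C j) y = - dual_apply (normal C' j) y"
        by (simp add: dual_apply_normal[OF j] neg)
      then show ?thesis
        using False by (simp add: normal slope_minus[OF u] algebra_simps)
    qed
  qed
  then show thesis
    using that by blast
qed

lemma openin_fibre:
  fixes \<Phi> :: "'e::real_vector \<Rightarrow> nat \<Rightarrow> real"
  assumes \<Phi>: "linear_coordinates \<Phi>" and X: "linear X" and Y: "linear Y" and C: "C \<in> chambers f n"
  shows "openin (ptop (vector_prevariety :: 'e prevariety)) {e. Y e \<in> fibre C (X e)}"
proof -
  let ?E = "vector_prevariety :: 'e prevariety"
  have "openin (ptop ?E) {e \<in> topspace (ptop ?E). \<forall>j\<in>J. f j (X e) \<noteq> 0 \<or> 0 < sign C j * (f j (Y e) - f j 0)}"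
  proof (rule openin_Collect_ball)
    fix j assume j: "j \<in> J"
    have "openin (ptop ?E) {e. 0 < sign C j * (f j (Y e) + - f j 0)}"
      by (intro openin_positive[OF \<Phi>] vector_germ_mult vector_germ_add vector_germ_const vector_germ_affine[OF \<Phi> Y j])
    from openin_Un[OF openin_off_hyperplane[OF \<Phi> X j] this]
    have "openin (ptop ?E) {e. f j (X e) \<noteq> 0 \<or> 0 < sign C j * (f j (Y e) + - f j 0)}"
      unfolding Collect_disj_eq .
    then show "openin (ptop ?E) {e \<in> topspace (ptop ?E). f j (X e) \<noteq> 0 \<or> 0 < sign C j * (f j (Y e) - f j 0)}"
      by (simp add: topspace_vector[OF \<Phi>])
  qed (rule finite_J)
  then show ?thesis
    by (simp add: fibre_iff[OF C] topspace_vector[OF \<Phi>])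
qed

lemma vector_germ_gradient:
  fixes \<Phi> :: "'e::real_vector \<Rightarrow> nat \<Rightarrow> real"
  assumes \<Phi>: "linear_coordinates \<Phi>" and X: "linear X" and Y: "linear Y" and \<gamma>: "linear \<gamma>"
    and C: "C \<in> chambers f n" and S: "\<And>e. e \<in> S \<Longrightarrow> Y e \<in> fibre C (X e)" and p: "p \<in> S"
  shows "vector_germ \<Phi> S (\<lambda>e. pair_coords (X e, \<gamma> e + gradient C (X e) (Y e)) i) p"
proof -
  note pair_coords_def = barrier_family.pair_coords_def[OF barrier_family[OF C]]
  have germ_at: "vector_germ \<Phi> S (\<lambda>e. dual_apply (\<gamma> e + gradient C (X e) (Y e)) w) p" for w
  proof -
    have "vector_germ \<Phi> S (\<lambda>e. dual_apply (\<gamma> e) w) p"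
      using linear_compose[OF \<gamma> linear_dual_apply_left] by (intro vector_germ_linear[OF \<Phi>]) (simp add: o_def)
    moreover have "vector_germ \<Phi> S
      (\<lambda>e. \<Sum>j\<in>J. slope (f j (X e)) (dual_apply (normal C j) (Y e)) * dual_apply (normal C j) w) p"
    proof (intro vector_germ_sum vector_germ_mult vector_germ_const vector_germ_slope[OF \<Phi> _ _ p])
      fix j assume j: "j \<in> J"
      show "vector_germ \<Phi> S (\<lambda>e. f j (X e)) p"
        by (rule vector_germ_affine[OF \<Phi> X j])
      show "vector_germ \<Phi> S (\<lambda>e. dual_apply (normal C j) (Y e)) p"
        using linear_compose[OF Y linear_dual_apply] by (intro vector_germ_linear[OF \<Phi>]) (simp add: o_def)
      show "f j (X p) \<noteq> 0 \<or> 0 < dual_apply (normal C j) (Y p)"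
        using S[OF p] j unfolding barrier_family.fibre_def[OF barrier_family[OF C]] by blast
    qed
    ultimately show ?thesis
      unfolding plus_dual_space.rep_eq barrier_family.gradient_def[OF barrier_family[OF C]]
        barrier_family.dual_apply_combination[OF barrier_family[OF C]] by (rule vector_germ_add)
  qed
  let ?d = "dim (UNIV :: 'v set)"
  show ?thesis
  proof (cases "i < ?d")
    case True
    have "vector_germ \<Phi> S (\<lambda>e. \<phi> (X e) i) p"
      using linear_compose[OF X linear_coordinate[OF coordinates, of i]]
      by (intro vector_germ_linear[OF \<Phi>]) (simp add: o_def)
    then show ?thesis
      using True by (simp add: pair_coords_def append_coords_def)
  next
    case False
    then show ?thesis
      using germ_at by (cases "i - ?d < ?d") (simp_all add: pair_coords_def append_coords_def dual_coords_def vector_germ_const)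
  qed
qed

end

context arrangement
begin

lemma vector_germ_solve:
  fixes \<Phi> :: "'e::real_vector \<Rightarrow> nat \<Rightarrow> real"
  assumes \<Phi>: "linear_coordinates \<Phi>" and X: "linear X" and Y: "linear Y" and \<gamma>: "linear \<gamma>"
    and C: "C \<in> chambers f n" and S: "\<And>e. e \<in> S \<Longrightarrow> Y e \<in> fibre C (X e)" and p: "p \<in> S"
    and i: "i < dim (UNIV :: 'v set)"
  shows "vector_germ \<Phi> S (\<lambda>e. \<phi> (solve C (X e) (\<gamma> e + gradient C (X e) (Y e))) i) p"
proof -
  have "vector_germ \<Phi> S (\<lambda>e. (\<lambda>q. \<phi> (solve C (fst q) (snd q)) i) (X e, \<gamma> e + gradient C (X e) (Y e))) p"
    by (rule vector_germ_compose[where h = "\<lambda>q. \<phi> (solve C (fst q) (snd q)) i",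
          OF \<Phi> barrier_family.linear_coordinates_pair[OF barrier_family[OF C]]
          vector_germ_gradient[OF \<Phi> X Y \<gamma> C S p] barrier_family.solve_analytic[OF barrier_family[OF C] i] p])
  then show ?thesis
    by simp
qed

section \<open>The glued space\<close>

text \<open>
  In terms of signs the relation is visibly an equivalence.
\<close>

lemma gluing_iff:
  "((C, q), (C', q')) \<in> gluing f n \<longleftrightarrow> C \<in> chambers f n \<and> C' \<in> chambers f n \<and> q = q' \<and>
     (\<forall>j\<in>J. f j q = 0 \<longrightarrow> sign C j = sign C' j)"
proof -
  have "(\<forall>j\<in>J. separates (f j) C C' \<longrightarrow> q \<notin> {x. f j x = 0}) \<longleftrightarrow> (\<forall>j\<in>J. f j q = 0 \<longrightarrow> sign C j = sign C' j)"
    if "C \<in> chambers f n" "C' \<in> chambers f n"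
    using separates_iff_sign[OF that] by blast
  then show ?thesis
    unfolding gluing_def J_def[symmetric] hyperplane_def by blast
qed

lemma equiv_gluing: "equiv (chambers f n \<times> UNIV) (gluing f n)"
proof (rule equivI)
  show "gluing f n \<subseteq> (chambers f n \<times> UNIV) \<times> chambers f n \<times> UNIV"
    by (auto simp: gluing_iff)
  show "refl_on (chambers f n \<times> UNIV) (gluing f n)"
    by (rule refl_onI) (auto simp: gluing_iff)
  show "sym (gluing f n)"
    by (rule symI) (auto simp: gluing_iff)
  show "trans (gluing f n)"
    by (rule transI) (auto simp: gluing_iff)
qed

definition glued_point :: "'v set \<Rightarrow> 'v \<Rightarrow> ('v set \<times> 'v) set" where
  "glued_point C q = gluing f n `` {(C, q)}"

lemma glued_point_eq_iff:
  assumes "C \<in> chambers f n" "C' \<in> chambers f n"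
  shows "glued_point C q = glued_point C' q' \<longleftrightarrow> q = q' \<and> (\<forall>j\<in>J. f j q = 0 \<longrightarrow> sign C j = sign C' j)"
  unfolding glued_point_def using assms
  by (subst eq_equiv_class_iff[OF equiv_gluing]) (auto simp: gluing_iff)

lemma chamber_copy_eq: "chamber_copy f n C = range (glued_point C)"
  by (auto simp: chamber_copy_def quotient_def glued_point_def)

lemma points_glued_space: "points (glued_space f n) = (\<Union>C\<in>chambers f n. chamber_copy f n C)"
  by (auto simp: glued_space_def chamber_copy_def quotient_def)

lemma copy_point_glued_point:
  assumes "C \<in> chambers f n"
  shows "copy_point C (glued_point C q) = q"
  unfolding copy_point_def glued_point_def
  by (rule the_equality) (use assms in \<open>auto simp: gluing_iff\<close>)

lemma glued_point_in_copy_iff: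
  assumes "C \<in> chambers f n" "C' \<in> chambers f n"
  shows "glued_point C' q \<in> chamber_copy f n C \<longleftrightarrow> (\<forall>j\<in>J. f j q = 0 \<longrightarrow> sign C' j = sign C j)"
  unfolding chamber_copy_eq image_iff by (simp add: glued_point_eq_iff[OF assms(2,1)])

lemma copy_chart:
  "C \<in> chambers f n \<Longrightarrow> (chamber_copy f n C, \<lambda>z. \<phi> (copy_point C z)) \<in> charts (glued_space f n)"
  using coordinates by (auto simp: glued_space_def)

lemma pdim_glued_space: "pdim (glued_space f n) = dim (UNIV :: 'v set)"
  by (simp add: glued_space_def)

lemma copy_overlap_image:
  assumes C: "C \<in> chambers f n" and C': "C' \<in> chambers f n"
  shows "(\<lambda>z. \<psi> (copy_point C z)) ` (chamber_copy f n C \<inter> chamber_copy f n C')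
    = \<psi> ` {q. \<forall>j\<in>J. f j q = 0 \<longrightarrow> sign C j = sign C' j}"
proof -
  have "chamber_copy f n C \<inter> chamber_copy f n C' = glued_point C ` {q. \<forall>j\<in>J. f j q = 0 \<longrightarrow> sign C j = sign C' j}"
    using glued_point_in_copy_iff[OF C' C] unfolding chamber_copy_eq[of C] by blast
  then show ?thesis
    by (simp add: image_image copy_point_glued_point[OF C])
qed

lemma openin_agreement:
  "openin (ptop (vector_prevariety :: 'v prevariety)) {q. \<forall>j\<in>J. f j q = 0 \<longrightarrow> sign C j = sign C' j}"
proof -
  let ?V = "vector_prevariety :: 'v prevariety"
  have top: "topspace (ptop ?V) = UNIV"
    by (rule topspace_vector[OF coordinates])
  have "openin (ptop ?V) {q \<in> topspace (ptop ?V). \<forall>j\<in>J. f j q = 0 \<longrightarrow> sign C j = sign C' j}"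
  proof (rule openin_Collect_ball[OF finite_J])
    fix j assume j: "j \<in> J"
    show "openin (ptop ?V) {q \<in> topspace (ptop ?V). f j q = 0 \<longrightarrow> sign C j = sign C' j}"
      using openin_off_hyperplane[OF coordinates linear_ident j] openin_topspace[of "ptop ?V"]
      by (cases "sign C j = sign C' j") (simp_all add: top)
  qed
  then show ?thesis
    by (simp add: top)
qed

text \<open>
  Two copies overlap over the complement of the hyperplanes that separate their chambers, which is open, and
  the transition maps are linear changes of coordinates.
\<close>

lemma real_analytic_prevariety_glued_space: "real_analytic_prevariety (glued_space f n)"
proof (rule real_analytic_prevarietyI)
  let ?Z = "glued_space f n"
  have charts: "\<exists>C \<psi>. C \<in> chambers f n \<and> linear_coordinates \<psi> \<and> U = chamber_copy f n C \<and> \<chi>' = (\<lambda>z. \<psi> (copy_point C z))"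
    if "(U, \<chi>') \<in> charts ?Z" for U \<chi>'
    using that by (auto simp: glued_space_def)
  show "(\<Union>c\<in>charts ?Z. fst c) = points ?Z"
    unfolding points_glued_space
  proof (intro equalityI subsetI)
    fix z assume "z \<in> (\<Union>c\<in>charts ?Z. fst c)"
    then obtain c where "c \<in> charts ?Z" "z \<in> fst c"
      by blast
    then show "z \<in> (\<Union>C\<in>chambers f n. chamber_copy f n C)"
      using charts[of "fst c" "snd c"] by auto
  next
    fix z assume "z \<in> (\<Union>C\<in>chambers f n. chamber_copy f n C)"
    then obtain C where "C \<in> chambers f n" "z \<in> chamber_copy f n C"
      by blast
    then show "z \<in> (\<Union>c\<in>charts ?Z. fst c)"
      using copy_chart by force
  qed
  have inj: "inj_on (\<lambda>z. \<psi> (copy_point C z)) (chamber_copy f n C)"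
    if C: "C \<in> chambers f n" and \<psi>: "linear_coordinates \<psi>" for C \<psi>
    unfolding chamber_copy_eq
    by (intro inj_onI) (auto simp: copy_point_glued_point[OF C] dest: injD[OF linear_coordinates_inj[OF \<psi>]])
  show "inj_on \<chi>' U" if "(U, \<chi>') \<in> charts ?Z" for U \<chi>'
    using charts[OF that] inj by blast
  show "openin (Euclidean_space (pdim ?Z)) (\<chi>' ` (U \<inter> U'))"
    if U: "(U, \<chi>') \<in> charts ?Z" and U': "(U', \<omega>) \<in> charts ?Z" for U \<chi>' U' \<omega>
  proof -
    obtain C \<psi> where 1: "C \<in> chambers f n" "linear_coordinates \<psi>" "U = chamber_copy f n C"
      "\<chi>' = (\<lambda>z. \<psi> (copy_point C z))"
      using charts[OF U] by blast
    obtain C' where 2: "C' \<in> chambers f n" "U' = chamber_copy f n C'"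
      using charts[OF U'] by blast
    show ?thesis
      unfolding 1(3,4) 2(2) copy_overlap_image[OF 1(1) 2(1)] pdim_glued_space
      using openin_agreement openin_vector[OF 1(2)] by blast
  qed
  fix U \<chi>' U' \<omega> i a
  assume U: "(U, \<chi>') \<in> charts ?Z" and U': "(U', \<omega>) \<in> charts ?Z" and a: "a \<in> \<chi>' ` (U \<inter> U')"
  obtain C \<psi> where 1: "C \<in> chambers f n" "linear_coordinates \<psi>" "U = chamber_copy f n C"
    "\<chi>' = (\<lambda>z. \<psi> (copy_point C z))"
    using charts[OF U] by blast
  obtain C' \<psi>' where 2: "C' \<in> chambers f n" "linear_coordinates \<psi>'" "U' = chamber_copy f n C'"
    "\<omega> = (\<lambda>z. \<psi>' (copy_point C' z))"
    using charts[OF U'] by blast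
  let ?A = "{q. \<forall>j\<in>J. f j q = 0 \<longrightarrow> sign C j = sign C' j}"
  have image: "\<chi>' ` (U \<inter> U') = \<psi> ` ?A"
    unfolding 1(3,4) 2(3) by (rule copy_overlap_image[OF 1(1) 2(1)])
  obtain p where p: "a = \<psi> p"
    using a unfolding image by blast
  have "vector_germ \<psi> ?A (\<lambda>v. \<psi>' v i) p"
    by (rule vector_germ_linear[OF 1(2) linear_coordinate[OF 2(2)]])
  then have germ: "analytic_germ (pdim ?Z) (\<psi> ` ?A) (\<lambda>x. \<psi>' (inv \<psi> x) i) a"
    unfolding vector_germ_def pdim_glued_space p .
  show "analytic_germ (pdim ?Z) (\<chi>' ` (U \<inter> U')) (\<lambda>x. \<omega> (inv_into U \<chi>' x) i) a"
    unfolding image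
  proof (rule analytic_germ_cong[OF germ])
    fix x assume "x \<in> \<psi> ` ?A"
    then obtain q where q: "x = \<psi> q" "q \<in> ?A"
      by blast
    have "x = \<chi>' (glued_point C q)"
      by (simp add: 1(4) copy_point_glued_point[OF 1(1)] q(1))
    then have "inv_into U \<chi>' x = glued_point C q"
      using inv_into_f_f[OF inj[OF 1(1,2)], of "glued_point C q"] by (simp add: 1(3,4) chamber_copy_eq)
    also have "\<dots> = glued_point C' q"
      using q(2) by (simp add: glued_point_eq_iff[OF 1(1) 2(1)])
    finally show "\<psi>' (inv \<psi> x) i = \<omega> (inv_into U \<chi>' x) i"
      by (simp add: 2(4) copy_point_glued_point[OF 2(1)] q(1) linear_coordinates_inv[OF 1(2)])
  qed
qed

section \<open>The complexified complement and its principal bundle structure\<close>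

definition complement :: "('v \<times> 'v) set" where
  "complement = {e. \<forall>j\<in>J. f j (fst e) \<noteq> 0 \<or> f j (snd e) \<noteq> f j 0}"

lemma complexified_complement_eq:
  "complexified_complement f n = open_subprevariety vector_prevariety complement"
proof -
  have "e \<in> complex_hyperplane (f j) \<longleftrightarrow> f j (fst e) = 0 \<and> f j (snd e) = f j 0" if "j \<in> J" for j e
    using dual_apply_linear_form[OF affine_J[OF that]]
    by (cases e) (simp add: complex_hyperplane_def complexification_def complex_eq_iff)
  then have "UNIV - (\<Union>j\<in>J. complex_hyperplane (f j)) = complement"
    by (auto simp: complement_def)
  then show ?thesis
    by (simp add: complexified_complement_def J_def)
qed

text \<open>
  A point \<open>x + \<i>y\<close> of the complement determines the chamber into which \<open>x\<close> moves in the direction \<open>y\<close>: for small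
  \<open>s > 0\<close> the point \<open>x + s y\<close> lies on no hyperplane, because \<open>y\<close> is transversal to those through \<open>x\<close>.
\<close>

lemma complement_iff: "(x, y) \<in> complement \<longleftrightarrow> (\<exists>C\<in>chambers f n. y \<in> fibre C x)"
proof
  assume e: "(x, y) \<in> complement"
  have line: "f j (x + s *\<^sub>R y) = f j x + s * (f j y - f j 0)" if j: "j \<in> J" for j s
    using linear_add[OF linear_dual_apply, of "linear_form (f j)" x "s *\<^sub>R y"]
      linear_scale[OF linear_dual_apply, of "linear_form (f j)" s y]
    by (simp add: dual_apply_linear_form[OF affine_J[OF j]])
  have "eventually (\<lambda>s. \<forall>j\<in>J. f j (x + s *\<^sub>R y) \<noteq> 0) (at_right 0)"
  proof (intro eventually_ball_finite finite_J ballI)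
    fix j assume j: "j \<in> J"
    show "eventually (\<lambda>s. f j (x + s *\<^sub>R y) \<noteq> 0) (at_right 0)"
    proof (cases "f j x = 0")
      case True
      then have "f j y \<noteq> f j 0"
        using e j by (auto simp: complement_def)
      then show ?thesis
        using True eventually_at_right_less[of "0::real"] by (auto simp: line[OF j] elim: eventually_mono)
    next
      case False
      have "((\<lambda>s. f j x + s * (f j y - f j 0)) \<longlongrightarrow> f j x + 0 * (f j y - f j 0)) (at_right 0)"
        by (intro tendsto_intros)
      then show ?thesis
        unfolding line[OF j] by (rule tendsto_imp_eventually_ne) (use False in simp)
    qed
  qed
  then have "eventually (\<lambda>s. 0 < s \<and> (\<forall>j\<in>J. f j (x + s *\<^sub>R y) \<noteq> 0)) (at_right 0)"
    using eventually_at_right_less[of "0::real"] by (rule eventually_conj[rotated])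
  then obtain s where s: "0 < s" "\<And>j. j \<in> J \<Longrightarrow> f j (x + s *\<^sub>R y) \<noteq> 0"
    using eventually_happens'[OF trivial_limit_at_right_real] by blast
  obtain C where C: "C \<in> chambers f n" "x + s *\<^sub>R y \<in> C"
    using ex_chamber[OF s(2)] by blast
  have "f j x \<noteq> 0 \<or> 0 < sign C j * (f j y - f j 0)" if j: "j \<in> J" for j
    using chamber_sign[OF C(1) j C(2)] s(1) unfolding line[OF j]
    by (cases "f j x = 0") (simp_all add: mult.left_commute zero_less_mult_iff)
  then show "\<exists>C\<in>chambers f n. y \<in> fibre C x"
    using C(1) fibre_iff by blast
next
  assume "\<exists>C\<in>chambers f n. y \<in> fibre C x"
  then obtain C where "\<forall>j\<in>J. f j x \<noteq> 0 \<or> 0 < sign C j * (f j y - f j 0)"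
    using fibre_iff by blast
  then show "(x, y) \<in> complement"
    by (auto simp: complement_def)
qed

definition point_coords :: "'v \<times> 'v \<Rightarrow> nat \<Rightarrow> real" where
  "point_coords = append_coords (dim (UNIV :: 'v set)) \<phi> \<phi>"

lemma linear_coordinates_point: "linear_coordinates point_coords"
  and dim_point: "dim (UNIV :: ('v \<times> 'v) set) = dim (UNIV :: 'v set) + dim (UNIV :: 'v set)"
  unfolding point_coords_def using linear_coordinates_product[OF coordinates coordinates] by auto

lemma pdim_complement: "pdim (complexified_complement f n) = dim (UNIV :: 'v set) + dim (UNIV :: 'v set)"
  by (simp add: complexified_complement_eq open_subprevariety_def vector_prevariety_def dim_point)

lemma points_complement: "points (complexified_complement f n) = complement"
  by (simp add: complexified_complement_eq open_subprevariety_def vector_prevariety_def)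

lemma complement_chart: "(complement, point_coords) \<in> charts (complexified_complement f n)"
proof -
  have "(UNIV, point_coords) \<in> charts (vector_prevariety :: ('v \<times> 'v) prevariety)"
    using linear_coordinates_point by (simp add: vector_prevariety_def)
  then have "(UNIV \<inter> complement, point_coords) \<in> charts (open_subprevariety vector_prevariety complement)"
    by (force simp: open_subprevariety_def)
  then show ?thesis
    by (simp add: complexified_complement_eq)
qed

lemma openin_chamber_part:
  assumes "C \<in> chambers f n"
  shows "openin (ptop (vector_prevariety :: ('v \<times> 'v) prevariety)) {e. snd e \<in> fibre C (fst e)}"
  by (rule openin_fibre[OF linear_coordinates_point linear_fst linear_snd assms])

lemma real_analytic_prevariety_complement: "real_analytic_prevariety (complexified_complement f n)"
  unfolding complexified_complement_eq
proof (rule real_analytic_prevariety_open_subprevariety)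
  let ?V2 = "vector_prevariety :: ('v \<times> 'v) prevariety"
  show V2: "real_analytic_prevariety ?V2"
    by (rule real_analytic_prevariety_vector[OF linear_coordinates_point])
  have "complement = (\<Union>C\<in>chambers f n. {e. snd e \<in> fibre C (fst e)})"
    using complement_iff by auto
  then have "openin (ptop ?V2) complement"
    using openin_chamber_part by (auto intro!: openin_Union)
  moreover have "points ?V2 \<inter> complement = complement"
    by (simp add: vector_prevariety_def)
  ultimately show "atlas_open ?V2 (points ?V2 \<inter> complement)"
    by (simp only: openin_ptop[OF V2])
qed

text \<open>
  An arbitrary choice among the chambers whose part of the complement contains \<open>e\<close>; projection and action
  are defined with it and then shown to be independent of the choice.
\<close>

definition chamber_at :: "'v \<times> 'v \<Rightarrow> 'v set" where
  "chamber_at e = (SOME C. C \<in> chambers f n \<and> snd e \<in> fibre C (fst e))"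

definition proj :: "'v \<times> 'v \<Rightarrow> ('v set \<times> 'v) set" where
  "proj e = glued_point (chamber_at e) (fst e)"

definition act :: "'v dual_space \<Rightarrow> 'v \<times> 'v \<Rightarrow> 'v \<times> 'v" where
  "act g e = (fst e, solve (chamber_at e) (fst e) (g + gradient (chamber_at e) (fst e) (snd e)))"

lemma chamber_at:
  assumes "C \<in> chambers f n" "y \<in> fibre C x"
  shows "chamber_at (x, y) \<in> chambers f n" "y \<in> fibre (chamber_at (x, y)) x"
  using someI[of "\<lambda>C. C \<in> chambers f n \<and> y \<in> fibre C x" C] assms by (simp_all add: chamber_at_def)

text \<open>
  Two chambers with \<open>y\<close> in both fibres over \<open>x\<close> have equal signs at the hyperplanes through \<open>x\<close>, and so the
  points of their copies over \<open>x\<close> are glued.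
\<close>

lemma proj_eq:
  assumes C: "C \<in> chambers f n" and y: "y \<in> fibre C x"
  shows "proj (x, y) = glued_point C x"
  using common_fibre_sign[OF chamber_at(1)[OF assms] C chamber_at(2)[OF assms] y]
  by (simp add: proj_def glued_point_eq_iff[OF chamber_at(1)[OF assms] C])

text \<open>
  The gradients of two admissible chambers have the same fibre over \<open>x\<close> as domain and differ there by a
  constant covector, which does not affect translations.
\<close>

lemma act_eq:
  assumes C: "C \<in> chambers f n" and y: "y \<in> fibre C x"
  shows "act g (x, y) = (x, solve C x (g + gradient C x y))"
proof -
  let ?D = "chamber_at (x, y)"
  note D = chamber_at[OF assms]
  define y' where "y' = solve ?D x (g + gradient ?D x y)"
  have same: "fibre ?D x = fibre C x"
    by (rule fibre_eq[OF D(1) C common_fibre_sign[OF D(1) C D(2) y]])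
  have y': "y' \<in> fibre C x"
    unfolding same[symmetric] y'_def by (rule solve_in_fibre[OF D(1)])
  obtain \<tau> where \<tau>: "\<And>y. y \<in> fibre C x \<Longrightarrow> y \<in> fibre ?D x \<Longrightarrow> gradient C x y = gradient ?D x y + \<tau>"
    using gradient_transition[OF C D(1)] by blast
  have "gradient C x y' = gradient ?D x y' + \<tau>"
    by (rule \<tau>) (use y' same in simp_all)
  also have "gradient ?D x y' = g + gradient ?D x y"
    unfolding y'_def by (rule gradient_solve[OF D(1)])
  also have "g + gradient ?D x y + \<tau> = g + gradient C x y"
    using \<tau>[OF y D(2)] by (simp add: add.assoc)
  finally have "solve C x (g + gradient C x y) = y'"
    by (rule solve_unique[OF C y'])
  then show ?thesis
    by (simp add: act_def y'_def)
qed

lemma act_in_fibre: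
  assumes "C \<in> chambers f n" "y \<in> fibre C x"
  shows "fst (act g (x, y)) = x" "snd (act g (x, y)) \<in> fibre C x"
    and "gradient C x (snd (act g (x, y))) = g + gradient C x y"
  unfolding act_eq[OF assms] using solve_in_fibre[OF assms(1)] gradient_solve[OF assms(1)] by simp_all

lemma proj_act:
  assumes "e \<in> complement"
  shows "proj (act g e) = proj e"
proof -
  obtain x y where e: "e = (x, y)"
    by fastforce
  obtain C where C: "C \<in> chambers f n" "y \<in> fibre C x"
    using assms complement_iff unfolding e by blast
  have "act g e = (x, snd (act g e))"
    using act_in_fibre(1)[OF C] by (simp add: e prod_eq_iff)
  then show ?thesis
    using proj_eq[OF C(1) act_in_fibre(2)[OF C, of g]] proj_eq[OF C] by (simp add: e)
qed

text \<open>
  The preimage of the copy \<open>V\<^sub>C\<close> is the part of the complement on which the gradient of \<open>C\<close> is defined.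
\<close>

lemma proj_in_copy_iff:
  assumes e: "e \<in> complement" and C: "C \<in> chambers f n"
  shows "proj e \<in> chamber_copy f n C \<longleftrightarrow> snd e \<in> fibre C (fst e)"
proof -
  obtain D where D: "D \<in> chambers f n" "snd e \<in> fibre D (fst e)"
    using complement_iff[of "fst e" "snd e"] e by auto
  have "proj e = glued_point D (fst e)"
    using proj_eq[OF D] by simp
  then have "proj e \<in> chamber_copy f n C \<longleftrightarrow> (\<forall>j\<in>J. f j (fst e) = 0 \<longrightarrow> sign D j = sign C j)"
    using glued_point_in_copy_iff[OF C D(1)] by simp
  also have "\<dots> \<longleftrightarrow> snd e \<in> fibre C (fst e)"
    using fibre_eq[OF D(1) C] common_fibre_sign[OF D(1) C D(2)] D(2) by blast
  finally show ?thesis .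
qed

lemma analytic_proj: "real_analytic_map (complexified_complement f n) (glued_space f n) proj"
proof (rule real_analytic_map_if_analytic_at[OF real_analytic_prevariety_complement real_analytic_prevariety_glued_space])
  fix p assume "p \<in> points (complexified_complement f n)"
  then obtain C where C: "C \<in> chambers f n" "snd p \<in> fibre C (fst p)"
    using complement_iff[of "fst p" "snd p"] by (auto simp: points_complement)
  show "analytic_at (complexified_complement f n) (glued_space f n) proj p"
  proof (rule analytic_at_via_vector_space[OF real_analytic_prevariety_complement complement_chart
        copy_chart[OF C(1)] linear_coordinates_point _ openin_chamber_part[OF C(1)], where \<kappa> = "\<lambda>v. v"])
    show "pdim (complexified_complement f n) = dim (UNIV :: ('v \<times> 'v) set)"
      by (simp add: pdim_complement dim_point)
    show "p \<in> {e. snd e \<in> fibre C (fst e)}"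
      using C(2) by simp
    fix v assume "v \<in> {e. snd e \<in> fibre C (fst e)}"
    then have v: "snd v \<in> fibre C (fst v)"
      by simp
    show "v \<in> complement"
      using complement_iff[of "fst v" "snd v"] C(1) v by auto
    then show "proj v \<in> chamber_copy f n C"
      using proj_in_copy_iff[OF _ C(1)] v by blast
  next
    fix i
    have "vector_germ point_coords {e. snd e \<in> fibre C (fst e)} (\<lambda>e. \<phi> (fst e) i) p"
      using linear_compose[OF linear_fst linear_coordinate[OF coordinates, of i]]
      by (intro vector_germ_linear[OF linear_coordinates_point]) (simp add: o_def)
    then show "vector_germ point_coords {e. snd e \<in> fibre C (fst e)} (\<lambda>v. \<phi> (copy_point C (proj v)) i) p"
    proof (rule vector_germ_cong[OF linear_coordinates_point])
      fix v assume "v \<in> {e. snd e \<in> fibre C (fst e)}"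
      then have "proj (fst v, snd v) = glued_point C (fst v)"
        by (intro proj_eq[OF C(1)]) simp
      then show "\<phi> (fst v) i = \<phi> (copy_point C (proj v)) i"
        by (simp add: copy_point_glued_point[OF C(1)])
    qed
  qed simp
qed

abbreviation "G \<equiv> vector_prevariety :: 'v dual_space prevariety"

lemma real_analytic_prevariety_G: "real_analytic_prevariety G"
  and pdim_G: "pdim G = dim (UNIV :: 'v set)"
  and chart_G: "(UNIV, dual_coords \<phi>) \<in> charts G"
  using real_analytic_prevariety_vector[OF linear_coordinates_dual(2)[OF coordinates]]
    linear_coordinates_dual[OF coordinates]
  by (simp_all add: vector_prevariety_def)

lemma vector_germ_point_coords:
  fixes \<Phi> :: "'e::real_vector \<Rightarrow> nat \<Rightarrow> real"
  assumes \<Phi>: "linear_coordinates \<Phi>" and X: "linear X"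
    and Y: "\<And>i. i < dim (UNIV :: 'v set) \<Longrightarrow> vector_germ \<Phi> S (\<lambda>e. \<phi> (Y e) i) p"
    and i: "i < dim (UNIV :: 'v set) + dim (UNIV :: 'v set)"
  shows "vector_germ \<Phi> S (\<lambda>e. point_coords (X e, Y e) i) p"
proof (cases "i < dim (UNIV :: 'v set)")
  case True
  have "vector_germ \<Phi> S (\<lambda>e. \<phi> (X e) i) p"
    using linear_compose[OF X linear_coordinate[OF coordinates, of i]]
    by (intro vector_germ_linear[OF \<Phi>]) (simp add: o_def)
  then show ?thesis
    using True by (simp add: point_coords_def append_coords_def)
next
  case False
  then show ?thesis
    using Y[of "i - dim (UNIV :: 'v set)"] i by (simp add: point_coords_def append_coords_def)
qed

lemma analytic_act: "real_analytic_map (product_prevariety G (complexified_complement f n)) (complexified_complement f n)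
    (\<lambda>(g, x). act g x)"
proof -
  let ?M = "complexified_complement f n"
  let ?\<Phi> = "append_coords (dim (UNIV :: 'v dual_space set)) (dual_coords \<phi>) point_coords"
  note dual = linear_coordinates_dual[OF coordinates]
  note prod = linear_coordinates_product[OF dual(2) linear_coordinates_point]
  note GM = real_analytic_prevariety_product[OF real_analytic_prevariety_G real_analytic_prevariety_complement]
  have chart: "(UNIV \<times> complement, ?\<Phi>) \<in> charts (product_prevariety G ?M)"
    using product_chart[OF chart_G complement_chart] by (simp add: pdim_G dual(1))
  have lin: "linear (\<lambda>e :: 'v dual_space \<times> 'v \<times> 'v. fst (snd e))" "linear (\<lambda>e :: 'v dual_space \<times> 'v \<times> 'v. snd (snd e))"
    using linear_compose[OF linear_snd linear_fst] linear_compose[OF linear_snd linear_snd] by (simp_all add: o_def)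
  show ?thesis
  proof (rule real_analytic_map_if_analytic_at[OF GM real_analytic_prevariety_complement])
    fix p assume "p \<in> points (product_prevariety G ?M)"
    then have "snd p \<in> complement"
      by (auto simp: product_prevariety_def points_complement)
    then obtain C where C: "C \<in> chambers f n" "snd (snd p) \<in> fibre C (fst (snd p))"
      using complement_iff[of "fst (snd p)" "snd (snd p)"] by auto
    let ?S = "{e :: 'v dual_space \<times> 'v \<times> 'v. snd (snd e) \<in> fibre C (fst (snd e))}"
    have act: "(case v of (g, x) \<Rightarrow> act g x) =
        (fst (snd v), solve C (fst (snd v)) (fst v + gradient C (fst (snd v)) (snd (snd v))))" if "v \<in> ?S" for v
      using act_eq[OF C(1), of "snd (snd v)" "fst (snd v)" "fst v"] that by (simp add: case_prod_beta)
    show "analytic_at (product_prevariety G ?M) ?M (\<lambda>(g, x). act g x) p"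
    proof (rule analytic_at_via_vector_space[OF GM chart complement_chart prod(2) _
          openin_fibre[OF prod(2) lin C(1)], where \<kappa> = "\<lambda>v. v"])
      show "pdim (product_prevariety G ?M) = dim (UNIV :: ('v dual_space \<times> 'v \<times> 'v) set)"
        by (simp add: product_prevariety_def pdim_G pdim_complement prod(1) dual(1) dim_point)
      show "p \<in> ?S"
        using C(2) by simp
      fix v assume v: "v \<in> ?S"
      show "v \<in> UNIV \<times> complement"
        using complement_iff[of "fst (snd v)" "snd (snd v)"] C(1) v by (auto simp: mem_Times_iff)
      show "(case v of (g, x) \<Rightarrow> act g x) \<in> complement"
        unfolding act[OF v] complement_iff using C(1) solve_in_fibre[OF C(1)] by blast
    next
      fix i assume "i < pdim ?M"
      then have i: "i < dim (UNIV :: 'v set) + dim (UNIV :: 'v set)"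
        by (simp add: pdim_complement)
      have "vector_germ ?\<Phi> ?S (\<lambda>v. point_coords (fst (snd v),
          solve C (fst (snd v)) (fst v + gradient C (fst (snd v)) (snd (snd v)))) i) p"
        by (rule vector_germ_point_coords[OF prod(2) lin(1) vector_germ_solve[OF prod(2) lin linear_fst C(1)] i])
          (use C(2) in simp_all)
      then show "vector_germ ?\<Phi> ?S (\<lambda>v. point_coords (case v of (g, x) \<Rightarrow> act g x) i) p"
        by (rule vector_germ_cong[OF prod(2)]) (simp add: act)
    qed simp
  qed
qed

lemma action: "real_analytic_action G (complexified_complement f n) act"
  unfolding real_analytic_action_def
proof (intro conjI analytic_act ballI allI)
  fix e assume "e \<in> points (complexified_complement f n)"
  moreover obtain x y where e: "e = (x, y)"
    by fastforce
  ultimately obtain C where C: "C \<in> chambers f n" "y \<in> fibre C x"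
    using complement_iff unfolding points_complement by blast
  show "act 0 e = e"
    by (simp add: e act_eq[OF C] solve_gradient[OF C])
  fix g h
  have "act h e = (x, snd (act h e))"
    using act_in_fibre(1)[OF C] by (simp add: e prod_eq_iff)
  then have "act g (act h e) = (x, solve C x (g + gradient C x (snd (act h e))))"
    using act_eq[OF C(1) act_in_fibre(2)[OF C, of h], of g] by (simp add: e)
  then show "act (g + h) e = act g (act h e)"
    using act_in_fibre(3)[OF C, of h] by (simp add: e act_eq[OF C] add.assoc)
qed

text \<open>
  Over the copy of \<open>C\<close> the projection together with the gradient is bijective, since the gradient maps each fibre
  bijectively onto the dual space.  The inverse solves \<open>gradient C x y = \<xi>\<close> for \<open>y\<close>, analytically in \<open>(x, \<xi>)\<close>.
\<close>

lemma trivialization: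
  assumes C: "C \<in> chambers f n"
  shows "real_analytic_iso (open_subprevariety (complexified_complement f n) (proj -` chamber_copy f n C))
    (product_prevariety (open_subprevariety (glued_space f n) (chamber_copy f n C)) G)
    (\<lambda>e. (proj e, gradient C (fst e) (snd e)))"
proof -
  let ?M = "complexified_complement f n" and ?Z = "glued_space f n" and ?U = "chamber_copy f n C"
  let ?M' = "open_subprevariety ?M (proj -` ?U)" and ?Z' = "open_subprevariety ?Z ?U"
  let ?S = "{e. snd e \<in> fibre C (fst e)}" and ?d = "dim (UNIV :: 'v set)"
  let ?\<psi> = "append_coords ?d (\<lambda>z. \<phi> (copy_point C z)) (dual_coords \<phi>)"
  note M = real_analytic_prevariety_complement and Z = real_analytic_prevariety_glued_space
  note bf = barrier_family[OF C]
  note dual = linear_coordinates_dual[OF coordinates]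
  note pair = barrier_family.linear_coordinates_pair[OF bf]
  have S: "complement \<inter> proj -` ?U = ?S"
  proof (intro equalityI subsetI)
    fix e assume "e \<in> complement \<inter> proj -` ?U"
    then show "e \<in> ?S"
      using proj_in_copy_iff[OF _ C, of e] by blast
  next
    fix e assume e: "e \<in> ?S"
    then have "(fst e, snd e) \<in> complement"
      unfolding complement_iff using C by blast
    then show "e \<in> complement \<inter> proj -` ?U"
      using proj_in_copy_iff[OF _ C, of e] e by simp
  qed
  have open_U: "atlas_open ?Z ?U"
    by (rule atlas_open_chart[OF Z copy_chart[OF C]])
  have "openin (ptop ?M) {e \<in> topspace (ptop ?M). proj e \<in> ?U}"
    by (rule openin_continuous_map_preimage[where Y = "ptop ?Z"])
      (use analytic_proj open_U in \<open>auto simp: real_analytic_map_def openin_ptop[OF Z]\<close>)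
  then have "atlas_open ?M (points ?M \<inter> proj -` ?U)"
    unfolding openin_ptop[OF M] topspace_ptop[OF M] by (simp add: Int_def vimage_def)
  then have M': "real_analytic_prevariety ?M'"
    by (rule real_analytic_prevariety_open_subprevariety[OF M])
  have "points ?Z \<inter> ?U = ?U"
    using C by (auto simp: points_glued_space)
  then have Z': "real_analytic_prevariety ?Z'"
    using real_analytic_prevariety_open_subprevariety[OF Z, of ?U] open_U by simp
  note ZG = real_analytic_prevariety_product[OF Z' real_analytic_prevariety_G]
  have "(complement \<inter> proj -` ?U, point_coords) \<in> charts ?M'"
    using complement_chart by (force simp: open_subprevariety_def)
  then have chart_M': "(?S, point_coords) \<in> charts ?M'"
    by (simp only: S)
  have "(?U \<inter> ?U, \<lambda>z. \<phi> (copy_point C z)) \<in> charts ?Z'"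
    using copy_chart[OF C] by (force simp: open_subprevariety_def)
  then have chart_Z': "(?U, \<lambda>z. \<phi> (copy_point C z)) \<in> charts ?Z'"
    by simp
  have pdim_Z': "pdim ?Z' = ?d" and pdim_M': "pdim ?M' = ?d + ?d"
    by (simp_all add: open_subprevariety_def pdim_glued_space pdim_complement)
  have chart_ZG: "(?U \<times> UNIV, ?\<psi>) \<in> charts (product_prevariety ?Z' G)"
    using product_chart[OF chart_Z' chart_G] by (simp only: pdim_Z')
  have pdim_ZG: "pdim (product_prevariety ?Z' G) = ?d + ?d"
    by (simp add: product_prevariety_def pdim_Z' pdim_G)
  have points_M': "points ?M' = ?S"
    by (simp add: open_subprevariety_def points_complement S)
  have points_ZG: "points (product_prevariety ?Z' G) = ?U \<times> UNIV"
    using \<open>points ?Z \<inter> ?U = ?U\<close> by (simp add: product_prevariety_def open_subprevariety_def vector_prevariety_def)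
  have proj_S: "proj e = glued_point C (fst e)" if "e \<in> ?S" for e
    using proj_eq[OF C, of "snd e" "fst e"] that by simp
  have forward: "real_analytic_map ?M' (product_prevariety ?Z' G) (\<lambda>e. (proj e, gradient C (fst e) (snd e)))"
  proof (rule real_analytic_map_if_analytic_at[OF M' ZG])
    fix p assume "p \<in> points ?M'"
    then have p: "p \<in> ?S"
      by (simp add: points_M')
    show "analytic_at ?M' (product_prevariety ?Z' G) (\<lambda>e. (proj e, gradient C (fst e) (snd e))) p"
    proof (rule analytic_at_via_vector_space[OF M' chart_M' chart_ZG linear_coordinates_point _
          openin_chamber_part[OF C] p, where \<kappa> = "\<lambda>v. v"])
      show "pdim ?M' = dim (UNIV :: ('v \<times> 'v) set)"
        by (simp add: pdim_M' dim_point)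
      show "(proj v, gradient C (fst v) (snd v)) \<in> ?U \<times> UNIV" if "v \<in> ?S" for v
        using proj_S[OF that] by (simp add: chamber_copy_eq)
      fix i
      have "vector_germ point_coords ?S (\<lambda>e. pair_coords (fst e, 0 + gradient C (fst e) (snd e)) i) p"
        by (rule vector_germ_gradient[OF linear_coordinates_point linear_fst linear_snd linear_zero C _ p]) simp
      then show "vector_germ point_coords ?S (\<lambda>v. ?\<psi> (proj v, gradient C (fst v) (snd v)) i) p"
        by (rule vector_germ_cong[OF linear_coordinates_point])
          (simp add: proj_S barrier_family.pair_coords_def[OF bf] append_coords_def copy_point_glued_point[OF C])
    qed simp_all
  qed
  define unproj where "unproj = (\<lambda>(z, \<xi>). (copy_point C z, solve C (copy_point C z) \<xi>))"
  have backward: "real_analytic_map (product_prevariety ?Z' G) ?M' unproj"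
  proof (rule real_analytic_map_if_analytic_at[OF ZG M'])
    fix p assume "p \<in> points (product_prevariety ?Z' G)"
    then obtain q \<xi> where p: "p = (glued_point C q, \<xi>)"
      unfolding points_ZG unfolding chamber_copy_eq by auto
    let ?\<kappa> = "\<lambda>(q, \<xi> :: 'v dual_space). (glued_point C q, \<xi>)"
    have "analytic_at (product_prevariety ?Z' G) ?M' unproj (?\<kappa> (q, \<xi>))"
    proof (rule analytic_at_via_vector_space[OF ZG chart_ZG chart_M' pair, where S = UNIV])
      show "pdim (product_prevariety ?Z' G) = dim (UNIV :: ('v \<times> 'v dual_space) set)"
        by (simp add: pdim_ZG barrier_family.dim_pair[OF bf])
      show "openin (ptop (vector_prevariety :: ('v \<times> 'v dual_space) prevariety)) UNIV"
        unfolding openin_vector[OF pair] linear_coordinates_range[OF pair] by (rule openin_topspace)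
      show "?\<kappa> v \<in> ?U \<times> UNIV" for v
        by (simp add: case_prod_beta chamber_copy_eq)
      show "?\<psi> (?\<kappa> v) = pair_coords v" for v
        by (cases v) (simp add: fun_eq_iff barrier_family.pair_coords_def[OF bf] append_coords_def copy_point_glued_point[OF C])
      show "unproj (?\<kappa> v) \<in> ?S" for v
        using solve_in_fibre[OF C] by (simp add: unproj_def case_prod_beta copy_point_glued_point[OF C])
      fix i assume "i < pdim ?M'"
      then have i: "i < ?d + ?d"
        by (simp add: pdim_M')
      have "vector_germ pair_coords UNIV (\<lambda>v. point_coords (fst v, solve C (fst v) (snd v)) i) (q, \<xi>)"
        by (rule vector_germ_point_coords[OF pair linear_fst barrier_family.solve_analytic[OF bf] i])
      then show "vector_germ pair_coords UNIV (\<lambda>v. point_coords (unproj (?\<kappa> v)) i) (q, \<xi>)"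
        by (simp add: unproj_def case_prod_beta copy_point_glued_point[OF C])
    qed simp
    then show "analytic_at (product_prevariety ?Z' G) ?M' unproj p"
      by (simp add: p)
  qed
  show ?thesis
    unfolding real_analytic_iso_def
  proof (intro conjI exI[of _ unproj] ballI forward backward)
    fix e assume "e \<in> points ?M'"
    then have e: "e \<in> ?S"
      by (simp add: points_M')
    then show "unproj (proj e, gradient C (fst e) (snd e)) = e"
      using solve_gradient[OF C, of "snd e" "fst e"]
      by (simp add: unproj_def proj_S copy_point_glued_point[OF C])
  next
    fix p assume "p \<in> points (product_prevariety ?Z' G)"
    then obtain q \<xi> where p: "p = (glued_point C q, \<xi>)"
      unfolding points_ZG unfolding chamber_copy_eq by auto
    have "unproj p = (q, solve C q \<xi>)"
      by (simp add: unproj_def p copy_point_glued_point[OF C])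
    then show "(proj (unproj p), gradient C (fst (unproj p)) (snd (unproj p))) = p"
      using proj_eq[OF C solve_in_fibre[OF C]] gradient_solve[OF C] by (simp add: p)
  qed
qed

theorem principal_bundle_arrangement:
  "principal_bundle G (complexified_complement f n) (glued_space f n) proj act"
  unfolding principal_bundle_def
proof (intro conjI allI ballI action analytic_proj real_analytic_prevariety_complement
    real_analytic_prevariety_glued_space
    real_analytic_group_vector[OF linear_coordinates_dual(2)[OF coordinates]])
  show "proj (act g e) = proj e" if "e \<in> points (complexified_complement f n)" for g e
    using proj_act that by (simp add: points_complement)
  fix z assume "z \<in> points (glued_space f n)"
  then obtain C where C: "C \<in> chambers f n" and z: "z \<in> chamber_copy f n C"
    by (auto simp: points_glued_space)
  let ?U = "chamber_copy f n C" and ?\<Phi> = "\<lambda>e. (proj e, gradient C (fst e) (snd e))"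
  have "openin (ptop (glued_space f n)) ?U"
    unfolding openin_ptop[OF real_analytic_prevariety_glued_space]
    by (rule atlas_open_chart[OF real_analytic_prevariety_glued_space copy_chart[OF C]])
  moreover have "fst (?\<Phi> e) = proj e \<and> (\<forall>g. ?\<Phi> (act g e) = (proj e, g + snd (?\<Phi> e)))"
    if e: "e \<in> points (complexified_complement f n)" and "proj e \<in> ?U" for e
  proof -
    have e': "e \<in> complement"
      using e by (simp add: points_complement)
    have fib: "snd e \<in> fibre C (fst e)"
      using proj_in_copy_iff[OF e' C] \<open>proj e \<in> ?U\<close> by blast
    then have "gradient C (fst (act g e)) (snd (act g e)) = g + gradient C (fst e) (snd e)" for g
      using act_in_fibre(1,3)[OF C fib, of g] by simp
    then show ?thesis
      by (simp add: proj_act[OF e'])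
  qed
  ultimately show "\<exists>U. openin (ptop (glued_space f n)) U \<and> z \<in> U \<and>
      (\<exists>\<Phi>. real_analytic_iso (open_subprevariety (complexified_complement f n) (proj -` U))
          (product_prevariety (open_subprevariety (glued_space f n) U) G) \<Phi> \<and>
        (\<forall>x\<in>points (complexified_complement f n). proj x \<in> U \<longrightarrow>
          fst (\<Phi> x) = proj x \<and> (\<forall>g. \<Phi> (act g x) = (proj x, g + snd (\<Phi> x)))))"
    using z trivialization[OF C] by (intro exI[of _ ?U] exI[of _ ?\<Phi>] conjI) auto
qed

end

theorem theorem1p1:
  fixes f :: "nat \<Rightarrow> 'v::real_vector \<Rightarrow> real"
    and n d :: nat
    and B :: "'v set"
  assumes "finite B" and "independent B" and "span B = UNIV" and "card B = d"
    and "\<And>j. j \<in> {1..n} \<Longrightarrow> affine_linear (f j)"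
    and "\<And>j. j \<in> {1..n} \<Longrightarrow> \<not> f j constant_on UNIV"
    and "span ((\<lambda>j. linear_form (f j)) ` {1..n}) = (UNIV :: 'v dual_space set)"
  shows "\<exists>\<pi> act. principal_bundle (vector_prevariety :: 'v dual_space prevariety)
           (complexified_complement f n) (glued_space f n) \<pi> act"
proof -
  obtain \<phi> :: "'v \<Rightarrow> nat \<Rightarrow> real" where "linear_coordinates \<phi>"
    using ex_linear_coordinates[OF assms(1-3)] by blast
  then interpret arrangement f n \<phi>
    by unfold_locales (use assms in auto)
  show ?thesis
    using principal_bundle_arrangement by blast
qed

end
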